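(* Assume that $M$ is a local random countable set over the Wiener noise that is stationary-in-law. Let $A\subset 2^{\mathbb{R}}$ be such that $\{M\in A\}\in\mathcal{G}$. Then $\mathsf{W}(M\in A)\in\{0,1\}$.
   Context: $\Omega_0:=\{\omega:\mathbb{R}\to\mathbb{R}\text{ continuous},\ \omega(0)=0\}$, with canonical process $B=(B_t)_{t\in\mathbb{R}}$. $\mathsf{W}$ is the completed two-sided Wiener measure: $(B_t)_{t\ge0}$ and $(B_{-t})_{t\ge 0}$ are independent standard Brownian motions under $\mathsf{W}$; its domain $\mathcal{G}$ is the $\mathsf{W}$-completion of the Borel $\sigma$-field of $\Omega_0$ (locally uniform topology). For extended-real $s<t$, $\mathcal{F}_{s,t}$ is the $\sigma$-field generated by the increments of $B$ between the times $s$ and $t$ and by all events of $\mathsf{W}$-probability $0$ or $1$. $Z_\star\mathsf{W}$ denotes the law of $Z$ under $\mathsf{W}$. $\dagger\notin\mathbb{R}$ is a coffin state; $\mathbb{R}^\dagger:=\mathbb{R}\cup\{\dagger\}$ with the $\sigma$-field generated by the Borel sets of $\mathbb{R}$ and $\{\dagger\}$. For a sequence $s=(s_i)_{i\in\mathbb{N}}$ in $\mathbb{R}^\dagger$, $[s]:=\{s_i:i\in\mathbb{N}\}\setminus\{\dagger\}$. A random set is a map $M:\Omega_0\to 2^{\mathbb{R}}$. For a sub-$\sigma$-field $\mathcal{A}$ of $\mathcal{G}$, an $\mathcal{A}$-measurable enumeration of $M$ is a sequence $S=(S_i)_{i\in\mathbb{N}}$ of $\mathcal{A}$-measurable $\mathbb{R}^\dagger$-valued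 random variables with $M=[S]$ $\mathsf{W}$-a.s.; "measurable enumeration" means $\mathcal{A}=\mathcal{G}$. $M$ is a random countable set if it has a measurable enumeration. Two random countable sets $M,M'$ have the same law if there are measurable enumerations $S$ of $M$ and $S'$ of $M'$ and a coupling $R$ of $S_\star\mathsf{W}$ and $S'_\star\mathsf{W}$ with $[s]=[s']$ for $R$-a.e. $(s,s')$. A random countable set $M$ is: local if for all extended-real $s<t$ the set $M\cap(s,t)$ has an $\mathcal{F}_{s,t}$-measurable enumeration; stationary-in-law if for every $u\in\mathbb{R}$ the sets $M$ and $u+M$ have the same law. *)

theory Defs
  imports "HOL-Probability.Probability"
begin

section \<open>Path space\<close>

definition path_space :: "(real \<Rightarrow> real) set" where
  "path_space = {\<omega>. continuous_on UNIV \<omega> \<and> \<omega> 0 = 0}"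

definition locally_uniform_topology :: "(real \<Rightarrow> real) topology" where
  "locally_uniform_topology = topology (\<lambda>U. U \<subseteq> path_space \<and>
     (\<forall>\<omega>\<in>U. \<exists>K e. compact K \<and> e > 0 \<and>
        {\<omega>'\<in>path_space. \<forall>t\<in>K. \<bar>\<omega>' t - \<omega> t\<bar> < e} \<subseteq> U))"

lemma openin_locally_uniform_topology:
  "openin locally_uniform_topology U \<longleftrightarrow> U \<subseteq> path_space \<and>
     (\<forall>\<omega>\<in>U. \<exists>K e. compact K \<and> e > 0 \<and>
        {\<omega>'\<in>path_space. \<forall>t\<in>K. \<bar>\<omega>' t - \<omega> t\<bar> < e} \<subseteq> U)"
proof -
  define N where "N = (\<lambda>\<omega> K e. {\<omega>'\<in>path_space. \<forall>t\<in>K. \<bar>\<omega>' t - \<omega> t\<bar> < (e::real)})"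
  define Q where "Q = (\<lambda>\<omega> U. \<exists>K e. compact K \<and> e > 0 \<and> N \<omega> K e \<subseteq> U)"
  define P where "P = (\<lambda>U. U \<subseteq> path_space \<and> (\<forall>\<omega>\<in>U. Q \<omega> U))"
  have Q_mono: "Q \<omega> V" if "Q \<omega> U" "U \<subseteq> V" for \<omega> U V
    using that unfolding Q_def by (meson subset_trans)
  have Q_Int: "Q \<omega> (U \<inter> V)" if U: "Q \<omega> U" and V: "Q \<omega> V" for \<omega> U V
  proof -
    obtain K e where K: "compact K" "e > 0" "N \<omega> K e \<subseteq> U"
      using U unfolding Q_def by (elim exE conjE)
    obtain L d where L: "compact L" "d > 0" "N \<omega> L d \<subseteq> V"
      using V unfolding Q_def by (elim exE conjE)
    have "N \<omega> (K \<union> L) (min e d) \<subseteq> N \<omega> K e" "N \<omega> (K \<union> L) (min e d) \<subseteq> N \<omega> L d"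
      unfolding N_def by auto
    then have "N \<omega> (K \<union> L) (min e d) \<subseteq> U \<inter> V"
      using K(3) L(3) by blast
    moreover have "compact (K \<union> L)" "min e d > 0"
      using K(1,2) L(1,2) by (simp_all add: compact_Un)
    ultimately show ?thesis
      unfolding Q_def by (intro exI conjI)
  qed
  have "P (U \<inter> V)" if "P U" "P V" for U V
    using that Q_Int unfolding P_def by (simp add: le_infI1)
  moreover have "P (\<Union>\<U>)" if "\<forall>U\<in>\<U>. P U" for \<U>
    using that unfolding P_def by (metis Q_mono Sup_least UnionE Union_upper)
  ultimately have "istopology P"
    unfolding istopology_def by simp
  then have "openin (topology P) U \<longleftrightarrow> P U"
    by (simp add: topology_inverse')
  then show ?thesis
    unfolding locally_uniform_topology_def P_def Q_def N_def .
qed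

lemma topspace_locally_uniform_topology: "topspace locally_uniform_topology = path_space"
proof
  show "topspace locally_uniform_topology \<subseteq> path_space"
    by (metis openin_locally_uniform_topology openin_topspace)
  have "openin locally_uniform_topology path_space"
    unfolding openin_locally_uniform_topology
    by (auto intro!: exI[of _ "{}"] exI[of _ "1::real"])
  then show "path_space \<subseteq> topspace locally_uniform_topology"
    by (rule openin_subset)
qed

definition path_borel :: "(real \<Rightarrow> real) measure" where
  "path_borel = sigma path_space {U. openin locally_uniform_topology U}"

lemma space_path_borel: "space path_borel = path_space"
  unfolding path_borel_def by (rule space_measure_of_conv)

lemma eval_measurable_path_borel: "(\<lambda>\<omega>. \<omega> t) \<in> borel_measurable path_borel"
proof (rule borel_measurableI)
  fix S :: "real set" assume S: "open S"
  have "openin locally_uniform_topology ((\<lambda>\<omega>. \<omega> t) -` S \<inter> path_space)"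
    unfolding openin_locally_uniform_topology
  proof (intro conjI ballI)
    fix \<omega> assume "\<omega> \<in> (\<lambda>\<omega>. \<omega> t) -` S \<inter> path_space"
    then obtain e where "e > 0" and "\<And>y. dist y (\<omega> t) < e \<Longrightarrow> y \<in> S"
      using S unfolding open_dist by auto
    then show "\<exists>K e. compact K \<and> e > 0 \<and> {\<omega>' \<in> path_space. \<forall>t\<in>K. \<bar>\<omega>' t - \<omega> t\<bar> < e}
        \<subseteq> (\<lambda>\<omega>. \<omega> t) -` S \<inter> path_space"
      by (intro exI[of _ "{t}"] exI[of _ e]) (auto simp: dist_real_def)
  qed auto
  moreover have "{U. openin locally_uniform_topology U} \<subseteq> Pow path_space"
    using openin_subset topspace_locally_uniform_topology by auto
  ultimately show "(\<lambda>\<omega>. \<omega> t) -` S \<inter> space path_borel \<in> sets path_borel"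
    unfolding path_borel_def by (auto intro: in_measure_of simp: space_measure_of_conv)
qed

section \<open>Two-sided Wiener measure\<close>

definition standard_brownian_motion :: "'w measure \<Rightarrow> (real \<Rightarrow> 'w \<Rightarrow> real) \<Rightarrow> bool" where
  "standard_brownian_motion P X \<longleftrightarrow>
     prob_space P \<and>
     (\<forall>t\<ge>0. X t \<in> borel_measurable P) \<and>
     (AE \<omega> in P. X 0 \<omega> = 0) \<and>
     (AE \<omega> in P. continuous_on {0..} (\<lambda>t. X t \<omega>)) \<and>
     (\<forall>s t. 0 \<le> s \<longrightarrow> s < t \<longrightarrow>
        distributed P lborel (\<lambda>\<omega>. X t \<omega> - X s \<omega>) (normal_density 0 (sqrt (t - s)))) \<and>
     (\<forall>(n::nat) \<tau>. 0 \<le> \<tau> 0 \<longrightarrow> (\<forall>i<n. \<tau> i < \<tau> (Suc i)) \<longrightarrow>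
        prob_space.indep_vars P (\<lambda>_. borel) (\<lambda>i \<omega>. X (\<tau> (Suc i)) \<omega> - X (\<tau> i) \<omega>) {..<n})"

text \<open>The properties below determine the measure uniquely; being \<open>the\<close> Wiener measure is therefore
  expressed as a predicate.\<close>

definition two_sided_wiener_measure :: "(real \<Rightarrow> real) measure \<Rightarrow> bool" where
  "two_sided_wiener_measure P \<longleftrightarrow>
     prob_space P \<and> space P = path_space \<and> sets P = sets path_borel \<and>
     standard_brownian_motion P (\<lambda>t \<omega>. \<omega> t) \<and>
     standard_brownian_motion P (\<lambda>t \<omega>. \<omega> (- t)) \<and>
     prob_space.indep_var P
       (Pi\<^sub>M {0..} (\<lambda>_. borel)) (\<lambda>\<omega>. \<lambda>t\<in>{0..}. \<omega> t)
       (Pi\<^sub>M {0..} (\<lambda>_. borel)) (\<lambda>\<omega>. \<lambda>t\<in>{0..}. \<omega> (- t))"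

definition completed_wiener_measure :: "(real \<Rightarrow> real) measure \<Rightarrow> bool" where
  "completed_wiener_measure W \<longleftrightarrow> (\<exists>P. two_sided_wiener_measure P \<and> W = completion P)"

text \<open>A \<open>\<sigma>\<close>-field on the path space is represented by a measure of which only the space and the
  measurable sets matter.\<close>

definition increment_field ::
    "(real \<Rightarrow> real) measure \<Rightarrow> ereal \<Rightarrow> ereal \<Rightarrow> (real \<Rightarrow> real) measure" where
  "increment_field W s t = sigma (space W)
     ({(\<lambda>\<omega>. \<omega> v - \<omega> u) -` E \<inter> space W | u v E.
         s \<le> ereal u \<and> u \<le> v \<and> ereal v \<le> t \<and> E \<in> sets borel} \<union>
      {N \<in> sets W. measure W N = 0 \<or> measure W N = 1})"

lemma subalgebra_increment_field:
  assumes "completed_wiener_measure W"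
  shows "subalgebra W (increment_field W s t)"
proof -
  obtain P where P: "sets P = sets path_borel" "W = completion P"
    using assms unfolding completed_wiener_measure_def two_sided_wiener_measure_def by blast
  have ev: "(\<lambda>\<omega>. \<omega> u) \<in> borel_measurable W" for u
  proof -
    have "(\<lambda>\<omega>. \<omega> u) \<in> borel_measurable P"
      unfolding measurable_cong_sets[OF P(1) refl] by (rule eval_measurable_path_borel)
    then show ?thesis
      unfolding P(2) by (rule measurable_completion)
  qed
  have "(\<lambda>\<omega>. \<omega> v - \<omega> u) -` E \<inter> space W \<in> sets W" if "E \<in> sets borel" for u v and E :: "real set"
    using borel_measurable_diff[OF ev ev] that by (rule measurable_sets)
  then have "sigma_sets (space W)
     ({(\<lambda>\<omega>. \<omega> v - \<omega> u) -` E \<inter> space W | u v E.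
         s \<le> ereal u \<and> u \<le> v \<and> ereal v \<le> t \<and> E \<in> sets borel} \<union>
      {N \<in> sets W. measure W N = 0 \<or> measure W N = 1}) \<subseteq> sets W"
    by (intro sets.sigma_sets_subset) blast
  then show ?thesis
    unfolding subalgebra_def increment_field_def space_measure_of_conv sets_measure_of_conv
    by simp
qed

section \<open>Random countable sets\<close>

text \<open>\<open>None\<close> is the coffin state.\<close>

definition coffin_borel :: "real option measure" where
  "coffin_borel = sigma UNIV ((\<lambda>E. Some ` E) ` sets borel \<union> {{None}})"

abbreviation coffin_seq_borel :: "(nat \<Rightarrow> real option) measure" where
  "coffin_seq_borel \<equiv> Pi\<^sub>M UNIV (\<lambda>_. coffin_borel)"

definition seq_set :: "(nat \<Rightarrow> real option) \<Rightarrow> real set" where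
  "seq_set s = {x. \<exists>i. s i = Some x}"

text \<open>\<open>F\<close> is meant to be a sub-\<open>\<sigma>\<close>-field of \<open>W\<close>; it is only ever \<open>W\<close> itself or an
  \<open>increment_field\<close>. Values of a random set outside \<open>space W\<close> are irrelevant.\<close>

definition measurable_enumeration ::
    "(real \<Rightarrow> real) measure \<Rightarrow> (real \<Rightarrow> real) measure \<Rightarrow> ((real \<Rightarrow> real) \<Rightarrow> real set) \<Rightarrow>
     (nat \<Rightarrow> (real \<Rightarrow> real) \<Rightarrow> real option) \<Rightarrow> bool" where
  "measurable_enumeration W F M S \<longleftrightarrow>
     (\<forall>i. S i \<in> measurable F coffin_borel) \<and> (AE \<omega> in W. M \<omega> = seq_set (\<lambda>i. S i \<omega>))"

definition random_countable_set ::
    "(real \<Rightarrow> real) measure \<Rightarrow> ((real \<Rightarrow> real) \<Rightarrow> real set) \<Rightarrow> bool" where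
  "random_countable_set W M \<longleftrightarrow> (\<exists>S. measurable_enumeration W W M S)"

definition seq_law ::
    "(real \<Rightarrow> real) measure \<Rightarrow> (nat \<Rightarrow> (real \<Rightarrow> real) \<Rightarrow> real option) \<Rightarrow>
     (nat \<Rightarrow> real option) measure" where
  "seq_law W S = distr W coffin_seq_borel (\<lambda>\<omega> i. S i \<omega>)"

definition is_coupling :: "('a \<times> 'b) measure \<Rightarrow> 'a measure \<Rightarrow> 'b measure \<Rightarrow> bool" where
  "is_coupling R \<mu> \<nu> \<longleftrightarrow> prob_space R \<and> sets R = sets (\<mu> \<Otimes>\<^sub>M \<nu>) \<and>
     distr R \<mu> fst = \<mu> \<and> distr R \<nu> snd = \<nu>"

definition same_law ::
    "(real \<Rightarrow> real) measure \<Rightarrow> ((real \<Rightarrow> real) \<Rightarrow> real set) \<Rightarrow> ((real \<Rightarrow> real) \<Rightarrow> real set) \<Rightarrow> bool" where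
  "same_law W M M' \<longleftrightarrow>
     (\<exists>S S' R. measurable_enumeration W W M S \<and> measurable_enumeration W W M' S' \<and>
        is_coupling R (seq_law W S) (seq_law W S') \<and>
        (AE (s, s') in R. seq_set s = seq_set s'))"

definition local_random_set ::
    "(real \<Rightarrow> real) measure \<Rightarrow> ((real \<Rightarrow> real) \<Rightarrow> real set) \<Rightarrow> bool" where
  "local_random_set W M \<longleftrightarrow>
     (\<forall>s t. s < t \<longrightarrow> (\<exists>S. measurable_enumeration W (increment_field W s t)
        (\<lambda>\<omega>. M \<omega> \<inter> {x. s < ereal x \<and> ereal x < t}) S))"

definition stationary_in_law ::
    "(real \<Rightarrow> real) measure \<Rightarrow> ((real \<Rightarrow> real) \<Rightarrow> real set) \<Rightarrow> bool" where
  "stationary_in_law W M \<longleftrightarrow> (\<forall>u. same_law W M (\<lambda>\<omega>. (\<lambda>x. u + x) ` M \<omega>))"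

end

theory Submission
  imports Defs "HOL-Library.Sublist"
begin

text \<open>If \<open>M\<close> is not almost surely empty, the set of outcomes with \<open>M \<in> A\<close> cannot be separated from its
  complement. First, for a Borel set \<open>E\<close> the events that \<open>M\<close> misses \<open>E \<inter> (s, t)\<close> are multiplicative over
  adjacent intervals. As for a Poisson process and a Brownian motion in a common filtration, they
  are independent of the increments of \<open>B\<close>; being determined by these increments, they are trivial. Averaging
  over translates, \<open>M\<close> almost surely hits \<open>E\<close> or almost surely misses it according as \<open>E\<close> has
  positive Lebesgue measure or not. By locality this persists if \<open>E\<close> depends on finitely many points
  of \<open>M\<close>, so an enumeration of \<open>M\<close> behaves like a generic sequence. Finally, if \<open>M \<in> A\<close> and
  \<open>M \<notin> A\<close> both had positive probability, a back-and-forth construction with shrinking events would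
  match the enumerations of \<open>M \<omega>\<close> and \<open>M \<omega>'\<close> for some \<open>\<omega>\<close> in the first and \<open>\<omega>'\<close> in
  the second event, giving \<open>M \<omega> = M \<omega>'\<close>.\<close>

section \<open>Fusion\<close>

text \<open>The family \<open>A\<close> is arbitrary, so \<open>M \<in> A\<close> need not be
  expressible through the law of an enumeration, and a zero-one law for events of the sequence space
  would not reach it. The contradiction has to be pointwise: two actual outcomes whose sets
  coincide. This creates two obstacles. That two matched points are equal is in general a null
  event, so equality cannot be imposed at a finite stage and must emerge in the limit. A decreasing
  sequence of non-null events may have empty intersection, so outcomes are coded by sequences of
  reals and the construction runs inside closed sets all of whose members are codes of outcomes.

  The independence of misses and increments is a comparison of two rates. Cut an interval into
  pieces of length \<open>d\<close>. The probabilities that the pieces are hit have a bounded sum,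
  since the product of the miss probabilities is positive and fixed. Increments larger than a fixed
  threshold cost only order \<open>d^2\<close> per piece. In the limit no hit can be charged to a
  noticeable increment, so the joint characteristic function factorizes.\<close>

text \<open>Half of a Lebesgue decomposition: off \<open>N\<close>, the law of \<open>b\<close> on
  \<open>Q'\<close> is absolutely continuous with respect to the law of \<open>a\<close> on
  \<open>Q\<close>.\<close>

lemma (in finite_measure) maximal_null_event:
  assumes [measurable]: "a \<in> measurable M Y" "b \<in> measurable M Y" "Q \<in> sets M" "Q' \<in> sets M"
  shows "\<exists>N\<in>sets Y. (AE \<omega> in M. \<omega> \<in> Q \<longrightarrow> a \<omega> \<notin> N) \<and>
    (\<forall>N'\<in>sets Y. N' \<inter> N = {} \<longrightarrow> (AE \<omega> in M. \<omega> \<in> Q \<longrightarrow> a \<omega> \<notin> N') \<longrightarrow>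
      (AE \<omega> in M. \<omega> \<in> Q' \<longrightarrow> b \<omega> \<notin> N'))"
proof -
  define \<N> where "\<N> = {N \<in> sets Y. AE \<omega> in M. \<omega> \<in> Q \<longrightarrow> a \<omega> \<notin> N}"
  define m where "m N = measure M {\<omega> \<in> space M. \<omega> \<in> Q' \<and> b \<omega> \<in> N}" for N
  have sets_b [measurable]: "{\<omega> \<in> space M. \<omega> \<in> Q' \<and> b \<omega> \<in> N} \<in> sets M" if [measurable]: "N \<in> sets Y" for N
    by measurable
  have "{} \<in> \<N>"
    unfolding \<N>_def by simp
  have bdd: "bdd_above (m ` \<N>)"
    by (rule bdd_aboveI[of _ "measure M (space M)"]) (auto simp: m_def bounded_measure)
  \<comment> \<open>Exhaustion: a countable union of avoided sets attains the supremum
    \<open>c\<close> of the \<open>b\<close>-masses. A further avoided set of positive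
    \<open>b\<close>-mass, disjoint from it, would exceed \<open>c\<close>.\<close>
  define c where "c = Sup (m ` \<N>)"
  have "\<exists>N\<in>\<N>. m N > c - 1 / Suc n" for n
  proof -
    have "c - 1 / Suc n < c"
      by simp
    then show ?thesis
      using less_cSup_iff[OF _ bdd] \<open>{} \<in> \<N>\<close> unfolding c_def by blast
  qed
  then obtain A where A: "\<And>n. A n \<in> \<N>" "\<And>n. m (A n) > c - 1 / Suc n"
    by metis
  define N where "N = (\<Union>n. A n)"
  have [measurable]: "A n \<in> sets Y" "N \<in> sets Y" for n
    using A(1) unfolding \<N>_def N_def by auto
  have N: "AE \<omega> in M. \<omega> \<in> Q \<longrightarrow> a \<omega> \<notin> N"
  proof -
    have "AE \<omega> in M. \<forall>n. \<omega> \<in> Q \<longrightarrow> a \<omega> \<notin> A n"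
      using A(1) by (intro AE_all_countable[THEN iffD2] allI) (auto simp: \<N>_def)
    then show ?thesis
      by eventually_elim (auto simp: N_def)
  qed
  have "c - 1 / Suc n < m N" for n
  proof -
    have "m (A n) \<le> m N"
      unfolding m_def by (rule finite_measure_mono) (auto simp: N_def)
    with A(2)[of n] show ?thesis
      by linarith
  qed
  moreover have "(\<lambda>n. c - 1 / Suc n) \<longlonglongrightarrow> c - 0"
    by (intro tendsto_diff tendsto_const LIMSEQ_Suc lim_1_over_n)
  ultimately have "c \<le> m N"
    by (intro LIMSEQ_le_const2[where X="\<lambda>n. c - 1 / Suc n"]) (auto intro: less_imp_le)
  show ?thesis
  proof (intro bexI[of _ N] conjI ballI impI N)
    fix N' assume N' [measurable]: "N' \<in> sets Y" and dj: "N' \<inter> N = {}"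
      and "AE \<omega> in M. \<omega> \<in> Q \<longrightarrow> a \<omega> \<notin> N'"
    then have "N \<union> N' \<in> \<N>"
      using N by (auto simp: \<N>_def)
    then have "m (N \<union> N') \<le> c"
      unfolding c_def by (intro cSup_upper bdd) auto
    moreover have "m (N \<union> N') = m N + m N'"
    proof -
      have "{\<omega> \<in> space M. \<omega> \<in> Q' \<and> b \<omega> \<in> N \<union> N'} = {\<omega> \<in> space M. \<omega> \<in> Q' \<and> b \<omega> \<in> N} \<union> {\<omega> \<in> space M. \<omega> \<in> Q' \<and> b \<omega> \<in> N'}"
        by auto
      then show ?thesis
        unfolding m_def using dj by (auto intro!: finite_measure_Union)
    qed
    ultimately have "m N' \<le> 0"
      using \<open>c \<le> m N\<close> by linarith
    then have "measure M {\<omega> \<in> space M. \<omega> \<in> Q' \<and> b \<omega> \<in> N'} = 0"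
      unfolding m_def by (simp add: measure_le_0_iff)
    then have "emeasure M {\<omega> \<in> space M. \<omega> \<in> Q' \<and> b \<omega> \<in> N'} = 0"
      by (simp add: emeasure_eq_measure)
    then show "AE \<omega> in M. \<omega> \<in> Q' \<longrightarrow> b \<omega> \<notin> N'"
      by (subst AE_iff_measurable[OF _ refl]) auto
  qed simp
qed

text \<open>Removing the exceptional sets of both directions leaves a set \<open>G\<close> on which
  the laws are equivalent. Assumption \<open>ns\<close> excludes mutual singularity: if
  \<open>a\<close> avoided \<open>G\<close>, then \<open>G \<union> N1\<close> would be avoided by
  \<open>a\<close> on \<open>Q\<close> and carry all of \<open>b\<close> on
  \<open>Q'\<close>.\<close>

lemma (in finite_measure) restrict_to_equivalent_laws:
  assumes [measurable]: "a \<in> measurable M Y" "b \<in> measurable M Y" "Q \<in> sets M" "Q' \<in> sets M"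
  assumes ns: "\<And>N. N \<in> sets Y \<Longrightarrow> AE \<omega> in M. \<omega> \<in> Q \<longrightarrow> a \<omega> \<notin> N \<Longrightarrow> AE \<omega> in M. \<omega> \<in> Q' \<longrightarrow> b \<omega> \<in> N \<Longrightarrow> False"
  shows "\<exists>G\<in>sets Y. \<not> (AE \<omega> in M. \<omega> \<in> Q \<longrightarrow> a \<omega> \<notin> G) \<and>
    (\<forall>N\<in>sets Y. (AE \<omega> in M. \<omega> \<in> Q \<and> a \<omega> \<in> G \<longrightarrow> a \<omega> \<notin> N) \<longleftrightarrow> (AE \<omega> in M. \<omega> \<in> Q' \<and> b \<omega> \<in> G \<longrightarrow> b \<omega> \<notin> N))"
proof -
  obtain N1 where N1_sets [measurable]: "N1 \<in> sets Y" and N1: "AE \<omega> in M. \<omega> \<in> Q \<longrightarrow> a \<omega> \<notin> N1"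
    "\<forall>N'\<in>sets Y. N' \<inter> N1 = {} \<longrightarrow> (AE \<omega> in M. \<omega> \<in> Q \<longrightarrow> a \<omega> \<notin> N') \<longrightarrow> (AE \<omega> in M. \<omega> \<in> Q' \<longrightarrow> b \<omega> \<notin> N')"
    using maximal_null_event[OF assms(1-4)] by (elim bexE conjE) (rule that)
  obtain N2 where N2_sets [measurable]: "N2 \<in> sets Y" and N2: "AE \<omega> in M. \<omega> \<in> Q' \<longrightarrow> b \<omega> \<notin> N2"
    "\<forall>N'\<in>sets Y. N' \<inter> N2 = {} \<longrightarrow> (AE \<omega> in M. \<omega> \<in> Q' \<longrightarrow> b \<omega> \<notin> N') \<longrightarrow> (AE \<omega> in M. \<omega> \<in> Q \<longrightarrow> a \<omega> \<notin> N')"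
    using maximal_null_event[OF assms(2,1,4,3)] by (elim bexE conjE) (rule that)
  define G where "G = space Y - (N1 \<union> N2)"
  have [measurable]: "G \<in> sets Y"
    unfolding G_def by auto
  have "\<not> (AE \<omega> in M. \<omega> \<in> Q \<longrightarrow> a \<omega> \<notin> G)"
  proof
    assume G: "AE \<omega> in M. \<omega> \<in> Q \<longrightarrow> a \<omega> \<notin> G"
    show False
    proof (rule ns[of "G \<union> N1"])
      show "AE \<omega> in M. \<omega> \<in> Q \<longrightarrow> a \<omega> \<notin> G \<union> N1"
        using G N1(1) by eventually_elim auto
      show "AE \<omega> in M. \<omega> \<in> Q' \<longrightarrow> b \<omega> \<in> G \<union> N1"
        using N2(1) AE_space by eventually_elim (auto simp: G_def dest: measurable_space[OF assms(2)])
    qed auto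
  qed
  moreover have "(AE \<omega> in M. \<omega> \<in> Q \<and> a \<omega> \<in> G \<longrightarrow> a \<omega> \<notin> N) \<longleftrightarrow> (AE \<omega> in M. \<omega> \<in> Q' \<and> b \<omega> \<in> G \<longrightarrow> b \<omega> \<notin> N)"
    if [measurable]: "N \<in> sets Y" for N
  proof
    assume "AE \<omega> in M. \<omega> \<in> Q \<and> a \<omega> \<in> G \<longrightarrow> a \<omega> \<notin> N"
    then have "AE \<omega> in M. \<omega> \<in> Q \<longrightarrow> a \<omega> \<notin> N \<inter> G"
      by eventually_elim auto
    then have "AE \<omega> in M. \<omega> \<in> Q' \<longrightarrow> b \<omega> \<notin> N \<inter> G"
      by (intro N1(2)[rule_format]) (auto simp: G_def)
    then show "AE \<omega> in M. \<omega> \<in> Q' \<and> b \<omega> \<in> G \<longrightarrow> b \<omega> \<notin> N"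
      by eventually_elim auto
  next
    assume "AE \<omega> in M. \<omega> \<in> Q' \<and> b \<omega> \<in> G \<longrightarrow> b \<omega> \<notin> N"
    then have "AE \<omega> in M. \<omega> \<in> Q' \<longrightarrow> b \<omega> \<notin> N \<inter> G"
      by eventually_elim auto
    then have "AE \<omega> in M. \<omega> \<in> Q \<longrightarrow> a \<omega> \<notin> N \<inter> G"
      by (intro N2(2)[rule_format]) (auto simp: G_def)
    then show "AE \<omega> in M. \<omega> \<in> Q \<and> a \<omega> \<in> G \<longrightarrow> a \<omega> \<notin> N"
      by eventually_elim auto
  qed
  ultimately show ?thesis
    by (intro bexI[of _ G]) auto
qed

section \<open>Finite tuples of enumerated points and equivalence of their laws\<close>

text \<open>Padding with zeros puts tuples of every length into one Borel space of
  sequences.\<close>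

definition tuple_of :: "(nat \<Rightarrow> 'a \<Rightarrow> real) \<Rightarrow> nat list \<Rightarrow> 'a \<Rightarrow> nat \<Rightarrow> real" where
  "tuple_of S is \<omega> r = (if r < length is then S (is ! r) \<omega> else 0)"

lemma tuple_of_snoc: "tuple_of S (is @ [i]) \<omega> = (tuple_of S is \<omega>)(length is := S i \<omega>)"
  by (auto simp: tuple_of_def fun_eq_iff nth_append less_Suc_eq)

lemma measurable_tuple_of [measurable]:
  assumes [measurable]: "\<And>i. S i \<in> borel_measurable M"
  shows "tuple_of S is \<in> borel_measurable M"
  by (rule measurable_coordinatewise_then_product) (simp add: tuple_of_def)

text \<open>Genericity with respect to Borel sets of positive measure; the Borel set may depend on finitely many
  points that have already been enumerated.\<close>

definition generic_enumeration :: "'a measure \<Rightarrow> (nat \<Rightarrow> 'a \<Rightarrow> real) \<Rightarrow> bool" where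
  "generic_enumeration M S \<longleftrightarrow> (\<forall>is. \<forall>E\<in>sets ((borel :: (nat \<Rightarrow> real) measure) \<Otimes>\<^sub>M (borel :: real measure)). AE \<omega> in M.
     (emeasure lborel {y. (tuple_of S is \<omega>, y) \<in> E} = 0 \<longrightarrow>
        (\<forall>i. (tuple_of S is \<omega>, S i \<omega>) \<in> E \<longrightarrow> (\<exists>r<length is. S i \<omega> = S (is ! r) \<omega>))) \<and>
     (emeasure lborel {y. (tuple_of S is \<omega>, y) \<in> E} \<noteq> 0 \<longrightarrow> (\<exists>i. (tuple_of S is \<omega>, S i \<omega>) \<in> E)))"

text \<open>Non-nullity is demanded of \<open>Q\<close> alone; the case \<open>N = UNIV\<close>
  transfers it to \<open>Q'\<close>, which makes the relation symmetric.\<close>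

definition equivalent_on ::
    "'a measure \<Rightarrow> (nat \<Rightarrow> 'a \<Rightarrow> real) \<Rightarrow> 'a set \<Rightarrow> 'a set \<Rightarrow> nat list \<Rightarrow> nat list \<Rightarrow> bool" where
  "equivalent_on M S Q Q' is js \<longleftrightarrow> Q \<in> sets M \<and> Q' \<in> sets M \<and> length is = length js \<and>
     \<not> (AE \<omega> in M. \<omega> \<notin> Q) \<and>
     (\<forall>N\<in>sets borel. (AE \<omega> in M. \<omega> \<in> Q \<longrightarrow> tuple_of S is \<omega> \<notin> N) \<longleftrightarrow>
        (AE \<omega> in M. \<omega> \<in> Q' \<longrightarrow> tuple_of S js \<omega> \<notin> N))"

lemma equivalent_onD:
  assumes "equivalent_on M S Q Q' is js" "N \<in> sets borel"
  shows "(AE \<omega> in M. \<omega> \<in> Q \<longrightarrow> tuple_of S is \<omega> \<notin> N) \<longleftrightarrow>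
    (AE \<omega> in M. \<omega> \<in> Q' \<longrightarrow> tuple_of S js \<omega> \<notin> N)"
  using assms unfolding equivalent_on_def by blast

lemma equivalent_on_sym:
  assumes "equivalent_on M S Q Q' is js"
  shows "equivalent_on M S Q' Q js is"
  using assms equivalent_onD[OF assms, of UNIV] unfolding equivalent_on_def by auto

section \<open>Shrinking and extending a matched pair of events\<close>

text \<open>As soon as the two tuple laws are not mutually singular, both events can be cut down to
  the part where the tuples fall into a common set on which the laws are equivalent.\<close>

lemma (in finite_measure) equivalent_on_shrink_aux:
  assumes S [measurable]: "\<And>i. S i \<in> borel_measurable M"
    and [measurable]: "Q \<in> sets M" "Q' \<in> sets M" and len: "length is = length js"
    and ns: "\<And>N. N \<in> sets borel \<Longrightarrow> AE \<omega> in M. \<omega> \<in> Q \<longrightarrow> tuple_of S is \<omega> \<notin> N \<Longrightarrow>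
      AE \<omega> in M. \<omega> \<in> Q' \<longrightarrow> tuple_of S js \<omega> \<in> N \<Longrightarrow> False"
  shows "\<exists>P P'. P \<subseteq> Q \<and> P' \<subseteq> Q' \<and> equivalent_on M S P P' is js"
proof -
  obtain G where [measurable]: "G \<in> sets borel" and G: "\<not> (AE \<omega> in M. \<omega> \<in> Q \<longrightarrow> tuple_of S is \<omega> \<notin> G)"
    "\<And>N. N\<in>sets borel \<Longrightarrow> (AE \<omega> in M. \<omega> \<in> Q \<and> tuple_of S is \<omega> \<in> G \<longrightarrow> tuple_of S is \<omega> \<notin> N) \<longleftrightarrow>
      (AE \<omega> in M. \<omega> \<in> Q' \<and> tuple_of S js \<omega> \<in> G \<longrightarrow> tuple_of S js \<omega> \<notin> N)"
    using restrict_to_equivalent_laws[of "tuple_of S is" borel "tuple_of S js" Q Q'] ns by force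
  define P P' where "P = {\<omega>\<in>space M. \<omega> \<in> Q \<and> tuple_of S is \<omega> \<in> G}"
    and "P' = {\<omega>\<in>space M. \<omega> \<in> Q' \<and> tuple_of S js \<omega> \<in> G}"
  have "P \<in> sets M" "P' \<in> sets M"
    unfolding P_def P'_def by measurable
  moreover have "(AE \<omega> in M. \<omega> \<in> P \<longrightarrow> tuple_of S is \<omega> \<notin> N) \<longleftrightarrow> (AE \<omega> in M. \<omega> \<in> P' \<longrightarrow> tuple_of S js \<omega> \<notin> N)"
    if "N \<in> sets borel" for N
    using G(2)[OF that] unfolding P_def P'_def by (simp cong: AE_cong)
  moreover have "\<not> (AE \<omega> in M. \<omega> \<notin> P)"
    using G(1) unfolding P_def by (simp cong: AE_cong)
  ultimately show ?thesis
    using len by (intro exI[of _ P] exI[of _ P']) (auto simp: equivalent_on_def P_def P'_def)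
qed

text \<open>Cutting \<open>Q\<close> down to a level set of
  \<open>\<lfloor>V \<omega> / e\<rfloor>\<close> bounds the oscillation but may destroy the
  equivalence. The tuple law on the non-null piece is still dominated by the one on
  \<open>Q'\<close>, so the two are not mutually singular and equivalence can be restored.\<close>

lemma (in finite_measure) equivalent_on_shrink:
  assumes S [measurable]: "\<And>i. S i \<in> borel_measurable M" and eqv: "equivalent_on M S Q Q' is js"
    and V [measurable]: "V \<in> borel_measurable M" and "e > 0"
  shows "\<exists>P P'. P \<subseteq> Q \<and> P' \<subseteq> Q' \<and> equivalent_on M S P P' is js \<and> (\<forall>\<omega>\<in>P. \<forall>\<omega>'\<in>P. \<bar>V \<omega> - V \<omega>'\<bar> \<le> (e::real))"
proof -
  have [measurable]: "Q \<in> sets M" "Q' \<in> sets M"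
    using eqv unfolding equivalent_on_def by auto
  have "\<exists>z::int. \<not> (AE \<omega> in M. \<not> (\<omega> \<in> Q \<and> \<lfloor>V \<omega> / e\<rfloor> = z))"
  proof (rule ccontr)
    assume "\<not> ?thesis"
    then have "\<forall>z::int. AE \<omega> in M. \<not> (\<omega> \<in> Q \<and> \<lfloor>V \<omega> / e\<rfloor> = z)"
      by blast
    then have "AE \<omega> in M. \<forall>z::int. \<not> (\<omega> \<in> Q \<and> \<lfloor>V \<omega> / e\<rfloor> = z)"
      by (subst AE_all_countable)
    then have "AE \<omega> in M. \<omega> \<notin> Q"
      by eventually_elim blast
    then show False
      using eqv unfolding equivalent_on_def by auto
  qed
  then obtain z :: int where z: "\<not> (AE \<omega> in M. \<not> (\<omega> \<in> Q \<and> \<lfloor>V \<omega> / e\<rfloor> = z))"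
    by blast
  define R where "R = {\<omega>\<in>space M. \<omega> \<in> Q \<and> \<lfloor>V \<omega> / e\<rfloor> = z}"
  have [measurable]: "R \<in> sets M"
    unfolding R_def by measurable
  have "\<exists>P P'. P \<subseteq> R \<and> P' \<subseteq> Q' \<and> equivalent_on M S P P' is js"
  proof (rule equivalent_on_shrink_aux)
    fix N :: "(nat \<Rightarrow> real) set" assume [measurable]: "N \<in> sets borel" and 1: "AE \<omega> in M. \<omega> \<in> R \<longrightarrow> tuple_of S is \<omega> \<notin> N"
      and 2: "AE \<omega> in M. \<omega> \<in> Q' \<longrightarrow> tuple_of S js \<omega> \<in> N"
    have "AE \<omega> in M. \<omega> \<in> Q \<longrightarrow> tuple_of S is \<omega> \<notin> -N"
      by (subst equivalent_onD[OF eqv]) (use 2 in auto)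
    then have "AE \<omega> in M. \<not> (\<omega> \<in> Q \<and> \<lfloor>V \<omega> / e\<rfloor> = z)"
      using 1 AE_space by eventually_elim (auto simp: R_def)
    then show False
      using z by blast
  qed (use eqv in \<open>auto simp: equivalent_on_def\<close>)
  then obtain P P' where P: "P \<subseteq> R" "P' \<subseteq> Q'" "equivalent_on M S P P' is js"
    by blast
  have "\<bar>V \<omega> - V \<omega>'\<bar> \<le> e" if "\<omega> \<in> P" "\<omega>' \<in> P" for \<omega> \<omega>'
  proof -
    have "\<lfloor>V \<omega> / e\<rfloor> = \<lfloor>V \<omega>' / e\<rfloor>"
      using P(1) that by (auto simp: R_def)
    then have "\<bar>V \<omega> / e - V \<omega>' / e\<bar> \<le> 1"
      by linarith
    then show ?thesis
      using \<open>e > 0\<close> by (simp add: diff_divide_distrib[symmetric] abs_div_pos[symmetric] pos_divide_le_eq)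
  qed
  then show ?thesis
    using P by (intro exI[of _ P] exI[of _ P']) (auto simp: R_def)
qed

lemma (in finite_measure) equivalent_on_shrink_many:
  assumes S: "\<And>i. S i \<in> borel_measurable M" and eqv: "equivalent_on M S Q Q' is js"
    and V: "\<And>c::nat. V c \<in> borel_measurable M" and "e > 0"
  shows "\<exists>P P'. P \<subseteq> Q \<and> P' \<subseteq> Q' \<and> equivalent_on M S P P' is js \<and>
    (\<forall>c<n. (\<forall>\<omega>\<in>P. \<forall>\<omega>'\<in>P. \<bar>V c \<omega> - V c \<omega>'\<bar> \<le> (e::real)) \<and> (\<forall>\<omega>\<in>P'. \<forall>\<omega>'\<in>P'. \<bar>V c \<omega> - V c \<omega>'\<bar> \<le> e))"
proof (induction n)
  case 0
  then show ?case
    using eqv by auto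
next
  case (Suc n)
  then obtain P P' where P: "P \<subseteq> Q" "P' \<subseteq> Q'" "equivalent_on M S P P' is js"
    "\<forall>c<n. (\<forall>\<omega>\<in>P. \<forall>\<omega>'\<in>P. \<bar>V c \<omega> - V c \<omega>'\<bar> \<le> e) \<and> (\<forall>\<omega>\<in>P'. \<forall>\<omega>'\<in>P'. \<bar>V c \<omega> - V c \<omega>'\<bar> \<le> e)"
    by blast
  obtain R R' where R: "R \<subseteq> P" "R' \<subseteq> P'" "equivalent_on M S R R' is js"
    "\<forall>\<omega>\<in>R. \<forall>\<omega>'\<in>R. \<bar>V n \<omega> - V n \<omega>'\<bar> \<le> e"
    using equivalent_on_shrink[OF S P(3) V \<open>e > 0\<close>, of n] by blast
  \<comment> \<open>The second round exchanges the two events, so that \<open>V n\<close> is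
    controlled on the other side as well.\<close>
  obtain T T' where T: "T \<subseteq> R'" "T' \<subseteq> R" "equivalent_on M S T T' js is"
    "\<forall>\<omega>\<in>T. \<forall>\<omega>'\<in>T. \<bar>V n \<omega> - V n \<omega>'\<bar> \<le> e"
    using equivalent_on_shrink[OF S equivalent_on_sym[OF R(3)] V \<open>e > 0\<close>, of n] by blast
  have "T' \<subseteq> P" "T \<subseteq> P'"
    using R T by auto
  then have "\<forall>c<Suc n. (\<forall>\<omega>\<in>T'. \<forall>\<omega>'\<in>T'. \<bar>V c \<omega> - V c \<omega>'\<bar> \<le> e) \<and> (\<forall>\<omega>\<in>T. \<forall>\<omega>'\<in>T. \<bar>V c \<omega> - V c \<omega>'\<bar> \<le> e)"
    using P(4) R(4) T(2,4) by (simp add: less_Suc_eq subset_iff)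
  moreover have "T' \<subseteq> Q" "T \<subseteq> Q'"
    using \<open>T' \<subseteq> P\<close> \<open>T \<subseteq> P'\<close> P by auto
  ultimately show ?case
    using equivalent_on_sym[OF T(3)] by blast
qed

text \<open>If no \<open>j\<close> were a partner for \<open>i\<close>, sets \<open>N j\<close>
  would separate the extended tuples for every \<open>j\<close>, and all extensions outside the
  \<open>N j\<close> would form a Borel set \<open>E\<close> hit by \<open>S i\<close> on
  \<open>Q\<close> and by no \<open>S j\<close> on \<open>Q'\<close>. Genericity makes the sections
  of \<open>E\<close> Lebesgue null on \<open>Q'\<close>, equivalence carries this to
  \<open>Q\<close>, and genericity on \<open>Q\<close> forces \<open>S i\<close> to repeat an
  earlier point. The partner of that point then lies in \<open>E\<close> on \<open>Q'\<close>, which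
  is impossible.\<close>

lemma (in finite_measure) equivalent_on_match:
  assumes S [measurable]: "\<And>i. S i \<in> borel_measurable M" and gen: "generic_enumeration M S"
    and eqv: "equivalent_on M S Q Q' is js"
  shows "\<exists>P P' j. P \<subseteq> Q \<and> P' \<subseteq> Q' \<and> equivalent_on M S P P' (is @ [i]) (js @ [j])"
proof (rule ccontr)
  assume neg: "\<not> ?thesis"
  have [measurable]: "Q \<in> sets M" "Q' \<in> sets M" and len: "length is = length js"
    and pos: "\<not> (AE \<omega> in M. \<omega> \<notin> Q)"
    using eqv unfolding equivalent_on_def by auto
  have "\<exists>N. N \<in> sets borel \<and> (AE \<omega> in M. \<omega> \<in> Q \<longrightarrow> tuple_of S (is @ [i]) \<omega> \<notin> N) \<and>
      (AE \<omega> in M. \<omega> \<in> Q' \<longrightarrow> tuple_of S (js @ [j]) \<omega> \<in> N)" for j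
  proof (rule ccontr)
    assume "\<not> ?thesis"
    then have "\<exists>P P'. P \<subseteq> Q \<and> P' \<subseteq> Q' \<and> equivalent_on M S P P' (is @ [i]) (js @ [j])"
      using len by (intro equivalent_on_shrink_aux) auto
    with neg show False
      by blast
  qed
  then have "\<exists>N. \<forall>j. N j \<in> sets borel \<and> (AE \<omega> in M. \<omega> \<in> Q \<longrightarrow> tuple_of S (is @ [i]) \<omega> \<notin> N j) \<and>
      (AE \<omega> in M. \<omega> \<in> Q' \<longrightarrow> tuple_of S (js @ [j]) \<omega> \<in> N j)"
    by (intro choice allI)
  then obtain N where N [measurable]: "\<And>j. N j \<in> sets borel"
    and N1: "\<And>j. AE \<omega> in M. \<omega> \<in> Q \<longrightarrow> tuple_of S (is @ [i]) \<omega> \<notin> N j"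
    and N2: "\<And>j. AE \<omega> in M. \<omega> \<in> Q' \<longrightarrow> tuple_of S (js @ [j]) \<omega> \<in> N j"
    by blast
  define k where "k = length is"
  define E where "E = {(x, y) | x y. \<forall>j::nat. x(k := y) \<notin> N j}"
  have upd [measurable]: "(\<lambda>z. (fst z)(k := snd z)) \<in> measurable ((borel :: (nat \<Rightarrow> real) measure) \<Otimes>\<^sub>M borel) borel"
  proof (rule measurable_coordinatewise_then_product)
    fix r
    have "(\<lambda>x. x r) \<in> borel_measurable (borel :: (nat \<Rightarrow> real) measure)"
      by (intro borel_measurable_continuous_onI continuous_on_product_coordinates)
    then show "(\<lambda>z. ((fst z)(k := snd z)) r) \<in> borel_measurable ((borel :: (nat \<Rightarrow> real) measure) \<Otimes>\<^sub>M borel)"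
      by (cases "r = k") (auto intro: measurable_compose[OF measurable_fst])
  qed
  have "E = {z \<in> space (borel \<Otimes>\<^sub>M borel). \<forall>j. (fst z)(k := snd z) \<notin> N j}"
    by (auto simp: E_def space_pair_measure)
  then have E [measurable]: "E \<in> sets (borel \<Otimes>\<^sub>M borel)"
    by simp
  have EQ: "AE \<omega> in M. \<omega> \<in> Q \<longrightarrow> (tuple_of S is \<omega>, S i \<omega>) \<in> E"
  proof -
    have "AE \<omega> in M. \<forall>j. \<omega> \<in> Q \<longrightarrow> tuple_of S (is @ [i]) \<omega> \<notin> N j"
      using N1 by (subst AE_all_countable) blast
    then show ?thesis
      by eventually_elim (auto simp: E_def tuple_of_snoc k_def)
  qed
  have EQ': "AE \<omega> in M. \<omega> \<in> Q' \<longrightarrow> (\<forall>j. (tuple_of S js \<omega>, S j \<omega>) \<notin> E)"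
  proof -
    have "AE \<omega> in M. \<forall>j. \<omega> \<in> Q' \<longrightarrow> tuple_of S (js @ [j]) \<omega> \<in> N j"
      using N2 by (subst AE_all_countable) blast
    then show ?thesis
      by eventually_elim (auto simp: E_def tuple_of_snoc k_def len)
  qed
  \<comment> \<open>That the section of \<open>E\<close> has positive measure is a Borel condition
    on the tuple alone, so the equivalence of tuple laws applies to it.\<close>
  define B where "B = {x. emeasure lborel {y. (x, y) \<in> E} \<noteq> 0}"
  have [measurable]: "B \<in> sets borel"
  proof -
    have "E \<in> sets (borel \<Otimes>\<^sub>M lborel)"
      using E by (simp cong: sets_pair_measure_cong)
    then have "(\<lambda>x. emeasure lborel (Pair x -` E)) \<in> borel_measurable borel"
      by (rule lborel.measurable_emeasure_Pair)
    then have "{x \<in> space borel. emeasure lborel (Pair x -` E) \<noteq> 0} \<in> sets borel"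
      by measurable
    then show ?thesis
      by (simp add: B_def vimage_def)
  qed
  have "AE \<omega> in M. \<omega> \<in> Q' \<longrightarrow> tuple_of S js \<omega> \<notin> B"
    using gen[unfolded generic_enumeration_def, rule_format, OF E, of js] EQ'
    by eventually_elim (auto simp: B_def)
  then have "AE \<omega> in M. \<omega> \<in> Q \<longrightarrow> tuple_of S is \<omega> \<notin> B"
    by (subst equivalent_onD[OF eqv]) auto
  then have hit: "AE \<omega> in M. \<omega> \<in> Q \<longrightarrow> (\<exists>r<k. S i \<omega> = S (is ! r) \<omega>)"
    using gen[unfolded generic_enumeration_def, rule_format, OF E, of "is"] EQ
    by eventually_elim (auto simp: B_def k_def)
  \<comment> \<open>The remaining case, a repeated point: that \<open>E\<close> contains coordinate
    \<open>r\<close> over the tuple is again a Borel condition on the tuple. On \<open>Q'\<close> it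
    fails, since coordinate \<open>r\<close> is the point \<open>S (js ! r)\<close>.\<close>
  define D where "D r = {x. (x, x r) \<in> E}" for r :: nat
  have [measurable]: "D r \<in> sets borel" for r
  proof -
    have "(\<lambda>x. x r) \<in> borel_measurable (borel :: (nat \<Rightarrow> real) measure)"
      by (intro borel_measurable_continuous_onI continuous_on_product_coordinates)
    then have "(\<lambda>x. (x, x r)) \<in> measurable (borel :: (nat \<Rightarrow> real) measure) (borel \<Otimes>\<^sub>M borel)"
      by measurable
    from measurable_sets[OF this E] show ?thesis
      by (simp add: D_def vimage_def)
  qed
  have "AE \<omega> in M. \<omega> \<in> Q \<longrightarrow> tuple_of S is \<omega> \<notin> D r" if "r < k" for r
  proof (subst equivalent_onD[OF eqv])
    show "AE \<omega> in M. \<omega> \<in> Q' \<longrightarrow> tuple_of S js \<omega> \<notin> D r"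
      using EQ' by eventually_elim (use that len in \<open>auto simp: D_def k_def tuple_of_def\<close>)
  qed simp
  then have "AE \<omega> in M. \<forall>r. r < k \<longrightarrow> \<omega> \<in> Q \<longrightarrow> tuple_of S is \<omega> \<notin> D r"
    by (simp add: AE_all_countable)
  then have "AE \<omega> in M. \<omega> \<notin> Q"
    using hit EQ
  proof eventually_elim
    case (elim \<omega>)
    show ?case
    proof
      assume Q: "\<omega> \<in> Q"
      with elim(2) obtain r where r: "r < k" "S i \<omega> = S (is ! r) \<omega>"
        by blast
      then have "S i \<omega> = tuple_of S is \<omega> r"
        by (simp add: tuple_of_def k_def)
      with Q r elim(1,3) show False
        by (auto simp: D_def)
    qed
  qed
  with pos show False
    by blast
qed

section \<open>Back-and-forth iteration and its limit\<close>

text \<open>One round at stage \<open>n\<close>: index \<open>n\<close> receives a partner in both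
  directions, and the first \<open>n\<close> coordinates are nearly frozen, which makes every
  coordinate converge along the iteration.\<close>

lemma (in finite_measure) equivalent_on_step:
  assumes S: "\<And>i. S i \<in> borel_measurable M" and gen: "generic_enumeration M S"
    and V: "\<And>c::nat. V c \<in> borel_measurable M" and eqv: "equivalent_on M S Q Q' is js"
  shows "\<exists>P P' is' js'. equivalent_on M S P P' is' js' \<and> P \<subseteq> Q \<and> P' \<subseteq> Q' \<and>
    prefix is is' \<and> prefix js js' \<and> n \<in> set is' \<and> n \<in> set js' \<and>
    (\<forall>c<n. (\<forall>\<omega>\<in>P. \<forall>\<omega>'\<in>P. \<bar>V c \<omega> - V c \<omega>'\<bar> \<le> 1 / Suc n) \<and> (\<forall>\<omega>\<in>P'. \<forall>\<omega>'\<in>P'. \<bar>V c \<omega> - V c \<omega>'\<bar> \<le> 1 / Suc n))"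
proof -
  obtain P P' j where P: "P \<subseteq> Q" "P' \<subseteq> Q'" "equivalent_on M S P P' (is @ [n]) (js @ [j])"
    using equivalent_on_match[OF S gen eqv] by blast
  obtain R R' i where R: "R \<subseteq> P'" "R' \<subseteq> P" "equivalent_on M S R R' ((js @ [j]) @ [n]) ((is @ [n]) @ [i])"
    using equivalent_on_match[OF S gen equivalent_on_sym[OF P(3)]] by blast
  obtain T T' where T: "T \<subseteq> R'" "T' \<subseteq> R" "equivalent_on M S T T' ((is @ [n]) @ [i]) ((js @ [j]) @ [n])"
    "\<forall>c<n. (\<forall>\<omega>\<in>T. \<forall>\<omega>'\<in>T. \<bar>V c \<omega> - V c \<omega>'\<bar> \<le> 1 / Suc n) \<and> (\<forall>\<omega>\<in>T'. \<forall>\<omega>'\<in>T'. \<bar>V c \<omega> - V c \<omega>'\<bar> \<le> 1 / Suc n)"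
    using equivalent_on_shrink_many[where V = V and e = "1 / Suc n" and n = n, OF S equivalent_on_sym[OF R(3)] V] by auto
  show ?thesis
    using T P R by (intro exI[of _ T] exI[of _ T'] exI[of _ "(is @ [n]) @ [i]"] exI[of _ "(js @ [j]) @ [n]"]) auto
qed

lemma tendsto_coordinatewise:
  fixes f :: "nat \<Rightarrow> 'b \<Rightarrow> 'c :: topological_space"
  assumes "\<And>c. (\<lambda>n. f n c) \<longlonglongrightarrow> x c"
  shows "f \<longlonglongrightarrow> x"
  using assms by (simp flip: limitin_canonical_iff add: euclidean_product_topology[symmetric] limitin_componentwise)

text \<open>The condition kept along the construction is that, on the current events \<open>Q\<close> and \<open>Q'\<close>, the laws
  of the tuples matched so far are mutually absolutely continuous. This is the substitute for
  conditioning on the matched points being equal.\<close>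

proposition (in prob_space) fusion:
  fixes V :: "nat \<Rightarrow> 'a \<Rightarrow> real" and s :: "nat \<Rightarrow> nat"
  assumes V [measurable]: "\<And>c. V c \<in> borel_measurable M" and gen: "generic_enumeration M (\<lambda>i. V (s i))"
    and [measurable]: "Q \<in> sets M" "Q' \<in> sets M" and pos: "\<not> (AE \<omega> in M. \<omega> \<notin> Q)" "\<not> (AE \<omega> in M. \<omega> \<notin> Q')"
  shows "\<exists>x y. x \<in> closure ((\<lambda>\<omega> c. V c \<omega>) ` Q) \<and> y \<in> closure ((\<lambda>\<omega> c. V c \<omega>) ` Q') \<and>
    (\<forall>i. \<exists>j. x (s i) = y (s j)) \<and> (\<forall>j. \<exists>i. x (s i) = y (s j))"
proof -
  define S where "S i = V (s i)" for i
  have S [measurable]: "\<And>i. S i \<in> borel_measurable M"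
    unfolding S_def by simp
  have gen: "generic_enumeration M S"
    using gen unfolding S_def[abs_def] .
  \<comment> \<open>The empty tuple is the constant sequence \<open>0\<close> on both sides, so
    initial equivalence only says that both events are non-null.\<close>
  have "(AE \<omega> in M. \<omega> \<in> Q \<longrightarrow> tuple_of S [] \<omega> \<notin> N) \<longleftrightarrow> (AE \<omega> in M. \<omega> \<in> Q' \<longrightarrow> tuple_of S [] \<omega> \<notin> N)" for N
    using pos by (cases "(\<lambda>_. 0) \<in> N") (simp_all add: tuple_of_def[abs_def])
  then have init: "equivalent_on M S Q Q' [] []"
    using pos by (simp add: equivalent_on_def)
  define I where "I n p \<longleftrightarrow> (case p of (P, P', is, js) \<Rightarrow> equivalent_on M S P P' is js \<and> P \<subseteq> Q \<and> P' \<subseteq> Q')"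
    for n :: nat and p
  define J where "J n p p' \<longleftrightarrow> (case p of (P, P', is, js) \<Rightarrow> case p' of (T, T', is', js') \<Rightarrow> T \<subseteq> P \<and> T' \<subseteq> P' \<and>
    prefix is is' \<and> prefix js js' \<and> n \<in> set is' \<and> n \<in> set js' \<and>
    (\<forall>c<n. (\<forall>\<omega>\<in>T. \<forall>\<omega>'\<in>T. \<bar>V c \<omega> - V c \<omega>'\<bar> \<le> 1 / Suc n) \<and> (\<forall>\<omega>\<in>T'. \<forall>\<omega>'\<in>T'. \<bar>V c \<omega> - V c \<omega>'\<bar> \<le> 1 / Suc n)))"
    for n p p'
  have "\<exists>p. \<forall>n. I n (p n) \<and> J n (p n) (p (Suc n))"
  proof (rule dependent_nat_choice)
    show "\<exists>p. I 0 p"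
      using init unfolding I_def by (intro exI[of _ "(Q, Q', [], [])"]) simp
  next
    fix p n assume p: "I n p"
    obtain P P' "is" js where p_eq: "p = (P, P', is, js)"
      using prod_cases4 by blast
    have eqv: "equivalent_on M S P P' is js" and sub: "P \<subseteq> Q" "P' \<subseteq> Q'"
      using p unfolding p_eq I_def by auto
    obtain T T' is' js' where T: "equivalent_on M S T T' is' js' \<and> T \<subseteq> P \<and> T' \<subseteq> P' \<and>
    prefix is is' \<and> prefix js js' \<and> n \<in> set is' \<and> n \<in> set js' \<and>
    (\<forall>c<n. (\<forall>\<omega>\<in>T. \<forall>\<omega>'\<in>T. \<bar>V c \<omega> - V c \<omega>'\<bar> \<le> 1 / Suc n) \<and> (\<forall>\<omega>\<in>T'. \<forall>\<omega>'\<in>T'. \<bar>V c \<omega> - V c \<omega>'\<bar> \<le> 1 / Suc n))"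
      using equivalent_on_step[where V = V and n = n, OF S gen V eqv] by (elim exE) (rule that)
    show "\<exists>p'. I (Suc n) p' \<and> J n p p'"
      unfolding p_eq I_def J_def using T sub by (intro exI[of _ "(T, T', is', js')"]) auto
  qed
  then obtain p where p: "\<And>n. I n (p n)" "\<And>n. J n (p n) (p (Suc n))"
    by blast
  define P P' i' j' where "P n = fst (p n)" and "P' n = fst (snd (p n))"
    and "i' n = fst (snd (snd (p n)))" and "j' n = snd (snd (snd (p n)))" for n
  have p_eq: "p n = (P n, P' n, i' n, j' n)" for n
    by (simp add: P_def P'_def i'_def j'_def)
  have eqv: "equivalent_on M S (P n) (P' n) (i' n) (j' n)" and sub: "P n \<subseteq> Q" "P' n \<subseteq> Q'" for n
    using p(1)[of n] unfolding I_def p_eq by auto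
  have dec: "P (Suc n) \<subseteq> P n" "P' (Suc n) \<subseteq> P' n" and pre: "prefix (i' n) (i' (Suc n))" "prefix (j' n) (j' (Suc n))"
    and mem: "n \<in> set (i' (Suc n))" "n \<in> set (j' (Suc n))"
    and osc: "\<And>c \<omega> \<omega>'. c < n \<Longrightarrow> \<omega> \<in> P (Suc n) \<Longrightarrow> \<omega>' \<in> P (Suc n) \<Longrightarrow> \<bar>V c \<omega> - V c \<omega>'\<bar> \<le> 1 / Suc n"
      "\<And>c \<omega> \<omega>'. c < n \<Longrightarrow> \<omega> \<in> P' (Suc n) \<Longrightarrow> \<omega>' \<in> P' (Suc n) \<Longrightarrow> \<bar>V c \<omega> - V c \<omega>'\<bar> \<le> 1 / Suc n" for n
    using p(2)[of n] unfolding J_def p_eq by auto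
  \<comment> \<open>The events \<open>R n\<close> may have empty intersection. Only a coordinatewise
    limit of values is available, hence the closure.\<close>
  have limit: "\<exists>x. x \<in> closure ((\<lambda>\<omega> c. V c \<omega>) ` R 0) \<and> (\<forall>c n. c < n \<longrightarrow> (\<forall>\<omega>\<in>R (Suc n). \<bar>V c \<omega> - x c\<bar> \<le> 1 / Suc n))"
    if dec: "\<And>n. R (Suc n) \<subseteq> R n" and ne: "\<And>n. R n \<noteq> {}"
      and osc: "\<And>n c \<omega> \<omega>'. c < n \<Longrightarrow> \<omega> \<in> R (Suc n) \<Longrightarrow> \<omega>' \<in> R (Suc n) \<Longrightarrow> \<bar>V c \<omega> - V c \<omega>'\<bar> \<le> 1 / Suc n"
    for R :: "nat \<Rightarrow> 'a set"
  proof -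
    define z where "z n = (SOME \<omega>. \<omega> \<in> R n)" for n
    have z: "z n \<in> R n" for n
      unfolding z_def using ne[of n] by (simp add: some_in_eq)
    have anti: "R m \<subseteq> R n" if "n \<le> m" for m n
      using lift_Suc_antimono_le[of R, OF dec that] .
    have "Cauchy (\<lambda>n. V c (z n))" for c
    proof (rule CauchyI')
      fix e :: real assume "e > 0"
      then obtain N where "1 / Suc N < e"
        using nat_approx_posE by blast
      define L where "L = max (Suc c) N"
      have "1 / Suc L \<le> 1 / Suc N" "c < L"
        by (simp_all add: L_def frac_le)
      have "dist (V c (z m)) (V c (z n)) < e" if "m \<ge> Suc L" "n > m" for m n
      proof -
        have "z m \<in> R (Suc L)" "z n \<in> R (Suc L)"
          using z[of m] z[of n] anti[of "Suc L" m] anti[of "Suc L" n] that by auto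
        then show ?thesis
          using osc[of c L "z m" "z n"] \<open>1 / Suc L \<le> 1 / Suc N\<close> \<open>1 / Suc N < e\<close> \<open>c < L\<close> by (simp add: dist_real_def)
      qed
      then show "\<exists>M. \<forall>m\<ge>M. \<forall>n>m. dist (V c (z m)) (V c (z n)) < e"
        by blast
    qed
    then have "\<exists>x. (\<lambda>n. V c (z n)) \<longlonglongrightarrow> x" for c
      by (simp add: Cauchy_convergent_iff convergent_def)
    then obtain x where x: "\<And>c. (\<lambda>n. V c (z n)) \<longlonglongrightarrow> x c"
      by metis
    have "(\<lambda>n c. V c (z n)) \<longlonglongrightarrow> x"
      by (rule tendsto_coordinatewise) (rule x)
    moreover have "(\<lambda>c. V c (z n)) \<in> (\<lambda>\<omega> c. V c \<omega>) ` R 0" for n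
      using z[of n] anti[of 0 n] by auto
    ultimately have "x \<in> closure ((\<lambda>\<omega> c. V c \<omega>) ` R 0)"
      unfolding closure_sequential by (intro exI[of _ "\<lambda>n c. V c (z n)"] conjI allI)
    moreover have "\<bar>V c \<omega> - x c\<bar> \<le> 1 / Suc n" if "c < n" "\<omega> \<in> R (Suc n)" for c n \<omega>
    proof (rule LIMSEQ_le_const2)
      show "(\<lambda>m. \<bar>V c \<omega> - V c (z m)\<bar>) \<longlonglongrightarrow> \<bar>V c \<omega> - x c\<bar>"
        by (intro tendsto_intros x)
      show "\<exists>N. \<forall>m\<ge>N. \<bar>V c \<omega> - V c (z m)\<bar> \<le> 1 / Suc n"
        using osc[OF that] z anti by blast
    qed
    ultimately show ?thesis
      by blast
  qed
  have ne: "P n \<noteq> {}" "P' n \<noteq> {}" for n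
    using eqv[of n] equivalent_on_sym[OF eqv[of n]] by (auto simp: equivalent_on_def)
  obtain x where x: "x \<in> closure ((\<lambda>\<omega> c. V c \<omega>) ` P 0)"
    "\<And>c n \<omega>. c < n \<Longrightarrow> \<omega> \<in> P (Suc n) \<Longrightarrow> \<bar>V c \<omega> - x c\<bar> \<le> 1 / Suc n"
    using limit[of P, OF dec(1) ne(1) osc(1)] by blast
  obtain y where y: "y \<in> closure ((\<lambda>\<omega> c. V c \<omega>) ` P' 0)"
    "\<And>c n \<omega>. c < n \<Longrightarrow> \<omega> \<in> P' (Suc n) \<Longrightarrow> \<bar>V c \<omega> - y c\<bar> \<le> 1 / Suc n"
    using limit[of P', OF dec(2) ne(2) osc(2)] by blast
  have pre_le: "prefix (i' m) (i' n)" "prefix (j' m) (j' n)" if "m \<le> n" for m n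
    using that by (induction rule: dec_induct) (auto intro: pre prefix_order.trans)
  \<comment> \<open>Here equality of the matched points emerges: tuples with equivalent laws charge
    the same closed set \<open>N\<close> of sequences whose coordinate \<open>r\<close> is close to
    a given value.\<close>
  have matched: "x (s (i' m ! r)) = y (s (j' m ! r))" if r: "r < length (i' m)" for m r
  proof -
    define a b where "a = i' m ! r" and "b = j' m ! r"
    have len: "length (i' n) = length (j' n)" for n
      using eqv[of n] by (simp add: equivalent_on_def)
    \<comment> \<open>The three terms are: \<open>x\<close> to \<open>\<omega>1\<close>, coordinate
      \<open>a\<close> at \<open>\<omega>1\<close> to coordinate \<open>b\<close> at
      \<open>\<omega>2\<close>, and \<open>\<omega>2\<close> to \<open>y\<close>.\<close>
    have "\<bar>x (s a) - y (s b)\<bar> \<le> 3 * (1 / Suc n)" if n: "n \<ge> m" "s a < n" "s b < n" for n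
    proof -
      let ?k = "Suc n"
      have nth: "r < length (i' ?k)" "i' ?k ! r = a" "j' ?k ! r = b"
        using pre_le[of m ?k] n(1) r len[of m] by (auto simp: prefix_def a_def b_def nth_append)
      obtain \<omega>1 where w1: "\<omega>1 \<in> P ?k"
        using ne by blast
      define N where "N = {u :: nat \<Rightarrow> real. \<bar>u r - S a \<omega>1\<bar> \<le> 1 / Suc n}"
      have [measurable]: "N \<in> sets borel"
        unfolding N_def by (intro borel_closed closed_Collect_le continuous_intros continuous_on_product_coordinates)
      have in_N: "tuple_of S (i' ?k) \<omega> \<in> N" if "\<omega> \<in> P ?k" for \<omega>
        using osc(1)[OF n(2) that w1] nth by (simp add: N_def tuple_of_def S_def)
      have "\<not> (AE \<omega> in M. \<omega> \<in> P ?k \<longrightarrow> tuple_of S (i' ?k) \<omega> \<notin> N)"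
      proof
        assume "AE \<omega> in M. \<omega> \<in> P ?k \<longrightarrow> tuple_of S (i' ?k) \<omega> \<notin> N"
        then have "AE \<omega> in M. \<omega> \<notin> P ?k"
          by eventually_elim (use in_N in blast)
        then show False
          using eqv[of ?k] by (simp add: equivalent_on_def)
      qed
      then have "\<not> (AE \<omega> in M. \<omega> \<in> P' ?k \<longrightarrow> tuple_of S (j' ?k) \<omega> \<notin> N)"
        by (subst (asm) equivalent_onD[OF eqv]) auto
      then obtain \<omega>2 where w2: "\<omega>2 \<in> P' ?k" "tuple_of S (j' ?k) \<omega>2 \<in> N"
        by (metis (mono_tags, lifting) AE_I2)
      then have "\<bar>V (s b) \<omega>2 - V (s a) \<omega>1\<bar> \<le> 1 / Suc n"
        using nth len[of ?k] by (simp add: N_def tuple_of_def S_def)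
      then show ?thesis
        using x(2)[OF n(2) w1] y(2)[OF n(3) w2(1)] by linarith
    qed
    then have "eventually (\<lambda>n. \<bar>x (s a) - y (s b)\<bar> \<le> 3 * (1 / Suc n)) sequentially"
      by (intro eventually_sequentiallyI[of "max m (max (Suc (s a)) (Suc (s b)))"]) auto
    moreover have "(\<lambda>n. 3 * (1 / Suc n)) \<longlonglongrightarrow> 3 * (0::real)"
      by (intro tendsto_mult tendsto_const LIMSEQ_Suc lim_1_over_n)
    ultimately have "\<bar>x (s a) - y (s b)\<bar> \<le> 3 * 0"
      by (intro tendsto_lowerbound[where F=sequentially]) auto
    then show ?thesis
      by (simp add: a_def b_def)
  qed
  have "\<exists>j. x (s i) = y (s j)" for i
    using mem(1)[of i] matched by (metis in_set_conv_nth)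
  moreover have "\<exists>i. x (s i) = y (s j)" for j
  proof -
    have "length (i' (Suc j)) = length (j' (Suc j))"
      using eqv[of "Suc j"] by (simp add: equivalent_on_def)
    then show ?thesis
      using mem(2)[of j] matched by (metis in_set_conv_nth)
  qed
  moreover have "x \<in> closure ((\<lambda>\<omega> c. V c \<omega>) ` Q)" "y \<in> closure ((\<lambda>\<omega> c. V c \<omega>) ` Q')"
    using x(1) y(1) sub[of 0] closure_mono[OF image_mono] by blast+
  ultimately show ?thesis
    by blast
qed

section \<open>Path space as a Borel set of sequences\<close>

definition rat_enum :: "nat \<Rightarrow> real" where
  "rat_enum n = real_of_rat (from_nat n)"

lemma range_rat_enum: "range rat_enum = \<rat>"
proof -
  have "range (from_nat :: nat \<Rightarrow> rat) = UNIV"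
    using surj_def from_nat_to_nat by (metis surjI)
  then show ?thesis
    unfolding rat_enum_def Rats_def by (metis image_image)
qed

lemma rat_enum_between: "(a::real) < b \<Longrightarrow> \<exists>i. a < rat_enum i \<and> rat_enum i < b"
  using Rats_dense_in_real[of a b] range_rat_enum by (metis imageE)

lemma real_eqI_rat_less:
  assumes "\<And>i. x < rat_enum i \<longleftrightarrow> y < rat_enum i"
  shows "x = (y::real)"
proof (rule ccontr)
  assume "x \<noteq> y"
  then have "min x y < max x y"
    by auto
  then obtain i where "min x y < rat_enum i" "rat_enum i < max x y"
    using rat_enum_between by blast
  with assms[of i] show False
    by (auto simp: min_def max_def split: if_splits)
qed

lemma continuous_le_if_le_on_rats:
  fixes f :: "real \<Rightarrow> real"
  assumes f: "continuous_on UNIV f" and le: "\<And>i. \<bar>rat_enum i\<bar> < n \<Longrightarrow> f (rat_enum i) \<le> c" and t: "\<bar>t\<bar> < n"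
  shows "f t \<le> c"
proof (rule ccontr)
  assume "\<not> f t \<le> c"
  then have "t \<in> {t. c < f t} \<inter> {t. \<bar>t\<bar> < n}"
    using t by auto
  moreover have "open ({t. c < f t} \<inter> {t. \<bar>t\<bar> < n})"
    using f by (intro open_Int open_Collect_less continuous_intros)
  ultimately obtain e where e: "e > 0" "ball t e \<subseteq> {t. c < f t} \<inter> {t. \<bar>t\<bar> < n}"
    unfolding open_contains_ball by blast
  obtain i where "t < rat_enum i" "rat_enum i < t + e"
    using rat_enum_between[of t "t + e"] \<open>e > 0\<close> by auto
  then have "rat_enum i \<in> ball t e"
    by (auto simp: dist_real_def)
  then have "c < f (rat_enum i) \<and> \<bar>rat_enum i\<bar> < n"
    using e(2) by blast
  then show False
    using le[of i] by auto
qed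

section \<open>Tubes and the Borel field of path space\<close>

definition rat_values :: "(real \<Rightarrow> real) \<Rightarrow> nat \<Rightarrow> real" where
  "rat_values \<omega> i = \<omega> (rat_enum i)"

text \<open>Tubes around rational step functions: \<open>(-n, n)\<close> is cut into cells of length
  \<open>1 / k\<close>, \<open>qs\<close> lists one rational value per cell, and
  \<open>2 / Suc m\<close> is the tolerance. The family is countable, and only the values at
  rational times enter.\<close>

definition tube :: "nat \<times> nat \<times> rat list \<times> nat \<Rightarrow> (real \<Rightarrow> real) set" where
  "tube = (\<lambda>(n, k, qs, m). {\<omega> \<in> path_space. \<forall>i. \<bar>rat_enum i\<bar> < real n \<longrightarrow>
     \<bar>rat_values \<omega> i - of_rat (qs ! nat \<lfloor>(rat_enum i + real n) * real k\<rfloor>)\<bar> \<le> 2 / real (Suc m)})"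

lemma uniformly_continuous_real_modulus:
  fixes f :: "real \<Rightarrow> real"
  assumes "uniformly_continuous_on S f" "e > 0"
  obtains d where "d > 0" "\<And>s t. s \<in> S \<Longrightarrow> t \<in> S \<Longrightarrow> \<bar>s - t\<bar> < d \<Longrightarrow> \<bar>f s - f t\<bar> < e"
proof -
  obtain d where d: "d > 0" "\<forall>x\<in>S. \<forall>x'\<in>S. dist x' x < d \<longrightarrow> dist (f x') (f x) < e"
    using assms unfolding uniformly_continuous_on_def by blast
  show thesis
    by (rule that[OF d(1)]) (use d(2) in \<open>simp add: dist_real_def\<close>)
qed

text \<open>Uniform continuity on \<open>[-n, n]\<close>: a step function with rational values near
  those of \<open>\<omega>\<close> at the left ends of sufficiently short cells stays close to
  \<open>\<omega>\<close>, and by continuity closeness at rational times is closeness at all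
  times.\<close>

lemma tube_basis:
  assumes U: "openin locally_uniform_topology U" and \<omega>: "\<omega> \<in> U"
  shows "\<exists>d. \<omega> \<in> tube d \<and> tube d \<subseteq> U"
proof -
  have path: "\<omega> \<in> path_space"
    using U \<omega> unfolding openin_locally_uniform_topology by auto
  obtain K e where K: "compact K" "e > 0" "{\<omega>'\<in>path_space. \<forall>t\<in>K. \<bar>\<omega>' t - \<omega> t\<bar> < e} \<subseteq> U"
    using U \<omega> unfolding openin_locally_uniform_topology by blast
  obtain b where b: "\<And>t. t \<in> K \<Longrightarrow> \<bar>t\<bar> \<le> b"
    using compact_imp_bounded[OF K(1)] unfolding bounded_iff by auto
  obtain n where n: "b < real n" "n > 0"
    using reals_Archimedean2[of "max b 0"] by (auto intro: gr0I)
  \<comment> \<open>Each path of the tube is within \<open>2 / Suc m\<close> of the step function,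
    so two of them differ by at most \<open>4 / Suc m\<close>, which has to be less than
    \<open>e\<close>.\<close>
  obtain m where m: "1 / real (Suc m) < e / 5"
    using nat_approx_posE[of "e / 5"] \<open>e > 0\<close> by auto
  let ?d = "1 / real (Suc m)"
  have "uniformly_continuous_on {- real n..real n} \<omega>"
    using path by (intro compact_uniformly_continuous) (auto simp: path_space_def intro: continuous_on_subset)
  then obtain \<delta> where \<delta>: "\<delta> > 0"
    "\<And>s t. s \<in> {- real n..real n} \<Longrightarrow> t \<in> {- real n..real n} \<Longrightarrow> \<bar>s - t\<bar> < \<delta> \<Longrightarrow> \<bar>\<omega> s - \<omega> t\<bar> < ?d"
    by (rule uniformly_continuous_real_modulus[of _ _ "1 / real (Suc m)"]) auto
  obtain k0 where k0: "1 / real (Suc k0) < \<delta>"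
    using nat_approx_posE[OF \<open>\<delta> > 0\<close>] by auto
  define k where "k = Suc k0"
  have "\<exists>r. \<bar>of_rat r - \<omega> (- real n + real j / real k)\<bar> < ?d" for j
  proof -
    obtain i where "\<omega> (- real n + real j / real k) < rat_enum i" "rat_enum i < \<omega> (- real n + real j / real k) + ?d"
      using rat_enum_between[of "\<omega> (- real n + real j / real k)" "\<omega> (- real n + real j / real k) + ?d"] by auto
    then show ?thesis
      unfolding rat_enum_def by (intro exI[of _ "from_nat i"]) auto
  qed
  then obtain r where r: "\<And>j. \<bar>of_rat (r j) - \<omega> (- real n + real j / real k)\<bar> < ?d"
    by metis
  \<comment> \<open>For \<open>\<bar>t\<bar> < n\<close> the cell index is at most
    \<open>2 * n * k\<close>.\<close>
  define qs where "qs = map r [0..<Suc (2 * n * k)]"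
  have near: "\<bar>\<omega> t - of_rat (qs ! nat \<lfloor>(t + real n) * real k\<rfloor>)\<bar> \<le> 2 * ?d" if t: "\<bar>t\<bar> < real n" for t
  proof -
    define j where "j = nat \<lfloor>(t + real n) * real k\<rfloor>"
    have pos: "0 \<le> (t + real n) * real k" "k > 0"
      using t by (auto simp: k_def)
    then have j: "real j \<le> (t + real n) * real k" "(t + real n) * real k < real j + 1"
      unfolding j_def by (simp_all add: of_nat_nat floor_le_iff) linarith?
    have "(t + real n) * real k \<le> (2 * real n) * real k"
      using t by (intro mult_right_mono) auto
    then have "real j \<le> real (2 * n * k)"
      using j(1) by simp
    then have "j < Suc (2 * n * k)"
      by linarith
    then have "qs ! j = r j"
      by (simp add: qs_def del: upt_Suc)
    define u where "u = - real n + real j / real k"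
    have "u \<le> t" "t < u + 1 / real k"
      using j pos by (auto simp: u_def field_simps)
    moreover have "- real n \<le> u"
      by (simp add: u_def)
    ultimately have "\<bar>\<omega> t - \<omega> u\<bar> < ?d"
      using t k0 by (intro \<delta>(2)) (auto simp: k_def)
    moreover have "\<bar>of_rat (qs ! j) - \<omega> u\<bar> < ?d"
      using r[of j] \<open>qs ! j = r j\<close> by (simp add: u_def)
    ultimately show ?thesis
      unfolding j_def[symmetric] by linarith
  qed
  have "\<omega> \<in> tube (n, k, qs, m)"
    using near path by (auto simp: tube_def rat_values_def)
  moreover have "tube (n, k, qs, m) \<subseteq> U"
  proof
    fix \<omega>' assume w': "\<omega>' \<in> tube (n, k, qs, m)"
    then have path': "\<omega>' \<in> path_space"
      by (simp add: tube_def)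
    have le: "\<bar>\<omega>' t - \<omega> t\<bar> \<le> 4 * ?d" if "\<bar>t\<bar> < real n" for t
    proof (rule continuous_le_if_le_on_rats[OF _ _ that])
      show "continuous_on UNIV (\<lambda>t. \<bar>\<omega>' t - \<omega> t\<bar>)"
        using path path' by (auto simp: path_space_def intro!: continuous_intros)
      fix i assume i: "\<bar>rat_enum i\<bar> < real n"
      then have "\<bar>\<omega>' (rat_enum i) - of_rat (qs ! nat \<lfloor>(rat_enum i + real n) * real k\<rfloor>)\<bar> \<le> 2 * ?d"
        using w' by (simp add: tube_def rat_values_def)
      with near[OF i] show "\<bar>\<omega>' (rat_enum i) - \<omega> (rat_enum i)\<bar> \<le> 4 * ?d"
        by linarith
    qed
    have "\<bar>\<omega>' t - \<omega> t\<bar> < e" if "t \<in> K" for t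
      using le[of t] b[OF that] n m by linarith
    then show "\<omega>' \<in> U"
      using K(3) path' by blast
  qed
  ultimately show ?thesis
    by blast
qed

lemma measurable_coordinate [measurable]: "(\<lambda>x. x i) \<in> borel_measurable (borel :: (nat \<Rightarrow> real) measure)"
  by (intro borel_measurable_continuous_onI continuous_on_product_coordinates)

text \<open>Open sets are countable unions of tubes, and a tube is the preimage under
  \<open>rat_values\<close> of a Borel set of sequences.\<close>

lemma path_borel_eq_rat_values:
  assumes "B \<in> sets path_borel"
  shows "\<exists>A\<in>sets borel. B = {\<omega> \<in> path_space. rat_values \<omega> \<in> A}"
proof -
  let ?V = "vimage_algebra path_space rat_values (borel :: (nat \<Rightarrow> real) measure)"
  have tube: "tube d \<in> sets ?V" for d
  proof -
    obtain n k qs m where d: "d = (n, k, qs, m)"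
      using prod_cases4 by blast
    have "{x \<in> space borel. \<forall>i. \<bar>rat_enum i\<bar> < real n \<longrightarrow>
       \<bar>x i - of_rat (qs ! nat \<lfloor>(rat_enum i + real n) * real k\<rfloor>)\<bar> \<le> 2 / real (Suc m)} \<in> sets (borel :: (nat \<Rightarrow> real) measure)" (is "?A \<in> _")
      by measurable
    then have "rat_values -` ?A \<inter> path_space \<in> sets ?V"
      by (rule in_vimage_algebra)
    also have "rat_values -` ?A \<inter> path_space = tube d"
      by (auto simp: tube_def d)
    finally show ?thesis .
  qed
  have "U \<in> sets ?V" if "openin locally_uniform_topology U" for U
  proof -
    have "U = (\<Union>d\<in>{d. tube d \<subseteq> U}. tube d)"
      using tube_basis[OF that] by blast
    moreover have "(\<Union>d\<in>{d. tube d \<subseteq> U}. tube d) \<in> sets ?V"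
      by (rule sets.countable_UN') (auto intro: tube)
    ultimately show ?thesis
      by simp
  qed
  then have "sigma_sets path_space {U. openin locally_uniform_topology U} \<subseteq> sets ?V"
    using sets.sigma_sets_subset[of "{U. openin locally_uniform_topology U}" ?V] by auto
  moreover have "sets path_borel = sigma_sets path_space {U. openin locally_uniform_topology U}"
    unfolding path_borel_def
    by (rule sets_measure_of) (auto simp: openin_locally_uniform_topology)
  ultimately have "B \<in> sets ?V"
    using assms by auto
  then show ?thesis
    unfolding sets_vimage_algebra2[of rat_values path_space borel, simplified] by auto
qed

section \<open>Extension of functions from the rationals\<close>

text \<open>The image of \<open>path_space\<close> under \<open>rat_values\<close>: value
  \<open>0\<close> at time \<open>0\<close> and uniform continuity on bounded sets of rationals,
  written with countable quantifiers so that it is visibly Borel.\<close>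

definition extendable :: "(nat \<Rightarrow> real) set" where
  "extendable = {x. (\<forall>i. rat_enum i = 0 \<longrightarrow> x i = 0) \<and> (\<forall>(n::nat) (m::nat). \<exists>k::nat. \<forall>i j. \<bar>rat_enum i\<bar> \<le> n \<longrightarrow>
     \<bar>rat_enum j\<bar> \<le> n \<longrightarrow> \<bar>rat_enum i - rat_enum j\<bar> < 1 / Suc k \<longrightarrow> \<bar>x i - x j\<bar> \<le> 1 / Suc m)}"

lemma extendable_sets [measurable]: "extendable \<in> sets borel"
proof -
  have "{x \<in> space borel. (\<forall>i. rat_enum i = 0 \<longrightarrow> x i = 0) \<and> (\<forall>(n::nat) (m::nat). \<exists>k::nat. \<forall>i j. \<bar>rat_enum i\<bar> \<le> n \<longrightarrow>
     \<bar>rat_enum j\<bar> \<le> n \<longrightarrow> \<bar>rat_enum i - rat_enum j\<bar> < 1 / Suc k \<longrightarrow> \<bar>x i - x j\<bar> \<le> 1 / Suc m)} \<in> sets (borel :: (nat \<Rightarrow> real) measure)"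
    by measurable
  then show ?thesis
    by (simp add: extendable_def)
qed

lemma rat_values_extendable:
  assumes "\<omega> \<in> path_space"
  shows "rat_values \<omega> \<in> extendable"
  unfolding extendable_def
proof (intro CollectI conjI allI)
  fix n m :: nat
  have "uniformly_continuous_on {- real n..real n} \<omega>"
    using assms by (intro compact_uniformly_continuous) (auto simp: path_space_def intro: continuous_on_subset)
  then obtain \<delta> where \<delta>: "\<delta> > 0"
    "\<And>s t. s \<in> {- real n..real n} \<Longrightarrow> t \<in> {- real n..real n} \<Longrightarrow> \<bar>s - t\<bar> < \<delta> \<Longrightarrow> \<bar>\<omega> s - \<omega> t\<bar> < 1 / Suc m"
    by (rule uniformly_continuous_real_modulus[of _ _ "1 / real (Suc m)"]) auto
  obtain k where k: "1 / real (Suc k) < \<delta>"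
    using nat_approx_posE[OF \<open>\<delta> > 0\<close>] by auto
  have "\<bar>rat_values \<omega> i - rat_values \<omega> j\<bar> \<le> 1 / Suc m"
    if "\<bar>rat_enum i\<bar> \<le> n" "\<bar>rat_enum j\<bar> \<le> n" "\<bar>rat_enum i - rat_enum j\<bar> < 1 / Suc k" for i j
  proof -
    have "\<bar>\<omega> (rat_enum i) - \<omega> (rat_enum j)\<bar> < 1 / Suc m"
      using that k by (intro \<delta>(2)) auto
    then show ?thesis
      by (simp add: rat_values_def)
  qed
  then show "\<exists>k::nat. \<forall>i j. \<bar>rat_enum i\<bar> \<le> n \<longrightarrow> \<bar>rat_enum j\<bar> \<le> n \<longrightarrow>
    \<bar>rat_enum i - rat_enum j\<bar> < 1 / Suc k \<longrightarrow> \<bar>rat_values \<omega> i - rat_values \<omega> j\<bar> \<le> 1 / Suc m"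
    by blast
qed (use assms in \<open>auto simp: rat_values_def path_space_def\<close>)

text \<open>Uniform continuity on bounded sets sends Cauchy sequences of rationals to Cauchy
  sequences, and such a map extends continuously to the closure of the rationals.\<close>

lemma extendable_rat_values:
  assumes x: "x \<in> extendable"
  shows "\<exists>\<omega>\<in>path_space. rat_values \<omega> = x"
proof -
  define f where "f t = x (SOME i. rat_enum i = t)" for t
  have idx: "rat_enum (SOME i. rat_enum i = t) = t" if "t \<in> \<rat>" for t
    using that range_rat_enum by (metis (mono_tags, lifting) imageE someI_ex)
  have modulus: "\<exists>k::nat. \<forall>s\<in>\<rat>. \<forall>t\<in>\<rat>. \<bar>s\<bar> \<le> n \<longrightarrow> \<bar>t\<bar> \<le> n \<longrightarrow> \<bar>s - t\<bar> < 1 / Suc k \<longrightarrow> \<bar>f s - f t\<bar> \<le> 1 / Suc m"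
    for n m :: nat
  proof -
    obtain k :: nat where k: "\<And>i j. \<bar>rat_enum i\<bar> \<le> n \<Longrightarrow> \<bar>rat_enum j\<bar> \<le> n \<Longrightarrow>
        \<bar>rat_enum i - rat_enum j\<bar> < 1 / Suc k \<Longrightarrow> \<bar>x i - x j\<bar> \<le> 1 / Suc m"
      using x unfolding extendable_def by blast
    show ?thesis
      unfolding f_def by (intro exI[of _ k] ballI impI k) (simp_all add: idx)
  qed
  \<comment> \<open>\<open>rat_enum\<close> is not assumed injective: indices of the same rational
    must carry the same value. The modulus of continuity at distance zero gives this.\<close>
  have f_rat: "f (rat_enum i) = x i" for i
  proof -
    define j where "j = (SOME j. rat_enum j = rat_enum i)"
    have j: "rat_enum j = rat_enum i"
      unfolding j_def by (rule someI[of _ i]) simp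
    obtain n :: nat where n: "\<bar>rat_enum i\<bar> \<le> n"
      using real_arch_simple by blast
    have "\<bar>x j - x i\<bar> \<le> 1 / Suc m" for m :: nat
    proof -
      obtain k :: nat where "\<And>i j. \<bar>rat_enum i\<bar> \<le> n \<Longrightarrow> \<bar>rat_enum j\<bar> \<le> n \<Longrightarrow>
          \<bar>rat_enum i - rat_enum j\<bar> < 1 / Suc k \<Longrightarrow> \<bar>x i - x j\<bar> \<le> 1 / Suc m"
        using x unfolding extendable_def by blast
      from this[of j i] show ?thesis
        using n j by simp
    qed
    then have "\<bar>x j - x i\<bar> \<le> 0"
      by (meson linorder_not_le nat_approx_posE)
    then show ?thesis
      by (simp add: f_def j_def)
  qed
  have "Cauchy_continuous_on \<rat> f"
    unfolding Cauchy_continuous_on_def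
  proof (intro allI impI)
    fix \<sigma> :: "nat \<Rightarrow> real" assume \<sigma>: "Cauchy \<sigma>" "range \<sigma> \<subseteq> \<rat>"
    obtain b where b: "\<And>i. \<bar>\<sigma> i\<bar> \<le> b"
      using cauchy_imp_bounded[of \<sigma>] \<sigma> unfolding bounded_iff by auto
    obtain n :: nat where n: "b \<le> n"
      using real_arch_simple by blast
    have bd: "\<bar>\<sigma> i\<bar> \<le> n" for i
      using b[of i] n by linarith
    show "Cauchy (f \<circ> \<sigma>)"
    proof (rule metric_CauchyI)
      fix e :: real assume "e > 0"
      then obtain m where m: "1 / real (Suc m) < e"
        using nat_approx_posE by blast
      obtain k where k: "\<forall>s\<in>\<rat>. \<forall>t\<in>\<rat>. \<bar>s\<bar> \<le> n \<longrightarrow> \<bar>t\<bar> \<le> n \<longrightarrow> \<bar>s - t\<bar> < 1 / Suc k \<longrightarrow> \<bar>f s - f t\<bar> \<le> 1 / Suc m"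
        using modulus[of n m] by (rule exE)
      have "(0::real) < 1 / Suc k"
        by simp
      then obtain N where N: "\<And>i j. i \<ge> N \<Longrightarrow> j \<ge> N \<Longrightarrow> dist (\<sigma> i) (\<sigma> j) < 1 / Suc k"
        using \<sigma> metric_CauchyD by metis
      have "dist ((f \<circ> \<sigma>) i) ((f \<circ> \<sigma>) j) < e" if "i \<ge> N" "j \<ge> N" for i j
      proof -
        have "\<bar>f (\<sigma> i) - f (\<sigma> j)\<bar> \<le> 1 / Suc m"
          using \<sigma> bd N[OF that] by (intro k[rule_format]) (auto simp: dist_real_def)
        then show ?thesis
          using m by (simp add: dist_real_def)
      qed
      then show "\<exists>M. \<forall>i\<ge>M. \<forall>j\<ge>M. dist ((f \<circ> \<sigma>) i) ((f \<circ> \<sigma>) j) < e"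
        by blast
    qed
  qed
  then have "Cauchy_continuous_map (submetric euclidean_metric \<rat>) euclidean_metric f"
    by simp
  moreover have "mcomplete_of (euclidean_metric :: real metric)"
    by (simp add: mcomplete_of_def complete_UNIV)
  ultimately obtain g where g: "continuous_map (subtopology euclidean (euclidean closure_of \<rat>)) euclidean g"
    "\<And>t. t \<in> \<rat> \<Longrightarrow> g t = f t"
    using Cauchy_continuous_map_extends_to_continuous_closure_of[of euclidean_metric euclidean_metric \<rat> f]
    by (metis mtopology_of_euclidean)
  have "euclidean closure_of (\<rat> :: real set) = UNIV"
    using Rats_closure_real by simp
  then have "continuous_on UNIV g"
    using g(1) by simp
  moreover have rat_g: "g (rat_enum i) = x i" for i
    using g(2)[of "rat_enum i"] f_rat[of i] range_rat_enum by auto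
  moreover have "g 0 = 0"
  proof -
    obtain i where "rat_enum i = 0"
      using range_rat_enum Rats_0 by (metis imageE)
    then show ?thesis
      using rat_g[of i] x by (simp add: extendable_def)
  qed
  ultimately show ?thesis
    by (intro bexI[of _ g]) (auto simp: path_space_def rat_values_def fun_eq_iff)
qed

section \<open>Coding paths together with enumerations\<close>

text \<open>Even coordinates determine the path, odd ones carry the enumeration.
  \<open>fusion\<close> is applied with \<open>s i = Suc (2 * i)\<close>: it matches odd coordinates
  only, while the limits are taken in all coordinates.\<close>

definition coded_path :: "(nat \<Rightarrow> (real \<Rightarrow> real) \<Rightarrow> real) \<Rightarrow> nat \<Rightarrow> (real \<Rightarrow> real) \<Rightarrow> real" where
  "coded_path S c \<omega> = (if even c then \<omega> (rat_enum (c div 2)) else S (c div 2) \<omega>)"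

lemma coded_path_simps: "coded_path S (2 * i) \<omega> = rat_values \<omega> i" "coded_path S (Suc (2 * i)) \<omega> = S i \<omega>"
  by (simp_all add: coded_path_def rat_values_def)

lemma eval_measurable:
  assumes "sets P = sets path_borel"
  shows "(\<lambda>\<omega>. \<omega> t) \<in> borel_measurable P"
  unfolding measurable_cong_sets[OF assms refl] by (rule eval_measurable_path_borel)

text \<open>Carrying the values of the enumeration along as extra coordinates makes the enumeration continuous
  and saves an appeal to Lusin's theorem.\<close>

proposition closed_set_of_coded_paths:
  assumes "prob_space P" and P: "sets P = sets path_borel" and C: "C \<in> sets (completion P)"
    and pos: "\<not> (AE \<omega> in completion P. \<omega> \<notin> C)" and S [measurable]: "\<And>i. S i \<in> borel_measurable (completion P)"
  obtains K Q where "closed K" "Q \<in> sets (completion P)" "\<not> (AE \<omega> in completion P. \<omega> \<notin> Q)"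
    "(\<lambda>\<omega> c. coded_path S c \<omega>) ` Q \<subseteq> K" "K \<subseteq> (\<lambda>\<omega> c. coded_path S c \<omega>) ` C"
proof -
  let ?W = "completion P"
  interpret P: prob_space P by fact
  interpret W: prob_space ?W
    using P.prob_space_completion .
  have space_P: "space P = path_space"
    using sets_eq_imp_space_eq[OF P] space_path_borel by simp
  have [measurable]: "(\<lambda>\<omega>. \<omega> t) \<in> borel_measurable ?W" for t
    by (intro measurable_completion eval_measurable P)
  have [measurable]: "coded_path S c \<in> borel_measurable ?W" for c
    unfolding coded_path_def[abs_def] by (cases "even c") auto
  have coded [measurable]: "(\<lambda>\<omega> c. coded_path S c \<omega>) \<in> borel_measurable ?W"
    by (rule measurable_coordinatewise_then_product) simp
  \<comment> \<open>\<open>C\<close> is replaced by a subset \<open>C2\<close>, Borel and differing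
    from \<open>C\<close> by a null set, on which every \<open>S i\<close> equals a Borel version
    \<open>T i\<close>.\<close>
  obtain C1 N N' where C1: "C = C1 \<union> N" "N \<subseteq> N'" "N' \<in> null_sets P" "C1 \<in> sets P"
    using C by (rule sets_completionE) blast
  have "\<exists>T\<in>borel_measurable P. AE \<omega> in P. S i \<omega> = T \<omega>" for i
    using S by (rule completion_ex_borel_measurable_real)
  then obtain T where T [measurable]: "\<And>i. T i \<in> borel_measurable P" and "\<And>i. AE \<omega> in P. S i \<omega> = T i \<omega>"
    by metis
  then have "AE \<omega> in P. \<forall>i. S i \<omega> = T i \<omega>"
    by (simp add: AE_all_countable)
  then obtain N2 where N2: "{\<omega> \<in> space P. \<not> (\<forall>i. S i \<omega> = T i \<omega>)} \<subseteq> N2" "N2 \<in> null_sets P"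
    unfolding eventually_ae_filter by blast
  define C2 where "C2 = C1 - N2"
  have C2: "C2 \<in> sets P" "C2 \<subseteq> C"
    using C1 N2(2) by (auto simp: C2_def)
  have C2_pos: "\<not> (AE \<omega> in ?W. \<omega> \<notin> C2)"
  proof
    assume "AE \<omega> in ?W. \<omega> \<notin> C2"
    moreover have "AE \<omega> in ?W. \<omega> \<notin> N'" "AE \<omega> in ?W. \<omega> \<notin> N2"
      using C1(3) N2(2) by (blast intro: AE_completion AE_not_in)+
    ultimately have "AE \<omega> in ?W. \<omega> \<notin> C"
      by eventually_elim (use C1 in \<open>auto simp: C2_def\<close>)
    with pos show False
      by blast
  qed
  have eq: "S i \<omega> = T i \<omega>" if "\<omega> \<in> C2" for i \<omega>
  proof -
    have "\<omega> \<in> space P" "\<omega> \<notin> N2"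
      using that sets.sets_into_space[OF C1(4)] by (auto simp: C2_def)
    then show ?thesis
      using N2(1) by blast
  qed
  obtain A0 where A0 [measurable]: "A0 \<in> sets borel" and C2_eq: "C2 = {\<omega> \<in> path_space. rat_values \<omega> \<in> A0}"
    using path_borel_eq_rat_values[of C2] C2(1) P by auto
  have "\<exists>A. A \<in> sets borel \<and> {\<omega> \<in> space P. T i \<omega> < rat_enum r} = {\<omega> \<in> path_space. rat_values \<omega> \<in> A}" for i r
    unfolding Bex_def[symmetric]
  proof (rule path_borel_eq_rat_values)
    show "{\<omega> \<in> space P. T i \<omega> < rat_enum r} \<in> sets path_borel"
      unfolding P[symmetric] by measurable
  qed
  then have "\<exists>A. \<forall>i r. A i r \<in> sets borel \<and> {\<omega> \<in> space P. T i \<omega> < rat_enum r} = {\<omega> \<in> path_space. rat_values \<omega> \<in> A i r}"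
    by (intro choice allI)
  then obtain A where A [measurable]: "\<And>i r. A i r \<in> sets borel"
    and A_eq: "\<And>i r. {\<omega> \<in> space P. T i \<omega> < rat_enum r} = {\<omega> \<in> path_space. rat_values \<omega> \<in> A i r}"
    by blast
  have A_iff: "rat_values \<omega> \<in> A i r \<longleftrightarrow> T i \<omega> < rat_enum r" if "\<omega> \<in> path_space" for i r \<omega>
    using A_eq[of i r] that space_P by auto
  have [measurable]: "(\<lambda>x i. x (2 * i)) \<in> measurable (borel :: (nat \<Rightarrow> real) measure) (borel :: (nat \<Rightarrow> real) measure)"
    by (rule measurable_coordinatewise_then_product) simp
  \<comment> \<open>The exact set of codes of members of \<open>C2\<close>. The sets
    \<open>A i r\<close> read off from the rational values of the path whether \<open>T i\<close> is
    below \<open>rat_enum r\<close>; comparing with all rational thresholds forces the odd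
    coordinate to be \<open>T i\<close>.\<close>
  define H where "H = {x. (\<lambda>i. x (2 * i)) \<in> A0 \<and> (\<lambda>i. x (2 * i)) \<in> extendable \<and>
    (\<forall>i r. (\<lambda>i. x (2 * i)) \<in> A i r \<longleftrightarrow> x (Suc (2 * i)) < rat_enum r)}"
  have "{x \<in> space borel. (\<lambda>i. x (2 * i)) \<in> A0 \<and> (\<lambda>i. x (2 * i)) \<in> extendable \<and>
    (\<forall>i r. (\<lambda>i. x (2 * i)) \<in> A i r \<longleftrightarrow> x (Suc (2 * i)) < rat_enum r)} \<in> sets borel"
    by measurable
  then have H [measurable]: "H \<in> sets borel"
    by (simp add: H_def)
  have C2_H: "(\<lambda>c. coded_path S c \<omega>) \<in> H" if "\<omega> \<in> C2" for \<omega>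
  proof -
    have "\<omega> \<in> path_space" "rat_values \<omega> \<in> A0"
      using that C2_eq by auto
    then show ?thesis
      using A_iff eq[OF that] rat_values_extendable by (simp add: H_def coded_path_simps)
  qed
  have H_C: "\<exists>\<omega>\<in>C. (\<lambda>c. coded_path S c \<omega>) = x" if x: "x \<in> H" for x
  proof -
    obtain \<omega> where w: "\<omega> \<in> path_space" "rat_values \<omega> = (\<lambda>i. x (2 * i))"
      using x extendable_rat_values[of "\<lambda>i. x (2 * i)"] by (auto simp: H_def)
    then have "\<omega> \<in> C2"
      using x by (simp add: C2_eq H_def)
    have "T i \<omega> < rat_enum r \<longleftrightarrow> x (Suc (2 * i)) < rat_enum r" for i r
      using A_iff[OF w(1), of i r] x by (simp add: H_def w(2))
    then have "T i \<omega> = x (Suc (2 * i))" for i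
      by (rule real_eqI_rat_less)
    then have "coded_path S c \<omega> = x c" for c
      using eq[OF \<open>\<omega> \<in> C2\<close>] fun_cong[OF w(2), of "c div 2"]
      by (cases "even c") (auto elim!: evenE oddE simp: coded_path_simps)
    then show ?thesis
      using \<open>\<omega> \<in> C2\<close> C2(2) by blast
  qed
  define \<nu> where "\<nu> = distr ?W borel (\<lambda>\<omega> c. coded_path S c \<omega>)"
  interpret \<nu>: prob_space \<nu>
    unfolding \<nu>_def by (rule W.prob_space_distr) simp
  have "emeasure \<nu> H \<noteq> 0"
  proof
    assume "emeasure \<nu> H = 0"
    then have "AE x in \<nu>. x \<notin> H"
      by (intro AE_not_in) (auto simp: null_sets_def \<nu>_def)
    then have "AE \<omega> in ?W. (\<lambda>c. coded_path S c \<omega>) \<notin> H"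
      unfolding \<nu>_def by (subst (asm) AE_distr_iff) auto
    then have "AE \<omega> in ?W. \<omega> \<notin> C2"
      by eventually_elim (use C2_H in blast)
    with C2_pos show False
      by blast
  qed
  \<comment> \<open>A finite Borel measure on the Polish space of sequences is inner regular by
    compact sets; one non-null compact subset of \<open>H\<close> is enough.\<close>
  moreover have "emeasure \<nu> H = (SUP K \<in> {K. K \<subseteq> H \<and> compact K}. emeasure \<nu> K)"
    by (rule inner_regular) (auto simp: \<nu>_def \<nu>.emeasure_finite[unfolded \<nu>_def])
  ultimately have "\<exists>K. K \<subseteq> H \<and> compact K \<and> emeasure \<nu> K \<noteq> 0"
    by (metis (no_types, lifting) SUP_bot_conv(2) bot_ennreal mem_Collect_eq)
  then obtain K where K: "K \<subseteq> H" "compact K" "emeasure \<nu> K \<noteq> 0"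
    by blast
  have [measurable]: "K \<in> sets borel"
    using K(2) by (intro borel_closed compact_imp_closed)
  define Q where "Q = {\<omega> \<in> space ?W. (\<lambda>c. coded_path S c \<omega>) \<in> K}"
  have [measurable]: "Q \<in> sets ?W"
    unfolding Q_def by measurable
  show thesis
  proof (rule that)
    show "Q \<in> sets ?W"
      by fact
    show "closed K"
      using K(2) by (rule compact_imp_closed)
    show "\<not> (AE \<omega> in ?W. \<omega> \<notin> Q)"
    proof
      assume "AE \<omega> in ?W. \<omega> \<notin> Q"
      then have "AE \<omega> in ?W. (\<lambda>c. coded_path S c \<omega>) \<notin> K"
        using AE_space by eventually_elim (auto simp: Q_def)
      then have "AE x in \<nu>. x \<notin> K"
        unfolding \<nu>_def by (subst AE_distr_iff) auto
      then have "emeasure \<nu> K = 0"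
        by (subst (asm) AE_iff_measurable[OF _ refl]) (auto simp: \<nu>_def)
      with K(3) show False
        by blast
    qed
    show "(\<lambda>\<omega> c. coded_path S c \<omega>) ` Q \<subseteq> K"
      by (auto simp: Q_def)
    show "K \<subseteq> (\<lambda>\<omega> c. coded_path S c \<omega>) ` C"
      using K(1) H_C by blast
  qed
qed

section \<open>Independence of increments\<close>

definition inc :: "real \<times> real \<Rightarrow> (real \<Rightarrow> real) \<Rightarrow> real" where
  "inc p \<omega> = \<omega> (snd p) - \<omega> (fst p)"

lemma standard_brownian_motion_indep:
  assumes "standard_brownian_motion P X" "0 \<le> \<tau> 0" "\<And>i. i < n \<Longrightarrow> \<tau> i < \<tau> (Suc i)"
  shows "prob_space.indep_vars P (\<lambda>_. borel) (\<lambda>i \<omega>. X (\<tau> (Suc i)) \<omega> - X (\<tau> i) \<omega>) {..<n}"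
  using assms unfolding standard_brownian_motion_def by blast

lemma standard_brownian_motion_moment4:
  assumes sbm: "standard_brownian_motion P X" and st: "0 \<le> s" "s < t"
  shows "integrable P (\<lambda>\<omega>. (X t \<omega> - X s \<omega>) ^ 4)" "(\<integral>\<omega>. (X t \<omega> - X s \<omega>) ^ 4 \<partial>P) = 3 * (t - s)\<^sup>2"
proof -
  have D: "distributed P lborel (\<lambda>\<omega>. X t \<omega> - X s \<omega>) (normal_density 0 (sqrt (t - s)))"
    using sbm st unfolding standard_brownian_motion_def by blast
  have bi: "has_bochner_integral lborel (\<lambda>x. normal_density 0 (sqrt (t - s)) x * x ^ 4) (3 * (t - s)\<^sup>2)"
  proof -
    \<comment> \<open>The even moment formula \<open>(2*k)! / ((2 / \<sigma>^2)^k * k!)\<close> for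
      \<open>k = 2\<close> and variance \<open>d\<close>.\<close>
    have "24 / ((2 / d)\<^sup>2 * 2) = 3 * d\<^sup>2" if "d > 0" for d :: real
      using that by (simp add: power2_eq_square)
    from this[of "t - s"] show ?thesis
      using normal_moment_even[of "sqrt (t - s)" 0 2] st by (simp add: fact_numeral)
  qed
  show "integrable P (\<lambda>\<omega>. (X t \<omega> - X s \<omega>) ^ 4)"
    using distributed_integrable[OF D, of "\<lambda>x. x ^ 4"] bi by (auto simp: has_bochner_integral_iff)
  show "(\<integral>\<omega>. (X t \<omega> - X s \<omega>) ^ 4 \<partial>P) = 3 * (t - s)\<^sup>2"
    using distributed_integral[OF D, of "\<lambda>x. x ^ 4"] bi by (auto simp: has_bochner_integral_iff)
qed

text \<open>Convexity of the square, applied twice.\<close>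

lemma power4_sum_le: "(x + y) ^ 4 \<le> 8 * (x ^ 4 + y ^ 4)" for x y :: real
proof -
  have "(x + y)\<^sup>2 \<le> 2 * (x\<^sup>2 + y\<^sup>2)"
    using zero_le_power2[of "x - y"] by (simp add: power2_eq_square algebra_simps)
  then have "((x + y)\<^sup>2)\<^sup>2 \<le> (2 * (x\<^sup>2 + y\<^sup>2))\<^sup>2"
    by (intro power_mono) auto
  also have "\<dots> \<le> 8 * ((x\<^sup>2)\<^sup>2 + (y\<^sup>2)\<^sup>2)"
    using zero_le_power2[of "x\<^sup>2 - y\<^sup>2"] by (simp add: power2_eq_square algebra_simps)
  finally show ?thesis
    by simp
qed

locale wiener_noise =
  fixes W :: "(real \<Rightarrow> real) measure"
  assumes completed_wiener: "completed_wiener_measure W"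
begin

lemma wiener_base:
  obtains P where "two_sided_wiener_measure P" "W = completion P"
  using completed_wiener unfolding completed_wiener_measure_def by blast

sublocale prob_space W
proof -
  obtain P where P: "two_sided_wiener_measure P" "W = completion P"
    by (rule wiener_base)
  then interpret P: prob_space P
    by (simp add: two_sided_wiener_measure_def)
  show "prob_space W"
    unfolding P(2) by (rule P.prob_space_completion)
qed

lemma measurable_eval [measurable]: "(\<lambda>\<omega>. \<omega> t) \<in> borel_measurable W"
proof -
  obtain P where "two_sided_wiener_measure P" "W = completion P"
    by (rule wiener_base)
  then show ?thesis
    by (simp add: two_sided_wiener_measure_def measurable_completion eval_measurable)
qed

lemma measurable_inc [measurable]: "inc p \<in> borel_measurable W"
  unfolding inc_def[abs_def] by measurable

section \<open>Independence over grids containing time \<open>0\<close>\<close>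

abbreviation grid_box :: "(nat \<Rightarrow> real) \<Rightarrow> nat set \<Rightarrow> (nat \<Rightarrow> real set) \<Rightarrow> (real \<Rightarrow> real) set" where
  "grid_box \<tau> I E \<equiv> {\<omega> \<in> space W. \<forall>i\<in>I. inc (\<tau> i, \<tau> (Suc i)) \<omega> \<in> E i}"

text \<open>The two half-line motions have independent increments and are independent of each other.
  With \<open>0\<close> among the grid points every cell belongs to one half, so the probability
  factorizes within the halves and between them; an increment straddling \<open>0\<close> belongs to
  neither motion.\<close>

lemma box_prob_zero_grid:
  fixes \<tau> :: "nat \<Rightarrow> real"
  assumes \<tau>: "\<And>i. i < n \<Longrightarrow> \<tau> i < \<tau> (Suc i)" and m: "m \<le> n" "\<tau> m = 0" and E [measurable]: "\<And>i. E i \<in> sets borel"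
  shows "prob (grid_box \<tau> {..<n} E) =
    (\<Prod>i<n. prob {\<omega> \<in> space W. inc (\<tau> i, \<tau> (Suc i)) \<omega> \<in> E i})"
proof -
  obtain P where P: "two_sided_wiener_measure P" "W = completion P"
    by (rule wiener_base)
  interpret P: prob_space P
    using P by (simp add: two_sided_wiener_measure_def)
  have sp: "space W = space P"
    by (simp add: P(2))
  have ev [measurable]: "(\<lambda>\<omega>. \<omega> t) \<in> borel_measurable P" for t
    using P(1) by (simp add: two_sided_wiener_measure_def eval_measurable)
  have [measurable]: "inc p \<in> borel_measurable P" for p
    unfolding inc_def[abs_def] by measurable
  have [simp]: "measure W {\<omega> \<in> space P. Q \<omega>} = measure P {\<omega> \<in> space P. Q \<omega>}" if "{\<omega> \<in> space P. Q \<omega>} \<in> sets P" for Q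
    using that by (simp add: P(2))
  have mono: "\<tau> i \<le> \<tau> j" if "i \<le> j" "j \<le> n" for i j
    using that
  proof (induction rule: dec_induct)
    case (step k)
    then show ?case
      using \<tau>[of k] by simp
  qed simp
  define X where "X i = inc (\<tau> i, \<tau> (Suc i))" for i
  have X [measurable]: "X i \<in> borel_measurable P" for i
    by (simp add: X_def)
  have pos: "P.prob {\<omega> \<in> space P. \<forall>i\<in>{m..<n}. X i \<omega> \<in> E i} = (\<Prod>i\<in>{m..<n}. P.prob {\<omega> \<in> space P. X i \<omega> \<in> E i})"
  proof (cases "m = n")
    case False
    have "P.indep_vars (\<lambda>_. borel) (\<lambda>i \<omega>. \<omega> (\<tau> (m + Suc i)) - \<omega> (\<tau> (m + i))) {..<n - m}"
      using P(1) \<tau> m unfolding two_sided_wiener_measure_def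
      by (intro standard_brownian_motion_indep[where X = "\<lambda>t \<omega>. \<omega> t" and \<tau> = "\<lambda>i. \<tau> (m + i)"]) auto
    from P.indep_varsD_finite[OF this, of "\<lambda>i. E (m + i)"]
    have "P.prob (\<Inter>i<n - m. X (m + i) -` E (m + i) \<inter> space P) = (\<Prod>i<n - m. P.prob (X (m + i) -` E (m + i) \<inter> space P))"
      using False m by (auto simp: X_def inc_def[abs_def] lessThan_empty_iff)
    moreover have "(\<Inter>i<n - m. X (m + i) -` E (m + i) \<inter> space P) = {\<omega> \<in> space P. \<forall>i\<in>{m..<n}. X i \<omega> \<in> E i}"
    proof -
      have "(\<forall>i<n - m. X (m + i) \<omega> \<in> E (m + i)) \<longleftrightarrow> (\<forall>i\<in>{m..<n}. X i \<omega> \<in> E i)" for \<omega>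
        by (metis (no_types, lifting) add_diff_inverse_nat atLeastLessThan_iff le_add1 less_diff_conv2 linorder_not_le add.commute m(1) nat_add_left_cancel_less)
      moreover have "{..<n - m} \<noteq> {}"
        using False m by (simp add: lessThan_empty_iff)
      ultimately show ?thesis
        by auto
    qed
    moreover have "(\<Prod>i<n - m. P.prob (X (m + i) -` E (m + i) \<inter> space P)) = (\<Prod>i\<in>{m..<n}. P.prob {\<omega> \<in> space P. X i \<omega> \<in> E i})"
      by (rule prod.reindex_bij_witness[of _ "\<lambda>i. i - m" "\<lambda>i. m + i"]) (auto simp: vimage_def Int_def conj_commute)
    ultimately show ?thesis
      by simp
  qed (simp add: P.prob_space)
  have neg: "P.prob {\<omega> \<in> space P. \<forall>i<m. X i \<omega> \<in> E i} = (\<Prod>i<m. P.prob {\<omega> \<in> space P. X i \<omega> \<in> E i})"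
  proof (cases "m = 0")
    case False
    \<comment> \<open>Time reversal: the motion \<open>\<omega> (- t)\<close> sees the cells left of
      \<open>0\<close> in reverse order and with increments of opposite sign.\<close>
    define \<sigma> where "\<sigma> j = - \<tau> (m - j)" for j
    have "\<sigma> j < \<sigma> (Suc j)" if "j < m" for j
      using \<tau>[of "m - Suc j"] that m(1) by (simp add: \<sigma>_def Suc_diff_Suc)
    then have "P.indep_vars (\<lambda>_. borel) (\<lambda>j \<omega>. \<omega> (- \<sigma> (Suc j)) - \<omega> (- \<sigma> j)) {..<m}"
      using P(1) m unfolding two_sided_wiener_measure_def
      by (intro standard_brownian_motion_indep[where X = "\<lambda>t \<omega>. \<omega> (- t)"]) (auto simp: \<sigma>_def)
    moreover have "(\<lambda>\<omega>. \<omega> (- \<sigma> (Suc j)) - \<omega> (- \<sigma> j)) = (\<lambda>\<omega>. - X (m - Suc j) \<omega>)" if "j \<in> {..<m}" for j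
      using that by (simp add: X_def inc_def \<sigma>_def Suc_diff_Suc)
    ultimately have "P.indep_vars (\<lambda>_. borel) (\<lambda>j \<omega>. - X (m - Suc j) \<omega>) {..<m}"
      using P.indep_vars_cong[OF refl, of "{..<m}" "\<lambda>j \<omega>. \<omega> (- \<sigma> (Suc j)) - \<omega> (- \<sigma> j)" "\<lambda>j \<omega>. - X (m - Suc j) \<omega>" "\<lambda>_. borel" "\<lambda>_. borel"]
      by blast
    \<comment> \<open>Reflecting the target sets undoes the sign change.\<close>
    from P.indep_varsD_finite[OF this, of "\<lambda>j. uminus -` E (m - Suc j)"]
    have "P.prob (\<Inter>j<m. X (m - Suc j) -` E (m - Suc j) \<inter> space P) = (\<Prod>j<m. P.prob (X (m - Suc j) -` E (m - Suc j) \<inter> space P))"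
      using False measurable_sets[OF borel_measurable_uminus[OF measurable_ident] E]
      by (auto simp: vimage_def)
    moreover have "(\<Inter>j<m. X (m - Suc j) -` E (m - Suc j) \<inter> space P) = {\<omega> \<in> space P. \<forall>i<m. X i \<omega> \<in> E i}"
    proof -
      have "(\<forall>j<m. X (m - Suc j) \<omega> \<in> E (m - Suc j)) \<longleftrightarrow> (\<forall>i<m. X i \<omega> \<in> E i)" for \<omega>
      proof (intro iffI allI impI)
        fix i assume "\<forall>j<m. X (m - Suc j) \<omega> \<in> E (m - Suc j)" "i < m"
        moreover have "m - Suc (m - Suc i) = i" "m - Suc i < m"
          using \<open>i < m\<close> by auto
        ultimately show "X i \<omega> \<in> E i"
          by metis
      qed auto
      then show ?thesis
        using False by auto
    qed
    moreover have "(\<Prod>j<m. P.prob (X (m - Suc j) -` E (m - Suc j) \<inter> space P)) = (\<Prod>i<m. P.prob {\<omega> \<in> space P. X i \<omega> \<in> E i})"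
      by (rule prod.reindex_bij_witness[of _ "\<lambda>i. m - Suc i" "\<lambda>i. m - Suc i"]) (auto simp: vimage_def Int_def conj_commute)
    ultimately show ?thesis
      by simp
  qed (simp add: P.prob_space)
  \<comment> \<open>Independence of the halves is stated for whole processes, so the two groups of
    conditions are written as cylinder events of the product space.\<close>
  let ?Pi = "Pi\<^sub>M {0::real..} (\<lambda>_. borel :: real measure)"
  let ?A = "{f \<in> space ?Pi. \<forall>i\<in>{m..<n}. f (\<tau> (Suc i)) - f (\<tau> i) \<in> E i}"
  let ?B = "{f \<in> space ?Pi. \<forall>i\<in>{..<m}. f (- \<tau> (Suc i)) - f (- \<tau> i) \<in> E i}"
  have c: "0 \<le> \<tau> i" if "m \<le> i" "i \<le> n" for i
    using mono[of m i] that m by simp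
  have d: "\<tau> i \<le> 0" if "i \<le> m" for i
    using mono[of i m] that m by simp
  have coord: "(\<lambda>f. f t) \<in> borel_measurable ?Pi" if "t \<ge> 0" for t
    using that by (intro measurable_component_singleton) auto
  have diff: "{f \<in> space ?Pi. f t - f s \<in> F} \<in> sets ?Pi" if "t \<ge> 0" "s \<ge> 0" "F \<in> sets borel" for t s F
    using measurable_sets[OF borel_measurable_diff[OF coord coord], of t s F] that
    by (simp add: vimage_def Int_def conj_commute)
  have "?A \<in> sets ?Pi" "?B \<in> sets ?Pi"
    by (intro sets.sets_Collect_finite_All diff finite_atLeastLessThan finite_lessThan E; use c d m in auto)+
  moreover have "P.indep_var ?Pi (\<lambda>\<omega>. \<lambda>t\<in>{0..}. \<omega> t) ?Pi (\<lambda>\<omega>. \<lambda>t\<in>{0..}. \<omega> (- t))"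
    using P(1) by (simp add: two_sided_wiener_measure_def)
  ultimately have "P.prob ((\<lambda>\<omega>. (\<lambda>t\<in>{0..}. \<omega> t, \<lambda>t\<in>{0..}. \<omega> (- t))) -` (?A \<times> ?B) \<inter> space P) =
      P.prob ((\<lambda>\<omega>. \<lambda>t\<in>{0..}. \<omega> t) -` ?A \<inter> space P) * P.prob ((\<lambda>\<omega>. \<lambda>t\<in>{0..}. \<omega> (- t)) -` ?B \<inter> space P)"
    by (intro P.indep_varD)
  moreover have A_eq: "(\<lambda>t\<in>{0..}. \<omega> t) \<in> ?A \<longleftrightarrow> (\<forall>i\<in>{m..<n}. X i \<omega> \<in> E i)" for \<omega>
    using c by (auto simp: space_PiM X_def inc_def)
  moreover have B_eq: "(\<lambda>t\<in>{0..}. \<omega> (- t)) \<in> ?B \<longleftrightarrow> (\<forall>i<m. X i \<omega> \<in> E i)" for \<omega>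
    using d by (auto simp: space_PiM X_def inc_def)
  ultimately have "P.prob {\<omega> \<in> space P. (\<forall>i\<in>{m..<n}. X i \<omega> \<in> E i) \<and> (\<forall>i<m. X i \<omega> \<in> E i)} =
      P.prob {\<omega> \<in> space P. \<forall>i\<in>{m..<n}. X i \<omega> \<in> E i} * P.prob {\<omega> \<in> space P. \<forall>i<m. X i \<omega> \<in> E i}"
    by (simp only: vimage_def Int_def mem_Collect_eq mem_Times_iff fst_conv snd_conv A_eq B_eq conj_commute[of _ "_ \<in> space P"])
  moreover have "(\<forall>i\<in>{m..<n}. X i \<omega> \<in> E i) \<and> (\<forall>i<m. X i \<omega> \<in> E i) \<longleftrightarrow> (\<forall>i<n. X i \<omega> \<in> E i)" for \<omega>
    using m(1) by (metis atLeastLessThan_iff le_trans linorder_not_le nle_le)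
  moreover have "(\<Prod>i\<in>{m..<n}. P.prob {\<omega> \<in> space P. X i \<omega> \<in> E i}) * (\<Prod>i<m. P.prob {\<omega> \<in> space P. X i \<omega> \<in> E i}) =
      (\<Prod>i<n. P.prob {\<omega> \<in> space P. X i \<omega> \<in> E i})"
    using m(1) by (subst prod.union_disjoint[symmetric]) (auto intro!: prod.cong)
  ultimately have "P.prob {\<omega> \<in> space P. \<forall>i<n. X i \<omega> \<in> E i} = (\<Prod>i<n. P.prob {\<omega> \<in> space P. X i \<omega> \<in> E i})"
    using pos neg by simp
  then show ?thesis
    unfolding sp X_def[symmetric] by (simp add: Ball_def)
qed

definition boxes :: "(nat \<Rightarrow> real) \<Rightarrow> nat set \<Rightarrow> (real \<Rightarrow> real) set set" where
  "boxes \<tau> I = {grid_box \<tau> I E | E. \<forall>i. E i \<in> sets borel}"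

lemma boxes_sets: "finite I \<Longrightarrow> boxes \<tau> I \<subseteq> sets W"
  unfolding boxes_def by auto

lemma Int_stable_boxes: "Int_stable (boxes \<tau> I)"
  unfolding Int_stable_def
proof (intro ballI)
  fix a b assume "a \<in> boxes \<tau> I" "b \<in> boxes \<tau> I"
  then obtain E F where "\<And>i. E i \<in> sets borel" "\<And>i. F i \<in> sets borel"
    and "a = grid_box \<tau> I E"
    and "b = grid_box \<tau> I F"
    unfolding boxes_def by blast
  then show "a \<inter> b \<in> boxes \<tau> I"
    unfolding boxes_def by (intro CollectI exI[of _ "\<lambda>i. E i \<inter> F i"]) auto
qed

lemma boxes_prob:
  assumes \<tau>: "\<And>i. i < n \<Longrightarrow> \<tau> i < \<tau> (Suc i)" and m: "m \<le> n" "\<tau> m = 0" and E: "\<And>i. E i \<in> sets borel"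
    and I: "I \<subseteq> {..<n}"
  shows "prob (grid_box \<tau> I E) =
    (\<Prod>i\<in>I. prob {\<omega> \<in> space W. inc (\<tau> i, \<tau> (Suc i)) \<omega> \<in> E i})"
proof -
  define F where "F i = (if i \<in> I then E i else UNIV)" for i
  have "prob (grid_box \<tau> {..<n} F) =
    (\<Prod>i<n. prob {\<omega> \<in> space W. inc (\<tau> i, \<tau> (Suc i)) \<omega> \<in> F i})"
    using E by (intro box_prob_zero_grid[OF \<tau> m]) (auto simp: F_def)
  also have "\<dots> = (\<Prod>i\<in>I. prob {\<omega> \<in> space W. inc (\<tau> i, \<tau> (Suc i)) \<omega> \<in> F i})"
    using I by (intro prod.mono_neutral_right) (auto simp: F_def prob_space)
  also have "\<dots> = (\<Prod>i\<in>I. prob {\<omega> \<in> space W. inc (\<tau> i, \<tau> (Suc i)) \<omega> \<in> E i})"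
    by (intro prod.cong) (auto simp: F_def)
  also have "grid_box \<tau> {..<n} F = grid_box \<tau> I E"
    using I by (auto simp: F_def)
  finally show ?thesis .
qed

lemma indep_boxes:
  assumes \<tau>: "\<And>i. i < n \<Longrightarrow> \<tau> i < \<tau> (Suc i)" and m: "m \<le> n" "\<tau> m = 0"
    and I: "I \<subseteq> {..<n}" "J \<subseteq> {..<n}" "I \<inter> J = {}"
  shows "indep_set (sigma_sets (space W) (boxes \<tau> I)) (sigma_sets (space W) (boxes \<tau> J))"
proof (intro indep_set_sigma_sets Int_stable_boxes indep_setI)
  have fin: "finite I" "finite J"
    using I finite_subset by blast+
  show "boxes \<tau> I \<subseteq> events" "boxes \<tau> J \<subseteq> events"
    using boxes_sets[OF fin(1)] boxes_sets[OF fin(2)] by simp_all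
  fix a b assume "a \<in> boxes \<tau> I" "b \<in> boxes \<tau> J"
  then obtain E F where E: "\<And>i. E i \<in> sets borel" "\<And>i. F i \<in> sets borel"
    and a: "a = grid_box \<tau> I E"
    and b: "b = grid_box \<tau> J F"
    unfolding boxes_def by blast
  define D where "D i = (if i \<in> I then E i else F i)" for i
  have D: "D i \<in> sets borel" for i
    using E by (simp add: D_def)
  have aD: "a = grid_box \<tau> I D"
    unfolding a by (auto simp: D_def)
  have bD: "b = grid_box \<tau> J D"
    unfolding b using I(3) by (auto simp: D_def)
  have "a \<inter> b = grid_box \<tau> (I \<union> J) D"
    unfolding aD bD by auto
  moreover have "I \<union> J \<subseteq> {..<n}"
    using I by auto
  ultimately show "prob (a \<inter> b) = prob a * prob b"
    unfolding aD bD using boxes_prob[OF \<tau> m D] I fin by (simp add: prod.union_disjoint)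
qed

lemma inc_boxes_measurable:
  assumes "a \<le> b" "{a..<b} \<subseteq> I"
  shows "inc (\<tau> a, \<tau> b) \<in> borel_measurable (sigma (space W) (boxes \<tau> I))"
  using assms
proof (induction b rule: dec_induct)
  case base
  have "inc (\<tau> a, \<tau> a) = (\<lambda>_. 0)"
    by (auto simp: inc_def)
  then show ?case
    by simp
next
  case (step b)
  have sub: "boxes \<tau> I \<subseteq> Pow (space W)"
    by (auto simp: boxes_def)
  have "inc (\<tau> b, \<tau> (Suc b)) \<in> borel_measurable (sigma (space W) (boxes \<tau> I))"
  proof (rule measurableI)
    fix E :: "real set" assume E: "E \<in> sets borel"
    have "inc (\<tau> b, \<tau> (Suc b)) -` E \<inter> space W \<in> boxes \<tau> I"
      unfolding boxes_def using step E
      by (intro CollectI exI[of _ "\<lambda>i. if i = b then E else UNIV"]) (auto simp: subset_eq)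
    then show "inc (\<tau> b, \<tau> (Suc b)) -` E \<inter> space (sigma (space W) (boxes \<tau> I)) \<in> sets (sigma (space W) (boxes \<tau> I))"
      using sub by (simp add: space_measure_of_conv)
  qed simp
  moreover have "inc (\<tau> a, \<tau> b) \<in> borel_measurable (sigma (space W) (boxes \<tau> I))"
  proof (rule step.IH)
    show "{a..<b} \<subseteq> I"
      using step.prems by (force simp: subset_eq)
  qed
  moreover have "inc (\<tau> a, \<tau> (Suc b)) = (\<lambda>\<omega>. inc (\<tau> a, \<tau> b) \<omega> + inc (\<tau> b, \<tau> (Suc b)) \<omega>)"
    by (auto simp: inc_def)
  ultimately show ?case
    by simp
qed

section \<open>Events generated by increments over sets of intervals\<close>

text \<open>Finite-dimensional rectangles: a pi-system generating the field of the increments over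
  the intervals of \<open>R\<close>.\<close>

definition inc_events :: "(real \<times> real) set \<Rightarrow> (real \<Rightarrow> real) set set" where
  "inc_events R = {{\<omega> \<in> space W. \<forall>p\<in>F. inc p \<omega> \<in> E p} | F E. finite F \<and> F \<subseteq> R \<and> (\<forall>p. E p \<in> sets borel)}"

lemma inc_events_sets: "inc_events R \<subseteq> sets W"
proof
  fix A assume "A \<in> inc_events R"
  then obtain F E where "finite F" and [measurable]: "\<And>p. E p \<in> sets borel" and A: "A = {\<omega> \<in> space W. \<forall>p\<in>F. inc p \<omega> \<in> E p}"
    unfolding inc_events_def by blast
  show "A \<in> events"
    unfolding A using \<open>finite F\<close> by (intro sets.sets_Collect_finite_All) measurable
qed

lemma Int_stable_inc_events: "Int_stable (inc_events R)"
  unfolding Int_stable_def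
proof (intro ballI)
  fix a b assume "a \<in> inc_events R" "b \<in> inc_events R"
  then obtain F E F' E' where F: "finite F" "F \<subseteq> R" "\<And>p. E p \<in> sets borel" "finite F'" "F' \<subseteq> R" "\<And>p. E' p \<in> sets borel"
    and a: "a = {\<omega> \<in> space W. \<forall>p\<in>F. inc p \<omega> \<in> E p}" and b: "b = {\<omega> \<in> space W. \<forall>p\<in>F'. inc p \<omega> \<in> E' p}"
    unfolding inc_events_def by blast
  define D where "D p = (if p \<in> F then E p else UNIV) \<inter> (if p \<in> F' then E' p else UNIV)" for p
  have "a \<inter> b = {\<omega> \<in> space W. \<forall>p\<in>F \<union> F'. inc p \<omega> \<in> D p}"
    unfolding a b D_def by auto
  moreover have "D p \<in> sets borel" for p
    using F by (auto simp: D_def)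
  ultimately show "a \<inter> b \<in> inc_events R"
    using F unfolding inc_events_def by (intro CollectI exI[of _ "F \<union> F'"] exI[of _ D]) auto
qed

lemma inc_event_in_boxes:
  assumes F: "finite F" "\<And>p. E p \<in> sets borel"
    and grid: "\<And>p. p \<in> F \<Longrightarrow> \<exists>a b. p = (\<tau> a, \<tau> b) \<and> a \<le> b \<and> {a..<b} \<subseteq> I"
  shows "{\<omega> \<in> space W. \<forall>p\<in>F. inc p \<omega> \<in> E p} \<in> sigma_sets (space W) (boxes \<tau> I)"
proof -
  let ?B = "sigma (space W) (boxes \<tau> I)"
  have sub: "boxes \<tau> I \<subseteq> Pow (space W)"
    by (auto simp: boxes_def)
  have "{\<omega> \<in> space ?B. inc p \<omega> \<in> E p} \<in> sets ?B" if "p \<in> F" for p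
  proof -
    have "inc p \<in> borel_measurable ?B"
      using grid[OF that] inc_boxes_measurable by blast
    then show ?thesis
      using F(2) by measurable
  qed
  then have "{\<omega> \<in> space ?B. \<forall>p\<in>F. inc p \<omega> \<in> E p} \<in> sets ?B"
    using F(1) by (intro sets.sets_Collect_finite_All)
  then show ?thesis
    using sub by (simp add: space_measure_of_conv)
qed

end

lemma finite_grid:
  fixes T :: "real set"
  assumes "finite T" "T \<noteq> {}"
  obtains \<tau> :: "nat \<Rightarrow> real" and n where "\<And>i. i < n \<Longrightarrow> \<tau> i < \<tau> (Suc i)" "\<tau> ` {..n} = T"
    "\<And>i j. i \<le> n \<Longrightarrow> j \<le> n \<Longrightarrow> \<tau> i \<le> \<tau> j \<longleftrightarrow> i \<le> j"
proof -
  define xs where "xs = sorted_list_of_set T"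
  define n where "n = length xs - 1"
  have len: "length xs = Suc n"
    using assms unfolding n_def xs_def by (simp add: card_gt_0_iff)
  have xs: "sorted_wrt (<) xs" "set xs = T"
    using assms unfolding xs_def by auto
  have lt: "xs ! i < xs ! j" if "i < j" "j \<le> n" for i j
    using sorted_wrt_nth_less[OF xs(1) that(1)] that(2) len by simp
  show thesis
  proof (rule that[of n "\<lambda>i. xs ! i"])
    show "(\<lambda>i. xs ! i) ` {..n} = T"
      using len xs(2) by (auto simp: set_conv_nth less_Suc_eq_le)
    fix i j assume "i \<le> n" "j \<le> n"
    then show "xs ! i \<le> xs ! j \<longleftrightarrow> i \<le> j"
      using lt[of i j] lt[of j i] by (cases i j rule: linorder_cases) auto
  qed (use lt in auto)
qed

context wiener_noise
begin

section \<open>Completed increment fields and their independence\<close>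

text \<open>The generated field is enlarged by all events almost surely equal to one of its own,
  which brings in every event of probability zero or one. Indexing by an arbitrary set of intervals
  makes room for the complement of an interval, namely a union of two half-lines.\<close>

definition inc_field :: "(real \<times> real) set \<Rightarrow> (real \<Rightarrow> real) set set" where
  "inc_field R = {A \<in> sets W. \<exists>A'\<in>sigma_sets (space W) (inc_events R). AE \<omega> in W. \<omega> \<in> A \<longleftrightarrow> \<omega> \<in> A'}"

definition nonoverlapping :: "(real \<times> real) set \<Rightarrow> (real \<times> real) set \<Rightarrow> bool" where
  "nonoverlapping R R' \<longleftrightarrow> (\<forall>p\<in>R. \<forall>q\<in>R'. snd p \<le> fst q \<or> snd q \<le> fst p)"

text \<open>All end points of two finite families are merged into one grid. An increment over an
  interval is a sum of cell increments, and non-overlapping families use disjoint sets of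
  cells.\<close>

lemma indep_inc_events:
  assumes R: "\<And>p. p \<in> R \<union> R' \<Longrightarrow> fst p \<le> snd p" and no: "nonoverlapping R R'"
  shows "indep_set (sigma_sets (space W) (inc_events R)) (sigma_sets (space W) (inc_events R'))"
proof (intro indep_set_sigma_sets Int_stable_inc_events indep_setI inc_events_sets)
  fix a b assume "a \<in> inc_events R" "b \<in> inc_events R'"
  then obtain F E F' E' where F: "finite F" "F \<subseteq> R" "\<And>p. E p \<in> sets borel" "finite F'" "F' \<subseteq> R'" "\<And>p. E' p \<in> sets borel"
    and a: "a = {\<omega> \<in> space W. \<forall>p\<in>F. inc p \<omega> \<in> E p}" and b: "b = {\<omega> \<in> space W. \<forall>p\<in>F'. inc p \<omega> \<in> E' p}"
    unfolding inc_events_def by blast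
  \<comment> \<open>Time \<open>0\<close> is inserted because independence of cells is available
    only for grids containing it.\<close>
  define T where "T = insert 0 (fst ` (F \<union> F') \<union> snd ` (F \<union> F'))"
  have T: "finite T" "T \<noteq> {}"
    using F by (auto simp: T_def)
  obtain \<tau> n where \<tau>: "\<And>i. i < n \<Longrightarrow> \<tau> i < \<tau> (Suc i)" and im: "\<tau> ` {..n} = T"
    and le: "\<And>i j. i \<le> n \<Longrightarrow> j \<le> n \<Longrightarrow> \<tau> i \<le> \<tau> j \<longleftrightarrow> i \<le> j"
    using finite_grid[OF T] by metis
  have "0 \<in> \<tau> ` {..n}"
    unfolding im by (simp add: T_def)
  then obtain m where m: "m \<le> n" "\<tau> m = 0"
    by auto
  define I where "I F = {i. i < n \<and> (\<exists>p\<in>F. fst p \<le> \<tau> i \<and> \<tau> (Suc i) \<le> snd p)}" for F :: "(real \<times> real) set"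
  have grid: "\<exists>a b. p = (\<tau> a, \<tau> b) \<and> a \<le> b \<and> {a..<b} \<subseteq> I G" if "p \<in> G" "G = F \<or> G = F'" for p G
  proof -
    have "fst p \<in> \<tau> ` {..n}" "snd p \<in> \<tau> ` {..n}"
      unfolding im using that by (auto simp: T_def)
    then obtain c d where cd: "c \<le> n" "d \<le> n" "fst p = \<tau> c" "snd p = \<tau> d"
      by auto
    have "fst p \<le> snd p"
      using R that F by blast
    then have "c \<le> d"
      using cd le[of c d] by simp
    moreover have "{c..<d} \<subseteq> I G"
    proof
      fix i assume i: "i \<in> {c..<d}"
      then have "\<tau> c \<le> \<tau> i" "\<tau> (Suc i) \<le> \<tau> d"
        using le[of c i] le[of "Suc i" d] cd by auto
      with i that cd show "i \<in> I G"
        unfolding I_def by (auto intro!: bexI[of _ p])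
    qed
    ultimately show ?thesis
      using cd by (metis prod.collapse)
  qed
  have "I F \<inter> I F' = {}"
  proof (rule ccontr)
    assume "I F \<inter> I F' \<noteq> {}"
    then obtain i p q where "i < n" "p \<in> F" "q \<in> F'" "fst p \<le> \<tau> i" "\<tau> (Suc i) \<le> snd p" "fst q \<le> \<tau> i" "\<tau> (Suc i) \<le> snd q"
      unfolding I_def by blast
    moreover have "snd p \<le> fst q \<or> snd q \<le> fst p"
      using no F \<open>p \<in> F\<close> \<open>q \<in> F'\<close> unfolding nonoverlapping_def by blast
    ultimately show False
      using \<tau>[of i] by linarith
  qed
  then have "indep_set (sigma_sets (space W) (boxes \<tau> (I F))) (sigma_sets (space W) (boxes \<tau> (I F')))"
    by (intro indep_boxes[OF \<tau> m]) (auto simp: I_def)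
  moreover have "a \<in> sigma_sets (space W) (boxes \<tau> (I F))"
    unfolding a using F grid by (intro inc_event_in_boxes) auto
  moreover have "b \<in> sigma_sets (space W) (boxes \<tau> (I F'))"
    unfolding b using F grid by (intro inc_event_in_boxes) auto
  ultimately show "prob (a \<inter> b) = prob a * prob b"
    by (rule indep_setD)
qed

lemma sigma_inc_events_sets: "sigma_sets (space W) (inc_events R) \<subseteq> sets W"
  by (intro sets.sigma_sets_subset inc_events_sets)

lemma sigma_algebra_inc_field: "sigma_algebra (space W) (inc_field R)"
proof -
  let ?S = "sigma_sets (space W) (inc_events R)"
  have S: "sigma_algebra (space W) ?S"
    using inc_events_sets sets.sets_into_space by (intro sigma_algebra_sigma_sets) blast
  have "space W - A \<in> inc_field R" if "A \<in> inc_field R" for A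
  proof -
    obtain A' where A': "A \<in> sets W" "A' \<in> ?S" "AE \<omega> in W. \<omega> \<in> A \<longleftrightarrow> \<omega> \<in> A'"
      using \<open>A \<in> inc_field R\<close> unfolding inc_field_def by blast
    have "AE \<omega> in W. \<omega> \<in> space W - A \<longleftrightarrow> \<omega> \<in> space W - A'"
      using A'(3) by eventually_elim auto
    moreover have "space W - A' \<in> ?S"
      using A'(2) by (rule sigma_sets.Compl)
    ultimately show ?thesis
      using A'(1) unfolding inc_field_def by blast
  qed
  moreover have "(\<Union>i. A i) \<in> inc_field R" if A: "range A \<subseteq> inc_field R" for A :: "nat \<Rightarrow> _"
  proof -
    have "\<forall>i. \<exists>A'. A' \<in> ?S \<and> (AE \<omega> in W. \<omega> \<in> A i \<longleftrightarrow> \<omega> \<in> A')" and sets_A: "\<And>i. A i \<in> sets W"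
      using A unfolding inc_field_def by blast+
    then obtain A' where A': "\<And>i. A' i \<in> ?S" "\<And>i. AE \<omega> in W. \<omega> \<in> A i \<longleftrightarrow> \<omega> \<in> A' i"
      by metis
    have "AE \<omega> in W. \<forall>i. \<omega> \<in> A i \<longleftrightarrow> \<omega> \<in> A' i"
      using A'(2) by (simp add: AE_all_countable)
    then have "AE \<omega> in W. \<omega> \<in> (\<Union>i. A i) \<longleftrightarrow> \<omega> \<in> (\<Union>i. A' i)"
      by eventually_elim auto
    moreover have "(\<Union>i. A' i) \<in> ?S"
      using A'(1) by (rule sigma_sets.Union)
    ultimately show ?thesis
      using sets_A unfolding inc_field_def by blast
  qed
  moreover have "{} \<in> inc_field R"
    unfolding inc_field_def by (auto intro!: bexI[of _ "{}"] sigma_sets.Empty)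
  moreover have "inc_field R \<subseteq> Pow (space W)"
    unfolding inc_field_def using sets.sets_into_space by blast
  ultimately show ?thesis
    by (intro sigma_algebra_iff2[THEN iffD2]) (auto simp: image_subset_iff)
qed

lemma indep_inc_field:
  assumes "\<And>p. p \<in> R \<union> R' \<Longrightarrow> fst p \<le> snd p" and "nonoverlapping R R'"
  shows "indep_set (inc_field R) (inc_field R')"
proof (rule indep_setI)
  show "inc_field R \<subseteq> events" "inc_field R' \<subseteq> events"
    unfolding inc_field_def by auto
  fix A B assume "A \<in> inc_field R" "B \<in> inc_field R'"
  then obtain A' B' where A: "A \<in> events" "A' \<in> sigma_sets (space W) (inc_events R)" "AE \<omega> in W. \<omega> \<in> A \<longleftrightarrow> \<omega> \<in> A'"
    and B: "B \<in> events" "B' \<in> sigma_sets (space W) (inc_events R')" "AE \<omega> in W. \<omega> \<in> B \<longleftrightarrow> \<omega> \<in> B'"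
    unfolding inc_field_def by blast
  have [measurable]: "A' \<in> events" "B' \<in> events" "A \<in> events" "B \<in> events"
    using A B sigma_inc_events_sets by blast+
  have "prob (A \<inter> B) = prob (A' \<inter> B')"
    using A(3) B(3) by (intro finite_measure_eq_AE) auto
  also have "\<dots> = prob A' * prob B'"
    using indep_inc_events[OF assms] A(2) B(2) by (rule indep_setD)
  also have "prob A' = prob A"
    using A(3) by (intro finite_measure_eq_AE) auto
  also have "prob B' = prob B"
    using B(3) by (intro finite_measure_eq_AE) auto
  finally show "prob (A \<inter> B) = prob A * prob B" .
qed

definition inc_algebra :: "(real \<times> real) set \<Rightarrow> (real \<Rightarrow> real) measure" where
  "inc_algebra R = sigma (space W) (inc_field R)"

lemma space_inc_algebra [simp]: "space (inc_algebra R) = space W"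
  by (simp add: inc_algebra_def space_measure_of_conv)

lemma sets_inc_algebra [simp]: "sets (inc_algebra R) = inc_field R"
  unfolding inc_algebra_def by (rule sigma_algebra.sets_measure_of_eq[OF sigma_algebra_inc_field])

lemma indep_var_inc_algebra:
  assumes "\<And>p. p \<in> R \<union> R' \<Longrightarrow> fst p \<le> snd p" and "nonoverlapping R R'"
    and U: "U \<in> measurable (inc_algebra R) Y" and V: "V \<in> measurable (inc_algebra R') Z"
  shows "indep_var Y U Z V"
proof -
  have ind: "indep_set (inc_field R) (inc_field R')"
    using assms(1,2) by (rule indep_inc_field)
  have gen: "sigma_sets (space W) {X -` A \<inter> space W | A. A \<in> sets Y} \<subseteq> inc_field R"
    if "X \<in> measurable (inc_algebra R) Y" for X :: "_ \<Rightarrow> 'z" and Y R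
    using measurable_sets[OF that] by (intro sigma_algebra.sigma_sets_subset[OF sigma_algebra_inc_field]) auto
  have sub: "sets (inc_algebra R) \<subseteq> events" for R
    by (auto simp: inc_field_def)
  have "X \<in> measurable W Y" if "X \<in> measurable (inc_algebra R) Y" for X :: "_ \<Rightarrow> 'z" and Y R
    using that sub[of R] by (auto simp: measurable_def)
  moreover have "indep_set (sigma_sets (space W) {U -` A \<inter> space W | A. A \<in> sets Y})
      (sigma_sets (space W) {V -` A \<inter> space W | A. A \<in> sets Z})"
  proof (rule indep_setI)
    fix a b assume "a \<in> sigma_sets (space W) {U -` A \<inter> space W | A. A \<in> sets Y}"
      "b \<in> sigma_sets (space W) {V -` A \<inter> space W | A. A \<in> sets Z}"
    then have "a \<in> inc_field R" "b \<in> inc_field R'"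
      using gen[OF U] gen[OF V] by blast+
    then show "prob (a \<inter> b) = prob a * prob b"
      using ind by (intro indep_setD)
  qed (use gen[OF U] gen[OF V] sub in auto)
  ultimately show ?thesis
    unfolding indep_var_eq using U V by blast
qed

definition between :: "ereal \<Rightarrow> ereal \<Rightarrow> (real \<times> real) set" where
  "between s t = {(u, v). s \<le> ereal u \<and> u \<le> v \<and> ereal v \<le> t}"

text \<open>Events of probability zero or one are almost surely equal to \<open>{}\<close> or to the
  whole space, so they survive the passage to the completed field. Through this inclusion locality
  becomes usable.\<close>

lemma increment_field_subset:
  "sets (increment_field W s t) \<subseteq> inc_field (between s t)" "space (increment_field W s t) = space W"
proof -
  let ?G = "{(\<lambda>\<omega>. \<omega> v - \<omega> u) -` E \<inter> space W | u v E. s \<le> ereal u \<and> u \<le> v \<and> ereal v \<le> t \<and> E \<in> sets borel} \<union>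
      {N \<in> sets W. measure W N = 0 \<or> measure W N = 1}"
  have "?G \<subseteq> inc_field (between s t)"
  proof
    fix A assume "A \<in> ?G"
    then consider u v E where "A = (\<lambda>\<omega>. \<omega> v - \<omega> u) -` E \<inter> space W" "s \<le> ereal u" "u \<le> v" "ereal v \<le> t" "E \<in> sets borel"
      | "A \<in> sets W" "prob A = 0" | "A \<in> sets W" "prob A = 1"
      by blast
    then show "A \<in> inc_field (between s t)"
    proof cases
      case 1
      have "A = {\<omega> \<in> space W. \<forall>p\<in>{(u, v)}. inc p \<omega> \<in> E}"
        unfolding 1 by (auto simp: inc_def)
      then have "A \<in> inc_events (between s t)"
        unfolding inc_events_def using 1(2-5)
        by (intro CollectI exI[of _ "{(u, v)}"] exI[of _ "\<lambda>_. E"]) (auto simp: between_def)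
      then show ?thesis
        unfolding inc_field_def using inc_events_sets by (blast intro: sigma_sets.Basic)
    next
      case 2
      then have "AE \<omega> in W. \<omega> \<notin> A"
        by (simp add: prob_eq_0)
      then have "AE \<omega> in W. \<omega> \<in> A \<longleftrightarrow> \<omega> \<in> {}"
        by eventually_elim auto
      with 2(1) show ?thesis
        unfolding inc_field_def by (blast intro: sigma_sets.Empty)
    next
      case 3
      then have "AE \<omega> in W. \<omega> \<in> A"
        by (simp add: prob_eq_1)
      then have "AE \<omega> in W. \<omega> \<in> A \<longleftrightarrow> \<omega> \<in> space W"
        using AE_space by eventually_elim auto
      with 3(1) show ?thesis
        unfolding inc_field_def by (blast intro: sigma_sets_top)
    qed
  qed
  then have "sigma_sets (space W) ?G \<subseteq> inc_field (between s t)"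
    by (rule sigma_algebra.sigma_sets_subset[OF sigma_algebra_inc_field])
  moreover have "?G \<subseteq> Pow (space W)"
    using sets.sets_into_space by blast
  ultimately show "sets (increment_field W s t) \<subseteq> inc_field (between s t)"
    unfolding increment_field_def by (subst sets_measure_of)
  show "space (increment_field W s t) = space W"
    unfolding increment_field_def by (simp add: space_measure_of_conv)
qed

lemma measurable_increment_field:
  assumes "X \<in> measurable (increment_field W s t) Y"
  shows "X \<in> measurable (inc_algebra (between s t)) Y"
  using assms increment_field_subset[of s t] by (auto simp: measurable_def)

lemma measurable_inc_algebra_mono:
  assumes X: "X \<in> measurable (inc_algebra R) Y" and "R \<subseteq> R'"
  shows "X \<in> measurable (inc_algebra R') Y"
proof -
  have "inc_events R \<subseteq> inc_events R'"
    using \<open>R \<subseteq> R'\<close> unfolding inc_events_def by blast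
  then have "inc_field R \<subseteq> inc_field R'"
    unfolding inc_field_def using sigma_sets_mono'[of "inc_events R" "inc_events R'"] by blast
  then show ?thesis
    using X by (auto simp: measurable_def)
qed

lemma measurable_inc_algebra_W:
  assumes X: "X \<in> measurable (inc_algebra R) Y"
  shows "X \<in> measurable W Y"
  using X by (auto simp: measurable_def inc_field_def)

lemma inc_measurable_inc_algebra:
  assumes "p \<in> R"
  shows "inc p \<in> borel_measurable (inc_algebra R)"
proof (rule measurableI)
  fix E :: "real set" assume "E \<in> sets borel"
  then have "inc p -` E \<inter> space W \<in> inc_events R"
    unfolding inc_events_def using assms by (intro CollectI exI[of _ "{p}"] exI[of _ "\<lambda>_. E"]) auto
  then show "inc p -` E \<inter> space (inc_algebra R) \<in> sets (inc_algebra R)"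
    using inc_events_sets unfolding space_inc_algebra sets_inc_algebra inc_field_def
    by (blast intro: sigma_sets.Basic)
qed simp

text \<open>The constant is \<open>8 * 3\<close>: an interval straddling \<open>0\<close> is cut
  there with \<open>power4_sum_le\<close>, each half contributing \<open>3\<close> times its squared
  length. Only the order \<open>(t - s)^2\<close> matters later.\<close>

lemma inc_moment4:
  assumes "s < t"
  shows "integrable W (\<lambda>\<omega>. (inc (s, t) \<omega>) ^ 4) \<and> expectation (\<lambda>\<omega>. (inc (s, t) \<omega>) ^ 4) \<le> 24 * (t - s)\<^sup>2"
proof -
  obtain P where P: "two_sided_wiener_measure P" "W = completion P"
    by (rule wiener_base)
  have [measurable]: "(\<lambda>\<omega>. \<omega> t) \<in> borel_measurable P" for t
    using P(1) by (simp add: two_sided_wiener_measure_def eval_measurable)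
  have [measurable]: "inc p \<in> borel_measurable P" for p
    unfolding inc_def[abs_def] by measurable
  have sbm: "standard_brownian_motion P (\<lambda>t \<omega>. \<omega> t)" "standard_brownian_motion P (\<lambda>t \<omega>. \<omega> (- t))"
    using P(1) by (simp_all add: two_sided_wiener_measure_def)
  have one: "integrable P (\<lambda>\<omega>. (inc (u, v) \<omega>) ^ 4) \<and> (\<integral>\<omega>. (inc (u, v) \<omega>) ^ 4 \<partial>P) = 3 * (v - u)\<^sup>2"
    if "u < v" "0 \<le> u \<or> v \<le> 0" for u v
    using that(2)
  proof
    assume "0 \<le> u"
    then show ?thesis
      using standard_brownian_motion_moment4[OF sbm(1), of u v] that(1) by (simp add: inc_def)
  next
    assume "v \<le> 0"
    moreover have "(inc (u, v) \<omega>) ^ 4 = (\<omega> u - \<omega> v) ^ 4" for \<omega>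
      by (simp add: inc_def power4_eq_xxxx algebra_simps)
    ultimately show ?thesis
      using standard_brownian_motion_moment4[OF sbm(2), of "- v" "- u"] that(1)
      by (simp add: power2_eq_square algebra_simps)
  qed
  have "integrable P (\<lambda>\<omega>. (inc (s, t) \<omega>) ^ 4) \<and> (\<integral>\<omega>. (inc (s, t) \<omega>) ^ 4 \<partial>P) \<le> 24 * (t - s)\<^sup>2"
  proof (cases "0 \<le> s \<or> t \<le> 0")
    case True
    then show ?thesis
      using one[OF assms] by simp
  next
    case False
    have s0: "integrable P (\<lambda>\<omega>. (inc (s, 0) \<omega>) ^ 4)" "(\<integral>\<omega>. (inc (s, 0) \<omega>) ^ 4 \<partial>P) = 3 * s\<^sup>2"
      and t0: "integrable P (\<lambda>\<omega>. (inc (0, t) \<omega>) ^ 4)" "(\<integral>\<omega>. (inc (0, t) \<omega>) ^ 4 \<partial>P) = 3 * t\<^sup>2"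
      using one[of s 0] one[of 0 t] False by auto
    have le: "(inc (s, t) \<omega>) ^ 4 \<le> 8 * ((inc (s, 0) \<omega>) ^ 4 + (inc (0, t) \<omega>) ^ 4)" for \<omega>
      using power4_sum_le[of "inc (s, 0) \<omega>" "inc (0, t) \<omega>"] by (simp add: inc_def)
    have int: "integrable P (\<lambda>\<omega>. (inc (s, t) \<omega>) ^ 4)"
      by (rule Bochner_Integration.integrable_bound[of _ "\<lambda>\<omega>. 8 * ((inc (s, 0) \<omega>) ^ 4 + (inc (0, t) \<omega>) ^ 4)"])
        (use s0 t0 le in auto)
    have "(\<integral>\<omega>. (inc (s, t) \<omega>) ^ 4 \<partial>P) \<le> (\<integral>\<omega>. 8 * ((inc (s, 0) \<omega>) ^ 4 + (inc (0, t) \<omega>) ^ 4) \<partial>P)"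
      using s0 t0 int le by (intro integral_mono) auto
    also have "\<dots> = 24 * (s\<^sup>2 + t\<^sup>2)"
      using s0 t0 by simp
    also have "\<dots> \<le> 24 * (t - s)\<^sup>2"
      using False mult_nonneg_nonpos[of t s] by (simp add: power2_eq_square algebra_simps)
    finally show ?thesis
      using int by simp
  qed
  then show ?thesis
    by (simp add: P(2) integral_completion integrable_completion)
qed

text \<open>Any finite family of intervals inside \<open>[s, t]\<close> is refined by a grid from
  \<open>s\<close> to \<open>t\<close>, and the finite-dimensional rectangles form a pi-system.
  Checking \<open>D\<close> against grid boxes therefore yields independence from the whole
  field.\<close>

lemma indep_of_increments:
  assumes D: "D \<in> events" and "s < t"
    and grid: "\<And>n \<tau> E. (\<And>i. i < n \<Longrightarrow> \<tau> i < \<tau> (Suc i)) \<Longrightarrow> \<tau> 0 = s \<Longrightarrow> \<tau> n = t \<Longrightarrow> (\<And>i. E i \<in> sets borel) \<Longrightarrow>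
      prob (D \<inter> grid_box \<tau> {..<n} E) =
      prob D * prob (grid_box \<tau> {..<n} E)"
    and A: "A \<in> inc_field (between (ereal s) (ereal t))"
  shows "prob (D \<inter> A) = prob D * prob A"
proof -
  let ?R = "between (ereal s) (ereal t)"
  have box: "indep_set (sigma_sets (space W) {D}) (sigma_sets (space W) (boxes \<tau> {..<n}))"
    if "\<And>i. i < n \<Longrightarrow> \<tau> i < \<tau> (Suc i)" "\<tau> 0 = s" "\<tau> n = t" for n \<tau>
  proof (intro indep_set_sigma_sets indep_setI Int_stable_boxes boxes_sets)
    fix a b assume "a \<in> {D}" "b \<in> boxes \<tau> {..<n}"
    then show "prob (a \<inter> b) = prob a * prob b"
      using grid[OF that] by (auto simp: boxes_def)
  qed (use D in \<open>auto simp: Int_stable_def\<close>)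
  have "indep_set (sigma_sets (space W) {D}) (sigma_sets (space W) (inc_events ?R))"
  proof (intro indep_set_sigma_sets indep_setI Int_stable_inc_events inc_events_sets)
    fix a b assume a: "a \<in> {D}" and "b \<in> inc_events ?R"
    then obtain F E where F: "finite F" "F \<subseteq> ?R" "\<And>p. E p \<in> sets borel"
      and b: "b = {\<omega> \<in> space W. \<forall>p\<in>F. inc p \<omega> \<in> E p}"
      unfolding inc_events_def by blast
    define T where "T = {s, t} \<union> (fst ` F \<union> snd ` F)"
    have T: "finite T" "T \<noteq> {}"
      using F by (auto simp: T_def)
    obtain \<tau> n where \<tau>: "\<And>i. i < n \<Longrightarrow> \<tau> i < \<tau> (Suc i)" and im: "\<tau> ` {..n} = T"
      and le: "\<And>i j. i \<le> n \<Longrightarrow> j \<le> n \<Longrightarrow> \<tau> i \<le> \<tau> j \<longleftrightarrow> i \<le> j"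
      using finite_grid[OF T] by metis
    have F_bounds: "s \<le> fst p \<and> fst p \<le> snd p \<and> snd p \<le> t" if "p \<in> F" for p
      using F(2) that by (auto simp: between_def)
    have bounds: "s \<le> x \<and> x \<le> t" if "x \<in> T" for x
      using that \<open>s < t\<close> F_bounds by (force simp: T_def)
    have "s \<in> \<tau> ` {..n}" "t \<in> \<tau> ` {..n}"
      unfolding im by (simp_all add: T_def)
    then obtain c d where "c \<le> n" "\<tau> c = s" "d \<le> n" "\<tau> d = t"
      by auto
    moreover have "\<tau> 0 \<in> T" "\<tau> n \<in> T"
      unfolding im[symmetric] by auto
    ultimately have ends: "\<tau> 0 = s" "\<tau> n = t"
      using bounds[of "\<tau> 0"] bounds[of "\<tau> n"] le[of 0 c] le[of d n] by auto
    have "\<exists>a b. p = (\<tau> a, \<tau> b) \<and> a \<le> b \<and> {a..<b} \<subseteq> {..<n}" if "p \<in> F" for p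
    proof -
      have "fst p \<in> \<tau> ` {..n}" "snd p \<in> \<tau> ` {..n}"
        unfolding im using that by (auto simp: T_def)
      then obtain c d where cd: "c \<le> n" "d \<le> n" "fst p = \<tau> c" "snd p = \<tau> d"
        by auto
      then have "c \<le> d"
        using F_bounds[OF that] le[of c d] by simp
      then show ?thesis
        using cd by (intro exI[of _ c] exI[of _ d]) (auto simp: prod_eq_iff)
    qed
    then have "b \<in> sigma_sets (space W) (boxes \<tau> {..<n})"
      unfolding b using F by (intro inc_event_in_boxes)
    with a show "prob (a \<inter> b) = prob a * prob b"
      by (intro indep_setD[OF box[OF \<tau> ends]]) auto
  qed (use D in \<open>auto simp: Int_stable_def\<close>)
  moreover obtain A' where A': "A \<in> events" "A' \<in> sigma_sets (space W) (inc_events ?R)" "AE \<omega> in W. \<omega> \<in> A \<longleftrightarrow> \<omega> \<in> A'"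
    using A unfolding inc_field_def by blast
  ultimately have "prob (D \<inter> A') = prob D * prob A'"
    by (intro indep_setD) auto
  moreover have [measurable]: "A' \<in> events"
    using A'(2) sigma_inc_events_sets by blast
  have "prob A = prob A'" "prob (D \<inter> A) = prob (D \<inter> A')"
    using A' D by (auto intro!: finite_measure_eq_AE)
  ultimately show ?thesis
    by simp
qed

end

section \<open>Multiplicative families of events\<close>

context wiener_noise
begin

lemma nonoverlapping_between: "nonoverlapping (between s (ereal t)) (between (ereal t) u)"
  unfolding nonoverlapping_def between_def by auto

lemma between_le: "p \<in> between s t \<Longrightarrow> fst p \<le> snd p"
  unfolding between_def by auto

lemma indep_adjacent: "indep_set (inc_field (between s (ereal t))) (inc_field (between (ereal t) u))"
  by (intro indep_inc_field nonoverlapping_between) (auto dest: between_le)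

lemma indep_var_adjacent:
  assumes "X \<in> measurable (inc_algebra (between s (ereal t))) Y" "X' \<in> measurable (inc_algebra (between (ereal t) u)) Z"
  shows "indep_var Y X Z X'"
  by (rule indep_var_inc_algebra[OF _ nonoverlapping_between assms]) (auto dest: between_le)

lemma inc_field_Int: "A \<in> inc_field R \<Longrightarrow> B \<in> inc_field R \<Longrightarrow> A \<inter> B \<in> inc_field R"
  using sets.Int[of A "inc_algebra R" B] by simp

lemma inc_field_sets: "A \<in> inc_field R \<Longrightarrow> A \<in> sets W"
  by (simp add: inc_field_def)

end

text \<open>Intended instance: \<open>D s t\<close> says that \<open>M\<close> misses a fixed Borel
  set within \<open>(s, t)\<close>. Splitting is required only almost surely because the cut point
  \<open>t\<close> belongs to neither open interval.\<close>

locale multiplicative_events = wiener_noise +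
  fixes D :: "real \<Rightarrow> real \<Rightarrow> (real \<Rightarrow> real) set"
  assumes D: "\<And>s t. s < t \<Longrightarrow> D s t \<in> inc_field (between (ereal s) (ereal t))"
    and D_split: "\<And>s t u. s < t \<Longrightarrow> t < u \<Longrightarrow> AE \<omega> in W. \<omega> \<in> D s u \<longleftrightarrow> \<omega> \<in> D s t \<and> \<omega> \<in> D t u"
begin

lemma D_sets [measurable]: "s < t \<Longrightarrow> D s t \<in> sets W"
  using D inc_field_sets by blast

lemma prob_D_mult:
  assumes "s < t" "t < u"
  shows "prob (D s u) = prob (D s t) * prob (D t u)"
proof -
  have "prob (D s u) = prob (D s t \<inter> D t u)"
    using D_split[OF assms] assms by (intro finite_measure_eq_AE) auto
  also have "\<dots> = prob (D s t) * prob (D t u)"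
    using assms D by (intro indep_setD[OF indep_adjacent])
  finally show ?thesis .
qed

section \<open>Joint characteristic functions of events and increments\<close>

text \<open>The joint transform of the event and the increment; \<open>\<Psi>\<close> below is the
  value it would have under independence. Both are multiplicative over adjacent intervals and
  bounded by \<open>1\<close>, so local errors add up.\<close>

definition \<Phi> :: "real \<Rightarrow> real \<Rightarrow> real \<Rightarrow> complex" where
  "\<Phi> \<theta> s t = expectation (\<lambda>\<omega>. indicator (D s t) \<omega> * iexp (\<theta> * inc (s, t) \<omega>))"

definition \<Psi> :: "real \<Rightarrow> real \<Rightarrow> real \<Rightarrow> complex" where
  "\<Psi> \<theta> s t = prob (D s t) * expectation (\<lambda>\<omega>. iexp (\<theta> * inc (s, t) \<omega>))"

lemma iexp_measurable:
  assumes "s < t"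
  shows "(\<lambda>\<omega>. iexp (\<theta> * inc (s, t) \<omega>)) \<in> borel_measurable (inc_algebra (between (ereal s) (ereal t)))"
proof -
  have [measurable]: "inc (s, t) \<in> borel_measurable (inc_algebra (between (ereal s) (ereal t)))"
    using assms by (intro inc_measurable_inc_algebra) (simp add: between_def)
  show ?thesis
    by measurable
qed

lemma ind_iexp_measurable:
  assumes "s < t"
  shows "(\<lambda>\<omega>. indicator (D s t) \<omega> * iexp (\<theta> * inc (s, t) \<omega>)) \<in> borel_measurable (inc_algebra (between (ereal s) (ereal t)))"
proof -
  have [measurable]: "D s t \<in> sets (inc_algebra (between (ereal s) (ereal t)))"
    using D[OF assms] by simp
  note [measurable] = iexp_measurable[OF assms]
  show ?thesis
    by measurable
qed

lemma integrable_iexp: "integrable W (\<lambda>\<omega>. iexp (\<theta> * inc (s, t) \<omega>))"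
  by (rule integrable_const_bound[of _ 1]) auto

lemma integrable_ind_iexp: "s < t \<Longrightarrow> integrable W (\<lambda>\<omega>. indicator (D s t) \<omega> * iexp (\<theta> * inc (s, t) \<omega>))"
  by (rule integrable_const_bound[of _ 1]) (auto simp: norm_mult indicator_def)

lemma \<Phi>_mult:
  assumes "s < t" "t < u"
  shows "\<Phi> \<theta> s u = \<Phi> \<theta> s t * \<Phi> \<theta> t u"
proof -
  have "\<Phi> \<theta> s u = expectation (\<lambda>\<omega>. (indicator (D s t) \<omega> * iexp (\<theta> * inc (s, t) \<omega>)) *
      (indicator (D t u) \<omega> * iexp (\<theta> * inc (t, u) \<omega>)))"
    unfolding \<Phi>_def
  proof (rule integral_cong_AE)
    show "AE \<omega> in W. indicator (D s u) \<omega> * iexp (\<theta> * inc (s, u) \<omega>) =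
      (indicator (D s t) \<omega> * iexp (\<theta> * inc (s, t) \<omega>)) * (indicator (D t u) \<omega> * iexp (\<theta> * inc (t, u) \<omega>))"
      using D_split[OF assms] by eventually_elim (auto simp: indicator_def inc_def exp_add[symmetric] algebra_simps)
  qed (use assms in \<open>auto intro!: borel_measurable_times borel_measurable_indicator\<close>)
  also have "\<dots> = \<Phi> \<theta> s t * \<Phi> \<theta> t u"
    unfolding \<Phi>_def using assms
    by (intro indep_var_lebesgue_integral integrable_ind_iexp
      indep_var_adjacent[OF ind_iexp_measurable ind_iexp_measurable])
  finally show ?thesis .
qed

lemma \<Psi>_mult:
  assumes "s < t" "t < u"
  shows "\<Psi> \<theta> s u = \<Psi> \<theta> s t * \<Psi> \<theta> t u"
proof -
  have "expectation (\<lambda>\<omega>. iexp (\<theta> * inc (s, u) \<omega>)) =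
      expectation (\<lambda>\<omega>. iexp (\<theta> * inc (s, t) \<omega>) * iexp (\<theta> * inc (t, u) \<omega>))"
    by (auto simp: inc_def exp_add[symmetric] algebra_simps)
  also have "\<dots> = expectation (\<lambda>\<omega>. iexp (\<theta> * inc (s, t) \<omega>)) * expectation (\<lambda>\<omega>. iexp (\<theta> * inc (t, u) \<omega>))"
    using assms by (intro indep_var_lebesgue_integral integrable_iexp
      indep_var_adjacent[OF iexp_measurable iexp_measurable])
  finally show ?thesis
    using prob_D_mult[OF assms] by (simp add: \<Psi>_def)
qed

lemma norm_\<Phi>: "s < t \<Longrightarrow> norm (\<Phi> \<theta> s t) \<le> 1"
  unfolding \<Phi>_def
  by (rule order_trans[OF integral_norm_bound])
    (intro integral_le_const integrable_norm integrable_ind_iexp; auto simp: norm_mult indicator_def)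

lemma norm_\<Psi>: "norm (\<Psi> \<theta> s t) \<le> 1"
proof -
  have "norm (expectation (\<lambda>\<omega>. iexp (\<theta> * inc (s, t) \<omega>))) \<le> 1"
    by (rule order_trans[OF integral_norm_bound])
      (intro integral_le_const integrable_norm integrable_iexp; auto)
  then show ?thesis
    unfolding \<Psi>_def by (simp add: norm_mult mult_le_one)
qed

text \<open>Where the event fails, which has probability \<open>1 - prob (D s t)\<close>, the increment is small with
  overwhelming probability by the fourth moment bound.\<close>

lemma \<Phi>_\<Psi>_local:
  assumes st: "s < t" and \<eta>: "\<eta> > 0"
  shows "norm (\<Phi> \<theta> s t - \<Psi> \<theta> s t) \<le> \<bar>\<theta>\<bar> * (2 * \<eta> * (1 - prob (D s t)) + 24 * (t - s)\<^sup>2 / \<eta> ^ 3)"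
proof -
  let ?p = "prob (D s t)" and ?X = "inc (s, t)"
  let ?e = "\<lambda>\<omega>. iexp (\<theta> * ?X \<omega>)"
  have [measurable]: "D s t \<in> sets W"
    using st by simp
  have int_g: "integrable W (\<lambda>\<omega>. 1 - indicator (D s t) \<omega> + (1 - ?p) :: real)"
  proof (rule integrable_const_bound[of _ 3], rule AE_I2)
    fix \<omega>
    have "indicator (D s t) \<omega> = (0 :: real) \<or> indicator (D s t) \<omega> = (1 :: real)"
      by (simp add: indicator_def)
    then have "\<bar>1 - indicator (D s t) \<omega> + (1 - ?p)\<bar> \<le> 3"
      using measure_nonneg[of W "D s t"] prob_le_1[of "D s t"] by linarith
    then show "norm (1 - indicator (D s t) \<omega> + (1 - ?p) :: real) \<le> 3"
      by simp
  qed measurable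
  have E_g: "expectation (\<lambda>\<omega>. 1 - indicator (D s t) \<omega> + (1 - ?p)) = 1 - ?p + (1 - ?p)"
  proof -
    have "integrable W (indicator (D s t) :: _ \<Rightarrow> real)"
      by (rule integrable_const_bound[of _ 1]) (auto simp: indicator_def)
    then show ?thesis
      by (simp add: prob_space)
  qed
  note int4 = inc_moment4[OF st]
  \<comment> \<open>The indicator minus \<open>?p\<close> has mean zero, so \<open>1\<close> may be
    subtracted from the exponential, which then is small wherever the increment is small.\<close>
  have "\<Phi> \<theta> s t - \<Psi> \<theta> s t = expectation (\<lambda>\<omega>. indicator (D s t) \<omega> * ?e \<omega> - complex_of_real ?p * ?e \<omega> - (complex_of_real (indicator (D s t) \<omega> - ?p)))"
  proof -
    have "expectation (\<lambda>\<omega>. complex_of_real (indicator (D s t) \<omega> - ?p)) = 0"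
      by (simp only: integral_complex_of_real, subst Bochner_Integration.integral_diff)
        (auto simp: prob_space emeasure_eq_measure)
    moreover have "complex_integrable W (\<lambda>\<omega>. complex_of_real (indicator (D s t) \<omega> - ?p))"
      by (rule integrable_const_bound[of _ 1]) (auto simp: indicator_def simp del: of_real_diff)
    ultimately show ?thesis
      using integrable_ind_iexp[OF st, of \<theta>] integrable_iexp[of \<theta> s t] unfolding \<Phi>_def \<Psi>_def
      by (subst Bochner_Integration.integral_diff Bochner_Integration.integral_diff; simp)+
  qed
  also have "\<dots> = expectation (\<lambda>\<omega>. complex_of_real (indicator (D s t) \<omega> - ?p) * (?e \<omega> - 1))"
    by (intro Bochner_Integration.integral_cong) (auto simp: algebra_simps indicator_def)
  also have "norm \<dots> \<le> expectation (\<lambda>\<omega>. norm (complex_of_real (indicator (D s t) \<omega> - ?p) * (?e \<omega> - 1)))"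
    by (rule integral_norm_bound)
  also have "\<dots> \<le> expectation (\<lambda>\<omega>. \<bar>\<theta>\<bar> * (\<eta> * (1 - indicator (D s t) \<omega> + (1 - ?p)) + (?X \<omega>) ^ 4 / \<eta> ^ 3))"
  proof (rule integral_mono)
    show "integrable W (\<lambda>\<omega>. norm (complex_of_real (indicator (D s t) \<omega> - ?p) * (?e \<omega> - 1)))"
    proof (rule integrable_const_bound[of _ "1 * 2"])
      have "norm (?e \<omega> - 1) \<le> 2" for \<omega>
        by (rule order_trans[OF norm_triangle_ineq4]) simp
      moreover have "\<bar>indicator (D s t) \<omega> - ?p\<bar> \<le> 1" for \<omega>
        by (auto simp: indicator_def)
      ultimately show "AE \<omega> in W. norm (norm (complex_of_real (indicator (D s t) \<omega> - ?p) * (?e \<omega> - 1))) \<le> 1 * 2"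
        by (intro AE_I2, unfold norm_mult norm_of_real, intro mult_mono) simp_all
    qed measurable
    show "integrable W (\<lambda>\<omega>. \<bar>\<theta>\<bar> * (\<eta> * (1 - indicator (D s t) \<omega> + (1 - ?p)) + (?X \<omega>) ^ 4 / \<eta> ^ 3))"
      using int_g int4 by (intro integrable_mult_right Bochner_Integration.integrable_add int_g integrable_divide) auto
    fix \<omega>
    have "norm (?e \<omega> - 1) \<le> \<bar>\<theta> * ?X \<omega>\<bar>"
      using iexp_approx1[of "\<theta> * ?X \<omega>" 0] by simp
    \<comment> \<open>The first bound has mean \<open>2 * (1 - ?p)\<close> and is paired with the
      threshold \<open>\<eta>\<close>; the second, constant bound is paired with the fourth
      moment.\<close>
    moreover have ind: "\<bar>indicator (D s t) \<omega> - ?p\<bar> \<le> 1 - indicator (D s t) \<omega> + (1 - ?p)" "\<bar>indicator (D s t) \<omega> - ?p\<bar> \<le> 1"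
      by (auto simp: indicator_def)
    ultimately have "norm (complex_of_real (indicator (D s t) \<omega> - ?p) * (?e \<omega> - 1)) \<le> \<bar>indicator (D s t) \<omega> - ?p\<bar> * (\<bar>\<theta>\<bar> * \<bar>?X \<omega>\<bar>)"
      unfolding norm_mult norm_of_real abs_mult by (intro mult_left_mono) auto
    \<comment> \<open>Splitting at the threshold: an increment is at most \<open>\<eta>\<close>, or
      else at most its fourth power over \<open>\<eta>^3\<close>.\<close>
    also have "\<dots> \<le> \<bar>indicator (D s t) \<omega> - ?p\<bar> * (\<bar>\<theta>\<bar> * (\<eta> + (?X \<omega>) ^ 4 / \<eta> ^ 3))"
    proof -
      have "\<bar>x\<bar> \<le> \<eta> + x ^ 4 / \<eta> ^ 3" for x
      proof (cases "\<bar>x\<bar> \<le> \<eta>")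
        case False
        then have "\<eta> ^ 3 * \<bar>x\<bar> \<le> \<bar>x\<bar> ^ 3 * \<bar>x\<bar>"
          using \<eta> by (intro mult_right_mono power_mono) auto
        also have "\<dots> = x ^ 4"
          by (simp add: power_numeral_reduce flip: power_abs)
        finally have "\<bar>x\<bar> \<le> x ^ 4 / \<eta> ^ 3"
          using \<eta> by (simp add: pos_le_divide_eq mult.commute)
        then show ?thesis
          using \<eta> by linarith
      next
        case True
        moreover have "0 \<le> x ^ 4 / \<eta> ^ 3"
          using \<eta> by simp
        ultimately show ?thesis
          by linarith
      qed
      then show ?thesis
        by (intro mult_left_mono) auto
    qed
    also have "\<dots> = \<bar>\<theta>\<bar> * (\<eta> * \<bar>indicator (D s t) \<omega> - ?p\<bar> + \<bar>indicator (D s t) \<omega> - ?p\<bar> * ((?X \<omega>) ^ 4 / \<eta> ^ 3))"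
      by (simp add: algebra_simps)
    also have "\<dots> \<le> \<bar>\<theta>\<bar> * (\<eta> * (1 - indicator (D s t) \<omega> + (1 - ?p)) + 1 * ((?X \<omega>) ^ 4 / \<eta> ^ 3))"
      using ind \<eta> by (intro mult_left_mono add_mono mult_right_mono) auto
    finally show "norm (complex_of_real (indicator (D s t) \<omega> - ?p) * (?e \<omega> - 1)) \<le>
        \<bar>\<theta>\<bar> * (\<eta> * (1 - indicator (D s t) \<omega> + (1 - ?p)) + (?X \<omega>) ^ 4 / \<eta> ^ 3)"
      by simp
  qed
  also have "\<dots> = \<bar>\<theta>\<bar> * (\<eta> * (1 - ?p + (1 - ?p)) + expectation (\<lambda>\<omega>. (?X \<omega>) ^ 4) / \<eta> ^ 3)"
    unfolding E_g[symmetric] using int4 int_g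
    by (subst integral_mult_right_zero, subst Bochner_Integration.integral_add) auto
  also have "\<dots> \<le> \<bar>\<theta>\<bar> * (\<eta> * (1 - ?p + (1 - ?p)) + 24 * (t - s)\<^sup>2 / \<eta> ^ 3)"
    using int4 \<eta> by (intro mult_left_mono add_mono divide_right_mono) auto
  finally show ?thesis
    by (simp add: algebra_simps)
qed

text \<open>Summing the local errors over \<open>Suc m\<close> equal pieces:
  \<open>1 - p \<le> - ln p\<close>, and by multiplicativity the logarithms add up to the finite
  number \<open>- ln (prob (D s t))\<close> for every partition. The moment terms add up to order
  \<open>1 / Suc m\<close>. Positivity of the probability keeps the logarithm finite.\<close>

lemma \<Phi>_eq_\<Psi>:
  assumes st: "s < t" and pos: "prob (D s t) > 0"
  shows "\<Phi> \<theta> s t = \<Psi> \<theta> s t"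
proof -
  have part: "norm (\<Phi> \<theta> s t - \<Psi> \<theta> s t) \<le> \<bar>\<theta>\<bar> * (2 * \<eta> * (- ln (prob (D s t))) + 24 * (t - s)\<^sup>2 / \<eta> ^ 3 * (1 / Suc m))"
    if \<eta>: "\<eta> > 0" for \<eta> :: real and m :: nat
  proof -
    define d where "d = (t - s) / Suc m"
    define \<tau> where "\<tau> k = s + k * d" for k :: nat
    have d: "d > 0"
      using st by (simp add: d_def)
    have \<tau>: "\<tau> 0 = s" "\<tau> (Suc m) = t" "\<tau> j < \<tau> k \<longleftrightarrow> j < k" for j k
      using d mult_less_cancel_right_pos[OF d, of "real j" "real k"] by (auto simp: \<tau>_def) (simp_all add: d_def)
    have claim: "prob (D s (\<tau> (Suc k))) > 0 \<longrightarrow> norm (\<Phi> \<theta> s (\<tau> (Suc k)) - \<Psi> \<theta> s (\<tau> (Suc k))) \<le>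
        \<bar>\<theta>\<bar> * (2 * \<eta> * (- ln (prob (D s (\<tau> (Suc k))))) + 24 * d\<^sup>2 / \<eta> ^ 3 * Suc k)" for k
    proof (induction k)
      case 0
      have "s < \<tau> 1"
        using \<tau>(3)[of 0 1] \<tau>(1) by simp
      then have "norm (\<Phi> \<theta> s (\<tau> 1) - \<Psi> \<theta> s (\<tau> 1)) \<le> \<bar>\<theta>\<bar> * (2 * \<eta> * (1 - prob (D s (\<tau> 1))) + 24 * (\<tau> 1 - s)\<^sup>2 / \<eta> ^ 3)"
        using \<eta> by (rule \<Phi>_\<Psi>_local)
      also have "\<dots> \<le> \<bar>\<theta>\<bar> * (2 * \<eta> * (- ln (prob (D s (\<tau> 1)))) + 24 * d\<^sup>2 / \<eta> ^ 3 * 1)" if "prob (D s (\<tau> 1)) > 0"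
        using \<eta> ln_le_minus_one[OF that] by (intro mult_left_mono add_mono) (auto simp: \<tau>_def)
      finally show ?case
        by simp
    next
      case (Suc k)
      let ?t1 = "\<tau> (Suc k)" and ?t2 = "\<tau> (Suc (Suc k))"
      have lt: "s < ?t1" "?t1 < ?t2"
        using \<tau>(3)[of 0 "Suc k"] \<tau>(3)[of "Suc k" "Suc (Suc k)"] \<tau>(1) by auto
      show ?case
      proof
        assume "prob (D s ?t2) > 0"
        then have p: "prob (D s ?t1) > 0" "prob (D ?t1 ?t2) > 0"
          unfolding prob_D_mult[OF lt] by (auto simp: zero_less_mult_iff)
        \<comment> \<open>Telescoping of a difference of products; the other factor in each summand
          has norm at most \<open>1\<close>.\<close>
        have "\<Phi> \<theta> s ?t2 - \<Psi> \<theta> s ?t2 = (\<Phi> \<theta> s ?t1 - \<Psi> \<theta> s ?t1) * \<Phi> \<theta> ?t1 ?t2 + \<Psi> \<theta> s ?t1 * (\<Phi> \<theta> ?t1 ?t2 - \<Psi> \<theta> ?t1 ?t2)"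
          unfolding \<Phi>_mult[OF lt] \<Psi>_mult[OF lt] by (simp add: algebra_simps)
        also have "norm \<dots> \<le> norm (\<Phi> \<theta> s ?t1 - \<Psi> \<theta> s ?t1) * 1 + 1 * norm (\<Phi> \<theta> ?t1 ?t2 - \<Psi> \<theta> ?t1 ?t2)"
          by (rule order_trans[OF norm_triangle_ineq], unfold norm_mult, intro add_mono mult_mono)
            (simp_all add: norm_\<Phi>[OF lt(2)] norm_\<Psi>)
        also have "\<dots> \<le> \<bar>\<theta>\<bar> * (2 * \<eta> * (- ln (prob (D s ?t1))) + 24 * d\<^sup>2 / \<eta> ^ 3 * Suc k) +
            \<bar>\<theta>\<bar> * (2 * \<eta> * (1 - prob (D ?t1 ?t2)) + 24 * (?t2 - ?t1)\<^sup>2 / \<eta> ^ 3)"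
          using Suc p(1) \<Phi>_\<Psi>_local[OF lt(2) \<eta>, of \<theta>] by simp
        also have "\<dots> \<le> \<bar>\<theta>\<bar> * (2 * \<eta> * (- ln (prob (D s ?t1))) + 24 * d\<^sup>2 / \<eta> ^ 3 * Suc k) +
            \<bar>\<theta>\<bar> * (2 * \<eta> * (- ln (prob (D ?t1 ?t2))) + 24 * (?t2 - ?t1)\<^sup>2 / \<eta> ^ 3)"
          using \<eta> ln_le_minus_one[OF p(2)] by (intro mult_left_mono add_mono) auto
        also have "\<dots> = \<bar>\<theta>\<bar> * (2 * \<eta> * (- ln (prob (D s ?t2))) + 24 * d\<^sup>2 / \<eta> ^ 3 * Suc (Suc k))"
        proof -
          define c where "c = 24 * d\<^sup>2 / \<eta> ^ 3"
          have "?t2 - ?t1 = d"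
            by (simp add: \<tau>_def algebra_simps)
          show ?thesis
            unfolding prob_D_mult[OF lt] \<open>?t2 - ?t1 = d\<close> c_def[symmetric] using p
            by (simp add: ln_mult algebra_simps)
        qed
        finally show "norm (\<Phi> \<theta> s ?t2 - \<Psi> \<theta> s ?t2) \<le>
            \<bar>\<theta>\<bar> * (2 * \<eta> * (- ln (prob (D s ?t2))) + 24 * d\<^sup>2 / \<eta> ^ 3 * Suc (Suc k))" .
      qed
    qed
    have "24 * d\<^sup>2 / \<eta> ^ 3 * Suc m = 24 * (t - s)\<^sup>2 / \<eta> ^ 3 * (1 / Suc m)"
      by (simp add: d_def power_divide power2_eq_square del: of_nat_Suc)
    with claim[of m] pos show ?thesis
      unfolding \<tau>(2) by simp
  qed
  \<comment> \<open>The order of limits matters: the moment term carries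
    \<open>1 / \<eta>^3\<close>, so the mesh goes to zero for fixed \<open>\<eta>\<close>, and
    \<open>\<eta>\<close> only afterwards.\<close>
  have "norm (\<Phi> \<theta> s t - \<Psi> \<theta> s t) \<le> \<bar>\<theta>\<bar> * (2 * (1 / Suc n) * (- ln (prob (D s t))))" for n
  proof -
    let ?\<eta> = "1 / real (Suc n)"
    have "(\<lambda>m. \<bar>\<theta>\<bar> * (2 * ?\<eta> * (- ln (prob (D s t))) + 24 * (t - s)\<^sup>2 / ?\<eta> ^ 3 * (1 / Suc m))) \<longlonglongrightarrow>
        \<bar>\<theta>\<bar> * (2 * ?\<eta> * (- ln (prob (D s t))) + 24 * (t - s)\<^sup>2 / ?\<eta> ^ 3 * 0)"
      by (intro tendsto_intros LIMSEQ_Suc lim_1_over_n)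
    then have "norm (\<Phi> \<theta> s t - \<Psi> \<theta> s t) \<le> \<bar>\<theta>\<bar> * (2 * ?\<eta> * (- ln (prob (D s t))) + 24 * (t - s)\<^sup>2 / ?\<eta> ^ 3 * 0)"
      by (rule LIMSEQ_le_const) (use part[of ?\<eta>] in auto)
    then show ?thesis
      by simp
  qed
  moreover have "(\<lambda>n. \<bar>\<theta>\<bar> * (2 * (1 / Suc n) * (- ln (prob (D s t))))) \<longlonglongrightarrow> \<bar>\<theta>\<bar> * (2 * 0 * (- ln (prob (D s t))))"
    by (intro tendsto_intros LIMSEQ_Suc lim_1_over_n)
  ultimately have "norm (\<Phi> \<theta> s t - \<Psi> \<theta> s t) \<le> \<bar>\<theta>\<bar> * (2 * 0 * (- ln (prob (D s t))))"
    by (intro LIMSEQ_le_const[of _ _ "norm (\<Phi> \<theta> s t - \<Psi> \<theta> s t)"]) auto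
  then show ?thesis
    by simp
qed

section \<open>From characteristic functions to triviality\<close>

text \<open>Conditioning on \<open>D s t\<close> does not change the characteristic function of the
  increment, hence by Levy's uniqueness theorem not its law.\<close>

lemma indep_single_increment:
  assumes st: "s < t" and F [measurable]: "F \<in> sets borel"
  shows "prob (D s t \<inter> {\<omega> \<in> space W. inc (s, t) \<omega> \<in> F}) = prob (D s t) * prob {\<omega> \<in> space W. inc (s, t) \<omega> \<in> F}"
proof (cases "prob (D s t) = 0")
  case True
  then have "prob (D s t \<inter> {\<omega> \<in> space W. inc (s, t) \<omega> \<in> F}) \<le> 0"
    using finite_measure_mono[of "D s t \<inter> {\<omega> \<in> space W. inc (s, t) \<omega> \<in> F}" "D s t"] st by auto
  then show ?thesis
    using True by (simp add: measure_le_0_iff)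
next
  case False
  define p where "p = prob (D s t)"
  have p: "p > 0"
    using False by (simp add: p_def less_le)
  have [measurable]: "D s t \<in> sets W"
    using st by simp
  define N where "N = uniform_measure W (D s t)"
  have N_density: "N = density W (\<lambda>\<omega>. ennreal (indicator (D s t) \<omega> / p))"
    unfolding N_def uniform_measure_def emeasure_eq_measure p_def[symmetric]
    using p by (intro density_cong) (auto simp: indicator_def divide_ennreal[symmetric])
  interpret N: prob_space N
    unfolding N_def using False by (intro prob_space_uniform_measure) (simp_all add: emeasure_eq_measure)
  have [measurable]: "inc (s, t) \<in> borel_measurable N"
    unfolding N_def by simp
  have "char (distr N borel (inc (s, t))) \<theta> = char (distr W borel (inc (s, t))) \<theta>" for \<theta>
  proof -
    have "char (distr N borel (inc (s, t))) \<theta> = (CLINT \<omega>|N. iexp (\<theta> * inc (s, t) \<omega>))"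
      unfolding char_def by (intro integral_distr) auto
    also have "\<dots> = expectation (\<lambda>\<omega>. (indicator (D s t) \<omega> / p) *\<^sub>R iexp (\<theta> * inc (s, t) \<omega>))"
      unfolding N_density using p by (intro integral_density) auto
    also have "\<dots> = expectation (\<lambda>\<omega>. (indicator (D s t) \<omega> * iexp (\<theta> * inc (s, t) \<omega>)) / p)"
      by (intro Bochner_Integration.integral_cong) (auto simp: scaleR_conv_of_real indicator_def)
    also have "\<dots> = \<Phi> \<theta> s t / p"
      by (simp add: \<Phi>_def)
    also have "\<dots> = expectation (\<lambda>\<omega>. iexp (\<theta> * inc (s, t) \<omega>))"
      using \<Phi>_eq_\<Psi>[OF st] p by (simp add: \<Psi>_def p_def)
    also have "\<dots> = char (distr W borel (inc (s, t))) \<theta>"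
      unfolding char_def by (intro integral_distr[symmetric]) auto
    finally show ?thesis .
  qed
  then have "distr N borel (inc (s, t)) = distr W borel (inc (s, t))"
    by (intro Levy_uniqueness N.real_distribution_distr real_distribution_distr) auto
  then have "measure (distr N borel (inc (s, t))) F = measure (distr W borel (inc (s, t))) F"
    by simp
  then have "measure N (inc (s, t) -` F \<inter> space N) = prob (inc (s, t) -` F \<inter> space W)"
    by (simp add: measure_distr)
  moreover have "inc (s, t) -` F \<inter> space W = {\<omega> \<in> space W. inc (s, t) \<omega> \<in> F}" "space N = space W"
    by (auto simp: N_def)
  moreover have "measure N {\<omega> \<in> space W. inc (s, t) \<omega> \<in> F} = prob (D s t \<inter> {\<omega> \<in> space W. inc (s, t) \<omega> \<in> F}) / p"
    unfolding N_def p_def by (intro measure_uniform_measure) (use False in \<open>auto simp: emeasure_eq_measure\<close>)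
  ultimately show ?thesis
    using p by (simp add: p_def field_simps)
qed

text \<open>Both \<open>D\<close> and the box split at the grid points. Adjacent fields are
  independent, so the case of a single increment applies cell by cell.\<close>

lemma indep_grid:
  assumes \<tau>: "\<And>i. i < n \<Longrightarrow> \<tau> i < \<tau> (Suc i)" and E [measurable]: "\<And>i. E i \<in> sets borel" and "n > 0"
  shows "prob (D (\<tau> 0) (\<tau> n) \<inter> grid_box \<tau> {..<n} E) =
    prob (D (\<tau> 0) (\<tau> n)) * prob (grid_box \<tau> {..<n} E)"
  using \<open>n > 0\<close> \<tau>
proof (induction n rule: nat_induct_non_zero)
  case 1
  then show ?case
    using indep_single_increment[OF _ E, of "\<tau> 0" "\<tau> 1" 0] by (simp add: lessThan_Suc)
next
  case (Suc n)
  have lt: "\<tau> 0 < \<tau> n" "\<tau> n < \<tau> (Suc n)"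
  proof -
    have "\<tau> 0 < \<tau> k" if "0 < k" "k \<le> n" for k
      using that
    proof (induction k rule: nat_induct_non_zero)
      case 1
      then show ?case
        using Suc.prems[of 0] by simp
    next
      case (Suc k)
      then show ?case
        using Suc.prems \<open>\<And>i. i < Suc n \<Longrightarrow> \<tau> i < \<tau> (Suc i)\<close>[of k] by simp
    qed
    then show "\<tau> 0 < \<tau> n" "\<tau> n < \<tau> (Suc n)"
      using Suc.hyps Suc.prems by auto
  qed
  let ?R = "between (ereal (\<tau> 0)) (ereal (\<tau> n))" and ?R' = "between (ereal (\<tau> n)) (ereal (\<tau> (Suc n)))"
  define B where "B = grid_box \<tau> {..<n} E"
  define C where "C = {\<omega> \<in> space W. inc (\<tau> n, \<tau> (Suc n)) \<omega> \<in> E n}"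
  have mono: "\<tau> i \<le> \<tau> j" if "i \<le> j" "j \<le> Suc n" for i j
    using that
  proof (induction rule: dec_induct)
    case (step k)
    then show ?case
      using Suc.prems[of k] by simp
  qed simp
  have B: "B \<in> inc_field ?R"
  proof -
    have "{\<omega> \<in> space (inc_algebra ?R). \<forall>i\<in>{..<n}. inc (\<tau> i, \<tau> (Suc i)) \<omega> \<in> E i} \<in> sets (inc_algebra ?R)"
    proof (intro sets.sets_Collect_finite_All finite_lessThan)
      fix i assume "i \<in> {..<n}"
      then have [measurable]: "inc (\<tau> i, \<tau> (Suc i)) \<in> borel_measurable (inc_algebra ?R)"
        using mono[of 0 i] mono[of i "Suc i"] mono[of "Suc i" n] by (intro inc_measurable_inc_algebra) (auto simp: between_def)
      show "{\<omega> \<in> space (inc_algebra ?R). inc (\<tau> i, \<tau> (Suc i)) \<omega> \<in> E i} \<in> sets (inc_algebra ?R)"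
        by measurable
    qed
    then show ?thesis
      by (simp add: B_def Ball_def)
  qed
  have C: "C \<in> inc_field ?R'"
  proof -
    have [measurable]: "inc (\<tau> n, \<tau> (Suc n)) \<in> borel_measurable (inc_algebra ?R')"
      using lt by (intro inc_measurable_inc_algebra) (auto simp: between_def)
    have "{\<omega> \<in> space (inc_algebra ?R'). inc (\<tau> n, \<tau> (Suc n)) \<omega> \<in> E n} \<in> sets (inc_algebra ?R')"
      by measurable
    then show ?thesis
      by (simp add: C_def)
  qed
  note sets_BC [measurable] = inc_field_sets[OF B] inc_field_sets[OF C]
  have [measurable]: "D (\<tau> 0) (\<tau> n) \<in> sets W" "D (\<tau> n) (\<tau> (Suc n)) \<in> sets W" "D (\<tau> 0) (\<tau> (Suc n)) \<in> sets W"
    using lt by auto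
  have BC: "grid_box \<tau> {..<Suc n} E = B \<inter> C"
    by (auto simp: B_def C_def less_Suc_eq)
  have "prob (D (\<tau> 0) (\<tau> (Suc n)) \<inter> (B \<inter> C)) = prob ((D (\<tau> 0) (\<tau> n) \<inter> B) \<inter> (D (\<tau> n) (\<tau> (Suc n)) \<inter> C))"
    using D_split[OF lt] by (intro finite_measure_eq_AE) auto
  also have "\<dots> = prob (D (\<tau> 0) (\<tau> n) \<inter> B) * prob (D (\<tau> n) (\<tau> (Suc n)) \<inter> C)"
    using lt B C D by (intro indep_setD[OF indep_adjacent] inc_field_Int)
  also have "prob (D (\<tau> 0) (\<tau> n) \<inter> B) = prob (D (\<tau> 0) (\<tau> n)) * prob B"
    using Suc unfolding B_def by simp
  also have "prob (D (\<tau> n) (\<tau> (Suc n)) \<inter> C) = prob (D (\<tau> n) (\<tau> (Suc n))) * prob C"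
    unfolding C_def using lt by (intro indep_single_increment) auto
  also have "prob (D (\<tau> 0) (\<tau> n)) * prob B * (prob (D (\<tau> n) (\<tau> (Suc n))) * prob C) = prob (D (\<tau> 0) (\<tau> (Suc n))) * (prob B * prob C)"
    by (simp add: prob_D_mult[OF lt])
  also have "prob B * prob C = prob (B \<inter> C)"
    using B C by (intro indep_setD[OF indep_adjacent, symmetric])
  finally show ?case
    unfolding BC .
qed

text \<open>The event is independent of the field of the increments in \<open>[s, t]\<close>, which
  contains it, and hence of itself.\<close>

theorem prob_D_zero_one:
  assumes "s < t"
  shows "prob (D s t) = 0 \<or> prob (D s t) = 1"
proof -
  have "prob (D s t \<inter> D s t) = prob (D s t) * prob (D s t)"
  proof (rule indep_of_increments[OF _ assms])
    fix n \<tau> and E :: "nat \<Rightarrow> real set"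
    assume *: "\<And>i. i < n \<Longrightarrow> \<tau> i < \<tau> (Suc i)" "\<tau> 0 = s" "\<tau> n = t" "\<And>i. E i \<in> sets borel"
    then have "n > 0"
      using assms by (cases n) auto
    then show "prob (D s t \<inter> grid_box \<tau> {..<n} E) =
      prob (D s t) * prob (grid_box \<tau> {..<n} E)"
      using indep_grid[of n \<tau> E] * by simp
  qed (use assms D in auto)
  then show ?thesis
    by auto
qed

end

section \<open>Hitting probabilities\<close>

lemma space_coffin_borel [simp]: "space coffin_borel = UNIV"
  by (simp add: coffin_borel_def space_measure_of_conv)

lemma Some_image_coffin_borel: "E \<in> sets borel \<Longrightarrow> Some ` E \<in> sets coffin_borel"
  unfolding coffin_borel_def by (intro in_measure_of) auto

lemma None_coffin_borel: "{None} \<in> sets coffin_borel"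
  unfolding coffin_borel_def by (intro in_measure_of) auto

definition from_coffin :: "real \<Rightarrow> real option \<Rightarrow> real" where
  "from_coffin d z = (case z of None \<Rightarrow> d | Some x \<Rightarrow> x)"

lemma from_coffin_simps [simp]: "from_coffin d None = d" "from_coffin d (Some x) = x"
  by (simp_all add: from_coffin_def)

lemma measurable_from_coffin [measurable]: "from_coffin d \<in> borel_measurable coffin_borel"
proof (rule measurableI)
  fix E :: "real set" assume "E \<in> sets borel"
  then have "Some ` E \<union> (if d \<in> E then {None} else {}) \<in> sets coffin_borel"
    using Some_image_coffin_borel None_coffin_borel by (intro sets.Un) (auto split: if_splits)
  moreover have "from_coffin d -` E = Some ` E \<union> (if d \<in> E then {None} else {})"
    by (auto simp: from_coffin_def split: option.splits if_splits)
  ultimately show "from_coffin d -` E \<inter> space coffin_borel \<in> sets coffin_borel"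
    by simp
qed simp

lemma pred_not_None:
  assumes "X \<in> measurable N coffin_borel"
  shows "Measurable.pred N (\<lambda>\<omega>. X \<omega> \<noteq> None)"
proof -
  have "{\<omega> \<in> space N. X \<omega> \<noteq> None} = space N - X -` {None} \<inter> space N"
    by auto
  then show ?thesis
    using measurable_sets[OF assms None_coffin_borel] by (auto simp: pred_def)
qed

lemma sets_seq_set_Int_empty:
  assumes T: "\<And>i. T i \<in> measurable N coffin_borel" and E: "E \<in> sets borel"
  shows "{\<omega> \<in> space N. seq_set (\<lambda>i. T i \<omega>) \<inter> E = {}} \<in> sets N"
proof -
  have "{\<omega> \<in> space N. seq_set (\<lambda>i. T i \<omega>) \<inter> E = {}} = space N - (\<Union>i. T i -` (Some ` E) \<inter> space N)"
    by (auto simp: seq_set_def)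
  moreover have "\<dots> \<in> sets N"
    by (intro sets.Diff sets.top sets.countable_nat_UN) (use measurable_sets[OF T Some_image_coffin_borel[OF E]] in blast)
  ultimately show ?thesis
    by simp
qed

context wiener_noise
begin

text \<open>Completeness of \<open>W\<close> enters here. \<open>M\<close> agrees with an
  enumeration only almost surely, so events about \<open>M\<close> inherit measurability from events
  about the enumeration.\<close>

lemma sets_AE_cong:
  assumes A': "A' \<in> sets W" and "A \<subseteq> space W" and AE: "AE \<omega> in W. \<omega> \<in> A \<longleftrightarrow> \<omega> \<in> A'"
  shows "A \<in> sets W"
proof -
  obtain P where P: "W = completion P"
    using wiener_base by blast
  obtain N where N: "N \<in> null_sets W" "{\<omega> \<in> space W. \<not> (\<omega> \<in> A \<longleftrightarrow> \<omega> \<in> A')} \<subseteq> N"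
    using AE unfolding eventually_ae_filter by blast
  have "A' \<subseteq> space W"
    using A' by (rule sets.sets_into_space)
  then have "A - A' \<subseteq> N" "A' - A \<subseteq> N"
    using N(2) \<open>A \<subseteq> space W\<close> by blast+
  then have "A - A' \<in> null_sets W" "A' - A \<in> null_sets W"
    using N(1) null_sets_completion_subset unfolding P by blast+
  then have "(A' - (A' - A)) \<union> (A - A') \<in> sets W"
    using A' by auto
  also have "(A' - (A' - A)) \<union> (A - A') = A"
    by auto
  finally show ?thesis .
qed

lemma inc_field_AE_cong:
  assumes A': "A' \<in> inc_field R" and "A \<subseteq> space W" and AE: "AE \<omega> in W. \<omega> \<in> A \<longleftrightarrow> \<omega> \<in> A'"
  shows "A \<in> inc_field R"
proof -
  obtain A'' where A'': "A'' \<in> sigma_sets (space W) (inc_events R)" "AE \<omega> in W. \<omega> \<in> A' \<longleftrightarrow> \<omega> \<in> A''"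
    using A' unfolding inc_field_def by blast
  have "AE \<omega> in W. \<omega> \<in> A \<longleftrightarrow> \<omega> \<in> A''"
    using AE A''(2) by eventually_elim auto
  moreover have "A \<in> sets W"
    using inc_field_sets[OF A'] assms(2) AE by (rule sets_AE_cong)
  ultimately show ?thesis
    using A''(1) unfolding inc_field_def by blast
qed

end

locale local_noise_set = wiener_noise +
  fixes M :: "(real \<Rightarrow> real) \<Rightarrow> real set"
  assumes countable_set: "random_countable_set W M"
    and local_set: "local_random_set W M"
    and stationary: "stationary_in_law W M"
begin

section \<open>Probabilities of missing a Borel set\<close>

definition miss :: "real set \<Rightarrow> (real \<Rightarrow> real) set" where
  "miss E = {\<omega> \<in> space W. M \<omega> \<inter> E = {}}"

lemma enumeration:
  obtains S where "\<forall>i. S i \<in> measurable W coffin_borel" "AE \<omega> in W. M \<omega> = seq_set (\<lambda>i. S i \<omega>)"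
proof -
  obtain S where "measurable_enumeration W W M S"
    using countable_set unfolding random_countable_set_def by blast
  then show thesis
    unfolding measurable_enumeration_def by (intro that[of S]) auto
qed

lemma local_enumeration:
  assumes "s < t"
  obtains T where "\<And>i. T i \<in> measurable (inc_algebra (between s t)) coffin_borel"
    "AE \<omega> in W. M \<omega> \<inter> {x. s < ereal x \<and> ereal x < t} = seq_set (\<lambda>i. T i \<omega>)"
  using local_set assms measurable_increment_field unfolding local_random_set_def measurable_enumeration_def by meson

lemma miss_sets [measurable]:
  assumes "E \<in> sets borel"
  shows "miss E \<in> sets W"
proof -
  obtain S where "\<forall>i. S i \<in> measurable W coffin_borel" "AE \<omega> in W. M \<omega> = seq_set (\<lambda>i. S i \<omega>)"
    by (rule enumeration)
  note S = this(1)[rule_format] this(2)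
  show ?thesis
  proof (rule sets_AE_cong[OF sets_seq_set_Int_empty[OF S(1) assms]])
    show "AE \<omega> in W. \<omega> \<in> miss E \<longleftrightarrow> \<omega> \<in> {\<omega> \<in> space W. seq_set (\<lambda>i. S i \<omega>) \<inter> E = {}}"
      using S(2) by eventually_elim (simp add: miss_def)
  qed (auto simp: miss_def)
qed

lemma miss_local:
  assumes "s < t" and E: "E \<in> sets borel"
  shows "miss (E \<inter> {s<..<t}) \<in> inc_field (between (ereal s) (ereal t))"
proof -
  obtain T where T: "\<And>i. T i \<in> measurable (inc_algebra (between (ereal s) (ereal t))) coffin_borel"
    "AE \<omega> in W. M \<omega> \<inter> {x. ereal s < ereal x \<and> ereal x < ereal t} = seq_set (\<lambda>i. T i \<omega>)"
    using local_enumeration[of "ereal s" "ereal t"] assms(1) by auto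
  have "{\<omega> \<in> space W. seq_set (\<lambda>i. T i \<omega>) \<inter> E = {}} \<in> inc_field (between (ereal s) (ereal t))"
    using sets_seq_set_Int_empty[OF T(1) E] by simp
  then show ?thesis
  proof (rule inc_field_AE_cong)
    show "AE \<omega> in W. \<omega> \<in> miss (E \<inter> {s<..<t}) \<longleftrightarrow> \<omega> \<in> {\<omega> \<in> space W. seq_set (\<lambda>i. T i \<omega>) \<inter> E = {}}"
      using T(2)
    proof eventually_elim
      case (elim \<omega>)
      have "M \<omega> \<inter> (E \<inter> {s<..<t}) = seq_set (\<lambda>i. T i \<omega>) \<inter> E"
        unfolding elim[symmetric] by auto
      then show ?case
        by (simp add: miss_def)
    qed
  qed (auto simp: miss_def)
qed

text \<open>Miss probabilities depend only on the law of an enumeration, the form in which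
  \<open>same_law\<close> can be used.\<close>

lemma prob_miss_seq_law:
  assumes S: "measurable_enumeration W W M' S" and E: "E \<in> sets borel"
  shows "measure (seq_law W S) {s. seq_set s \<inter> E = {}} = prob {\<omega> \<in> space W. M' \<omega> \<inter> E = {}}"
    and "{s. seq_set s \<inter> E = {}} \<in> sets coffin_seq_borel"
proof -
  have S': "\<And>i. S i \<in> measurable W coffin_borel" "AE \<omega> in W. M' \<omega> = seq_set (\<lambda>i. S i \<omega>)"
    using S unfolding measurable_enumeration_def by auto
  have "{s \<in> space coffin_seq_borel. seq_set (\<lambda>i. s i) \<inter> E = {}} \<in> sets coffin_seq_borel"
    by (intro sets_seq_set_Int_empty E) simp
  then show *: "{s. seq_set s \<inter> E = {}} \<in> sets coffin_seq_borel"
    by (simp add: space_PiM)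
  have meas: "(\<lambda>\<omega> i. S i \<omega>) \<in> measurable W coffin_seq_borel"
    by (rule measurable_PiM_single') (use S' in auto)
  have "measure (seq_law W S) {s. seq_set s \<inter> E = {}} = prob {\<omega> \<in> space W. seq_set (\<lambda>i. S i \<omega>) \<inter> E = {}}"
    unfolding seq_law_def using * by (subst measure_distr[OF meas]) (auto intro!: arg_cong[where f = prob])
  also have "\<dots> = prob {\<omega> \<in> space W. M' \<omega> \<inter> E = {}}"
  proof (rule finite_measure_eq_AE)
    show AE: "AE \<omega> in W. \<omega> \<in> {\<omega> \<in> space W. seq_set (\<lambda>i. S i \<omega>) \<inter> E = {}} \<longleftrightarrow> \<omega> \<in> {\<omega> \<in> space W. M' \<omega> \<inter> E = {}}"
      using S'(2) by eventually_elim simp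
    show 1: "{\<omega> \<in> space W. seq_set (\<lambda>i. S i \<omega>) \<inter> E = {}} \<in> sets W"
      by (rule sets_seq_set_Int_empty[OF S'(1) E])
    show "{\<omega> \<in> space W. M' \<omega> \<inter> E = {}} \<in> sets W"
      by (rule sets_AE_cong[OF 1]) (use AE in auto)
  qed
  finally show "measure (seq_law W S) {s. seq_set s \<inter> E = {}} = prob {\<omega> \<in> space W. M' \<omega> \<inter> E = {}}" .
qed

text \<open>Under the coupling the two sequences have the same set almost surely, so they miss a
  given Borel set with equal probability.\<close>

lemma prob_miss_shift:
  assumes E: "E \<in> sets borel"
  shows "prob (miss ((\<lambda>x. x - u) -` E)) = prob (miss E)"
proof -
  obtain S S' R where S: "measurable_enumeration W W M S" "measurable_enumeration W W (\<lambda>\<omega>. (\<lambda>x. u + x) ` M \<omega>) S'"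
    and R: "is_coupling R (seq_law W S) (seq_law W S')" "AE (s, s') in R. seq_set s = seq_set s'"
    using stationary unfolding stationary_in_law_def same_law_def by blast
  \<comment> \<open>\<open>F\<close> is the translate of \<open>E\<close> by \<open>u\<close>, and
    \<open>u + M\<close> misses it exactly when \<open>M\<close> misses \<open>E\<close>.\<close>
  define F where "F = (\<lambda>x. x - u) -` E"
  have F: "F \<in> sets borel"
    unfolding F_def using measurable_sets[of "\<lambda>x. x - u" borel borel E] E by simp
  let ?A = "{s. seq_set s \<inter> F = {}}"
  interpret R: prob_space R
    using R(1) by (simp add: is_coupling_def)
  have sets_law: "sets (seq_law W S) = sets coffin_seq_borel" "sets (seq_law W S') = sets coffin_seq_borel"
    by (simp_all add: seq_law_def)
  have sets_R: "sets R = sets (seq_law W S \<Otimes>\<^sub>M seq_law W S')"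
    using R(1) by (simp add: is_coupling_def)
  have fst: "fst \<in> measurable R (seq_law W S)" and snd: "snd \<in> measurable R (seq_law W S')"
    by (simp_all add: measurable_cong_sets[OF sets_R refl])
  have A: "?A \<in> sets coffin_seq_borel"
    by (rule prob_miss_seq_law(2)[OF S(1) F])
  have "measure (seq_law W S) ?A = measure R (fst -` ?A \<inter> space R)"
    using R(1) A sets_law measure_distr[OF fst, of ?A] by (simp add: is_coupling_def)
  also have "\<dots> = measure R (snd -` ?A \<inter> space R)"
  proof (rule R.finite_measure_eq_AE)
    show "AE z in R. z \<in> fst -` ?A \<inter> space R \<longleftrightarrow> z \<in> snd -` ?A \<inter> space R"
      using R(2) by eventually_elim auto
  qed (use A sets_law measurable_sets[OF fst, of ?A] measurable_sets[OF snd, of ?A] in auto)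
  also have "\<dots> = measure (seq_law W S') ?A"
    using R(1) A sets_law measure_distr[OF snd, of ?A] by (simp add: is_coupling_def)
  finally have "prob {\<omega> \<in> space W. M \<omega> \<inter> F = {}} = prob {\<omega> \<in> space W. (\<lambda>x. u + x) ` M \<omega> \<inter> F = {}}"
    using prob_miss_seq_law(1)[OF S(1) F] prob_miss_seq_law(1)[OF S(2) F] by simp
  moreover have "(\<lambda>x. u + x) ` M \<omega> \<inter> F = {} \<longleftrightarrow> M \<omega> \<inter> E = {}" for \<omega>
    by (auto simp: F_def)
  ultimately show ?thesis
    by (simp add: miss_def F_def)
qed

lemma prob_miss_eq_1_iff: "E \<in> sets borel \<Longrightarrow> prob (miss E) = 1 \<longleftrightarrow> (AE \<omega> in W. M \<omega> \<inter> E = {})"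
  unfolding prob_eq_1[OF miss_sets] by (intro AE_cong) (auto simp: miss_def)

lemma prob_miss_eq_0_iff: "E \<in> sets borel \<Longrightarrow> prob (miss E) = 0 \<longleftrightarrow> (AE \<omega> in W. M \<omega> \<inter> E \<noteq> {})"
  unfolding prob_eq_0[OF miss_sets] by (intro AE_cong) (auto simp: miss_def)

text \<open>By stationarity all translates of \<open>E\<close> are missed with the same probability; averaging over them turns
  hitting probabilities into Lebesgue measures.\<close>

lemma AE_miss_translates:
  assumes E [measurable]: "E \<in> sets borel" and S [measurable]: "\<And>i. S i \<in> measurable W coffin_borel"
    and M: "AE \<omega> in W. M \<omega> = seq_set (\<lambda>i. S i \<omega>)"
  shows "(AE \<omega> in W. AE u in lborel. \<forall>i. S i \<omega> \<noteq> None \<longrightarrow> from_coffin 0 (S i \<omega>) - u \<notin> E) \<longleftrightarrow>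
    prob (miss E) = 1"
proof -
  interpret pair_sigma_finite W lborel ..
  note [measurable] = pred_not_None[OF S]
  have [measurable]: "(\<lambda>\<omega>. from_coffin 0 (S i \<omega>)) \<in> borel_measurable W" for i
    by measurable
  have "{z \<in> space (W \<Otimes>\<^sub>M lborel). \<forall>i. S i (fst z) \<noteq> None \<longrightarrow> from_coffin 0 (S i (fst z)) - snd z \<notin> E} \<in> sets (W \<Otimes>\<^sub>M lborel)"
    by measurable
  then have "(AE \<omega> in W. AE u in lborel. \<forall>i. S i \<omega> \<noteq> None \<longrightarrow> from_coffin 0 (S i \<omega>) - u \<notin> E) \<longleftrightarrow>
      (AE u in lborel. AE \<omega> in W. \<forall>i. S i \<omega> \<noteq> None \<longrightarrow> from_coffin 0 (S i \<omega>) - u \<notin> E)"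
    by (rule AE_commute)
  \<comment> \<open>After Fubini: for fixed \<open>u\<close> the inner statement says that
    \<open>M\<close> almost surely misses the translate of \<open>E\<close> by \<open>u\<close>. By
    stationarity its truth does not depend on \<open>u\<close>, so the quantifier over almost every
    \<open>u\<close> drops out.\<close>
  moreover have "(AE \<omega> in W. \<forall>i. S i \<omega> \<noteq> None \<longrightarrow> from_coffin 0 (S i \<omega>) - u \<notin> E) \<longleftrightarrow> prob (miss E) = 1" for u
  proof -
    have sh: "(\<lambda>x. x - u) -` E \<in> sets borel"
      using measurable_sets[of "\<lambda>x. x - u" borel borel E] E by simp
    have "(AE \<omega> in W. \<forall>i. S i \<omega> \<noteq> None \<longrightarrow> from_coffin 0 (S i \<omega>) - u \<notin> E) \<longleftrightarrow> (AE \<omega> in W. M \<omega> \<inter> (\<lambda>x. x - u) -` E = {})"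
    proof -
      have *: "(\<forall>i. z i \<noteq> None \<longrightarrow> from_coffin 0 (z i) - u \<notin> E) \<longleftrightarrow> seq_set z \<inter> (\<lambda>x. x - u) -` E = {}" for z
        unfolding seq_set_def by force
      have "AE \<omega> in W. (\<forall>i. S i \<omega> \<noteq> None \<longrightarrow> from_coffin 0 (S i \<omega>) - u \<notin> E) \<longleftrightarrow> M \<omega> \<inter> (\<lambda>x. x - u) -` E = {}"
        using M
      proof eventually_elim
        case (elim \<omega>)
        show ?case
          unfolding elim by (rule *)
      qed
      then show ?thesis
        by (rule eventually_subst)
    qed
    also have "\<dots> \<longleftrightarrow> prob (miss E) = 1"
      using prob_miss_eq_1_iff[OF sh] prob_miss_shift[OF E, of u] by simp
    finally show ?thesis .
  qed
  ultimately show ?thesis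
    by (simp only: eventually_const_iff) (simp add: ae_filter_eq_bot_iff)
qed

lemma AE_lborel_reflect_iff:
  fixes c :: real
  assumes [measurable]: "E \<in> sets borel"
  shows "(AE u in lborel. c - u \<notin> E) \<longleftrightarrow> emeasure lborel E = 0"
proof -
  have "(AE u in lborel. c - u \<notin> E) \<longleftrightarrow> (AE u in lborel. u \<notin> E)"
  proof
    assume "AE u in lborel. c - u \<notin> E"
    from AE_borel_affine[where P = "\<lambda>u. c - u \<notin> E", OF _ _ this, of "-1" c] show "AE u in lborel. u \<notin> E"
      by simp
  next
    assume "AE u in lborel. u \<notin> E"
    from AE_borel_affine[where P = "\<lambda>u. u \<notin> E", OF _ _ this, of "-1" c] show "AE u in lborel. c - u \<notin> E"
      by simp
  qed
  also have "\<dots> \<longleftrightarrow> emeasure lborel E = 0"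
    by (subst AE_iff_measurable[OF _ refl]) auto
  finally show ?thesis .
qed

text \<open>For each outcome the countably many points avoid almost every translate of a null set;
  averaging turns this into a statement about \<open>E\<close> itself.\<close>

lemma miss_null:
  assumes E: "E \<in> sets borel" "emeasure lborel E = 0"
  shows "AE \<omega> in W. M \<omega> \<inter> E = {}"
proof -
  obtain S where "\<forall>i. S i \<in> measurable W coffin_borel" "AE \<omega> in W. M \<omega> = seq_set (\<lambda>i. S i \<omega>)"
    by (rule enumeration)
  note S = this(1)[rule_format] this(2)
  have "AE u in lborel. \<forall>i. S i \<omega> \<noteq> None \<longrightarrow> from_coffin 0 (S i \<omega>) - u \<notin> E" for \<omega>
  proof (intro AE_all_countable[THEN iffD2] allI)
    fix i
    have "AE u in lborel. from_coffin 0 (S i \<omega>) - u \<notin> E"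
      using E by (simp add: AE_lborel_reflect_iff)
    then show "AE u in lborel. S i \<omega> \<noteq> None \<longrightarrow> from_coffin 0 (S i \<omega>) - u \<notin> E"
      by eventually_elim simp
  qed
  then have "prob (miss E) = 1"
    using AE_miss_translates[OF E(1) S] by simp
  then show ?thesis
    using prob_miss_eq_1_iff[OF E(1)] by simp
qed

text \<open>A single point lies in a non-null set of translates of \<open>E\<close>. If almost every
  translate is missed, there can be no point at all.\<close>

lemma miss_positive:
  assumes E: "E \<in> sets borel" "emeasure lborel E \<noteq> 0" and ne: "\<not> (AE \<omega> in W. M \<omega> = {})"
  shows "prob (miss E) \<noteq> 1"
proof
  assume "prob (miss E) = 1"
  obtain S where "\<forall>i. S i \<in> measurable W coffin_borel" "AE \<omega> in W. M \<omega> = seq_set (\<lambda>i. S i \<omega>)"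
    by (rule enumeration)
  note S = this(1)[rule_format] this(2)
  have "AE \<omega> in W. AE u in lborel. \<forall>i. S i \<omega> \<noteq> None \<longrightarrow> from_coffin 0 (S i \<omega>) - u \<notin> E"
    using AE_miss_translates[OF E(1) S] \<open>prob (miss E) = 1\<close> by simp
  then have "AE \<omega> in W. M \<omega> = {}"
    using S(2)
  proof eventually_elim
    case (elim \<omega>)
    have "S i \<omega> = None" for i
    proof (rule ccontr)
      assume "S i \<omega> \<noteq> None"
      then have "AE u in lborel. from_coffin 0 (S i \<omega>) - u \<notin> E"
        using elim(1) by (rule_tac eventually_mono[OF elim(1)]) blast
      then show False
        using E by (simp add: AE_lborel_reflect_iff)
    qed
    then show ?case
      unfolding elim(2) by (simp add: seq_set_def)
  qed
  with ne show False
    by blast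
qed

section \<open>The dichotomy between null and non-null sets\<close>

text \<open>The misses within intervals form a multiplicative family: locality places them in the
  right fields, and \<open>miss_null\<close> for the singleton \<open>{t}\<close> removes the cut
  point.\<close>

lemma miss_interval_zero_one:
  assumes E [measurable]: "E \<in> sets borel" and "s < t"
  shows "prob (miss (E \<inter> {s<..<t})) = 0 \<or> prob (miss (E \<inter> {s<..<t})) = 1"
proof -
  interpret multiplicative_events W "\<lambda>s t. miss (E \<inter> {s<..<t})"
  proof
    fix s t :: real assume "s < t"
    then show "miss (E \<inter> {s<..<t}) \<in> inc_field (between (ereal s) (ereal t))"
      by (rule miss_local) fact
  next
    fix s t u :: real assume "s < t" "t < u"
    have "AE \<omega> in W. M \<omega> \<inter> {t} = {}"
      by (rule miss_null) auto
    then show "AE \<omega> in W. \<omega> \<in> miss (E \<inter> {s<..<u}) \<longleftrightarrow> \<omega> \<in> miss (E \<inter> {s<..<t}) \<and> \<omega> \<in> miss (E \<inter> {t<..<u})"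
      using AE_space
    proof eventually_elim
      case (elim \<omega>)
      have "M \<omega> \<inter> (E \<inter> {s<..<u}) = M \<omega> \<inter> (E \<inter> {s<..<t}) \<union> M \<omega> \<inter> (E \<inter> {t<..<u})"
      proof (intro set_eqI)
        fix x
        have "x \<in> M \<omega> \<Longrightarrow> x < t \<or> t < x"
          using elim(1) by (cases x t rule: linorder_cases) auto
        then show "x \<in> M \<omega> \<inter> (E \<inter> {s<..<u}) \<longleftrightarrow> x \<in> M \<omega> \<inter> (E \<inter> {s<..<t}) \<union> M \<omega> \<inter> (E \<inter> {t<..<u})"
          using \<open>s < t\<close> \<open>t < u\<close> by auto
      qed
      then show ?case
        by (auto simp: miss_def)
    qed
  qed
  show ?thesis
    using \<open>s < t\<close> by (rule prob_D_zero_one)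
qed

text \<open>The zero-one law concerns bounded intervals only. Some bounded window of
  \<open>E\<close> is hit with positive probability, since otherwise \<open>E\<close> would be
  missed altogether, and within that window positive means one.\<close>

lemma hit_positive:
  assumes E [measurable]: "E \<in> sets borel" and pos: "emeasure lborel E \<noteq> 0" and ne: "\<not> (AE \<omega> in W. M \<omega> = {})"
  shows "AE \<omega> in W. M \<omega> \<inter> E \<noteq> {}"
proof -
  let ?I = "\<lambda>n::nat. {- real (Suc n)<..<real (Suc n)}"
  have "\<exists>n. prob (miss (E \<inter> ?I n)) \<noteq> 1"
  proof (rule ccontr)
    assume "\<not> ?thesis"
    then have "AE \<omega> in W. M \<omega> \<inter> (E \<inter> ?I n) = {}" for n
      using prob_miss_eq_1_iff[of "E \<inter> ?I n"] by auto
    then have "AE \<omega> in W. \<forall>n. M \<omega> \<inter> (E \<inter> ?I n) = {}"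
      by (subst AE_all_countable) blast
    then have "AE \<omega> in W. M \<omega> \<inter> E = {}"
    proof eventually_elim
      case (elim \<omega>)
      have "x \<notin> E" if "x \<in> M \<omega>" for x
      proof -
        obtain n :: nat where "\<bar>x\<bar> < real n"
          using reals_Archimedean2 by blast
        then have "x \<in> ?I n"
          by auto
        then show ?thesis
          using elim that by blast
      qed
      then show ?case
        by blast
    qed
    then have "prob (miss E) = 1"
      by (simp add: prob_miss_eq_1_iff)
    with miss_positive[OF E pos ne] show False
      by simp
  qed
  then obtain n where "prob (miss (E \<inter> ?I n)) \<noteq> 1"
    by blast
  then have "prob (miss (E \<inter> ?I n)) = 0"
    using miss_interval_zero_one[OF E, of "- real (Suc n)" "real (Suc n)"] by auto
  then have "AE \<omega> in W. M \<omega> \<inter> (E \<inter> ?I n) \<noteq> {}"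
    by (simp add: prob_miss_eq_0_iff)
  then show ?thesis
    by eventually_elim auto
qed

section \<open>Borel sets depending on independent points\<close>

text \<open>The points of \<open>M\<close> in \<open>(s, t)\<close> are independent of
  \<open>U\<close>, so the joint law is a product and \<open>U\<close> may be frozen at a value
  \<open>x\<close>. The section of \<open>E\<close> at \<open>x\<close> is then a deterministic
  Borel set, to which the dichotomy applies.\<close>

lemma hits_of_independent_set:
  assumes st: "s < t" and ne: "\<not> (AE \<omega> in W. M \<omega> = {})"
    and R: "\<And>p. p \<in> R \<Longrightarrow> fst p \<le> snd p" "nonoverlapping R (between (ereal s) (ereal t))"
    and U: "U \<in> borel_measurable (inc_algebra R)"
    and E: "E \<in> sets ((borel :: (nat \<Rightarrow> real) measure) \<Otimes>\<^sub>M (borel :: real measure))"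
  shows "AE \<omega> in W.
    (emeasure lborel {y. (U \<omega>, y) \<in> E \<and> y \<in> {s<..<t}} = 0 \<longrightarrow> (\<forall>y\<in>M \<omega>. y \<in> {s<..<t} \<longrightarrow> (U \<omega>, y) \<notin> E)) \<and>
    (emeasure lborel {y. (U \<omega>, y) \<in> E \<and> y \<in> {s<..<t}} \<noteq> 0 \<longrightarrow> (\<exists>y\<in>M \<omega>. (U \<omega>, y) \<in> E))"
proof -
  obtain T where T: "\<And>i. T i \<in> measurable (inc_algebra (between (ereal s) (ereal t))) coffin_borel"
    "AE \<omega> in W. M \<omega> \<inter> {x. ereal s < ereal x \<and> ereal x < ereal t} = seq_set (\<lambda>i. T i \<omega>)"
    using local_enumeration[of "ereal s" "ereal t"] st by auto
  \<comment> \<open>The default \<open>s\<close> lies outside the open interval, so coffin entries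
    contribute no point there.\<close>
  define V where "V \<omega> i = from_coffin s (T i \<omega>)" for \<omega> i
  have V: "V \<in> borel_measurable (inc_algebra (between (ereal s) (ereal t)))"
    unfolding V_def[abs_def]
    by (intro measurable_coordinatewise_then_product measurable_compose[OF T(1) measurable_from_coffin])
  have MV: "AE \<omega> in W. M \<omega> \<inter> {s<..<t} = range (V \<omega>) \<inter> {s<..<t}"
    using T(2)
  proof eventually_elim
    case (elim \<omega>)
    have M: "M \<omega> \<inter> {s<..<t} = seq_set (\<lambda>i. T i \<omega>)"
      unfolding elim[symmetric] by auto
    have "x \<in> seq_set (\<lambda>i. T i \<omega>)" if "x \<in> range (V \<omega>)" "x \<in> {s<..<t}" for x
    proof -
      obtain i where "x = from_coffin s (T i \<omega>)"
        using \<open>x \<in> range (V \<omega>)\<close> by (auto simp: V_def)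
      with \<open>x \<in> {s<..<t}\<close> have "T i \<omega> = Some x"
        by (cases "T i \<omega>") auto
      then show ?thesis
        by (auto simp: seq_set_def)
    qed
    moreover have "x \<in> range (V \<omega>)" if x: "x \<in> seq_set (\<lambda>i. T i \<omega>)" for x
    proof -
      obtain i where "T i \<omega> = Some x"
        using x unfolding seq_set_def by blast
      then have "V \<omega> i = x"
        by (simp add: V_def)
      then show ?thesis
        by blast
    qed
    moreover have "x \<in> {s<..<t}" if "x \<in> seq_set (\<lambda>i. T i \<omega>)" for x
      using that unfolding M[symmetric] by auto
    ultimately show ?case
      unfolding M by blast
  qed
  have UW: "U \<in> borel_measurable W" and VW: "V \<in> borel_measurable W"
    using U V by (auto intro: measurable_inc_algebra_W)
  define E' where "E' = E \<inter> (UNIV \<times> {s<..<t})"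
  have E' [measurable]: "E' \<in> sets (borel \<Otimes>\<^sub>M borel)"
    unfolding E'_def using E by (intro sets.Int pair_measureI) auto
  define m where "m x = emeasure lborel {y. (x, y) \<in> E'}" for x
  have [measurable]: "m \<in> borel_measurable borel"
  proof -
    have "E' \<in> sets (borel \<Otimes>\<^sub>M lborel)"
      using E' by (simp cong: sets_pair_measure_cong)
    then have "(\<lambda>x. emeasure lborel (Pair x -` E')) \<in> borel_measurable borel"
      by (rule lborel.measurable_emeasure_Pair)
    then show ?thesis
      by (simp add: m_def[abs_def] vimage_def)
  qed
  define Q where "Q z \<longleftrightarrow> (m (fst z) = 0 \<longrightarrow> (\<forall>i. (fst z, snd z i) \<notin> E')) \<and> (m (fst z) \<noteq> 0 \<longrightarrow> (\<exists>i. (fst z, snd z i) \<in> E'))"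
    for z :: "(nat \<Rightarrow> real) \<times> (nat \<Rightarrow> real)"
  have pr [measurable]: "(\<lambda>z. (fst z, snd z i)) \<in> measurable ((borel :: (nat \<Rightarrow> real) measure) \<Otimes>\<^sub>M (borel :: (nat \<Rightarrow> real) measure)) (borel \<Otimes>\<^sub>M borel)" for i
    by measurable
  have Q [measurable]: "Measurable.pred (borel \<Otimes>\<^sub>M borel) Q"
    unfolding Q_def[abs_def] by measurable
  define \<mu> \<nu> where "\<mu> = distr W borel U" and "\<nu> = distr W borel V"
  have \<mu>\<nu>: "prob_space \<mu>" "prob_space \<nu>"
    unfolding \<mu>_def \<nu>_def using UW VW by (auto intro: prob_space_distr)
  interpret \<mu>\<nu>: pair_prob_space \<mu> \<nu>
    using \<mu>\<nu> by (simp add: pair_prob_space_def pair_sigma_finite_def prob_space_imp_sigma_finite)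
  have sets_\<mu>\<nu>: "sets \<mu> = sets borel" "sets \<nu> = sets borel"
    by (simp_all add: \<mu>_def \<nu>_def)
  have "AE v in \<nu>. Q (x, v)" for x
  proof -
    define F where "F = {y. (x, y) \<in> E'}"
    have F [measurable]: "F \<in> sets borel"
      unfolding F_def using sets_Pair1[OF E', of x] by (simp add: vimage_def)
    have Fst: "F \<subseteq> {s<..<t}"
      by (auto simp: F_def E'_def)
    have "AE \<omega> in W. Q (x, V \<omega>)"
    proof (cases "m x = 0")
      case True
      then have "AE \<omega> in W. M \<omega> \<inter> F = {}"
        by (intro miss_null F) (simp add: m_def F_def)
      then show ?thesis
        using MV
      proof eventually_elim
        case (elim \<omega>)
        have "V \<omega> i \<notin> F" for i
          using elim Fst by blast
        then show ?case
          using True by (simp add: Q_def F_def)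
      qed
    next
      case False
      then have "AE \<omega> in W. M \<omega> \<inter> F \<noteq> {}"
        by (intro hit_positive F ne) (simp add: m_def F_def)
      then show ?thesis
        using MV
      proof eventually_elim
        case (elim \<omega>)
        then obtain z where z: "z \<in> M \<omega>" "z \<in> F"
          by blast
        then have "z \<in> range (V \<omega>)"
          using elim(2) Fst by blast
        with z obtain i where "V \<omega> i \<in> F"
          by blast
        then show ?case
          using False by (auto simp: Q_def F_def)
      qed
    qed
    moreover have "Measurable.pred borel (\<lambda>v. Q (x, v))"
      by measurable
    ultimately show ?thesis
      unfolding \<nu>_def by (subst AE_distr_iff[OF VW]) (auto simp: pred_def)
  qed
  moreover have "{z \<in> space (\<mu> \<Otimes>\<^sub>M \<nu>). Q z} \<in> sets (\<mu> \<Otimes>\<^sub>M \<nu>)"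
  proof -
    have "sets (\<mu> \<Otimes>\<^sub>M \<nu>) = sets ((borel :: (nat \<Rightarrow> real) measure) \<Otimes>\<^sub>M (borel :: (nat \<Rightarrow> real) measure))"
      by (intro sets_pair_measure_cong sets_\<mu>\<nu>)
    from this sets_eq_imp_space_eq[OF this] show ?thesis
      using Q by (simp only: pred_def)
  qed
  ultimately have "AE z in \<mu> \<Otimes>\<^sub>M \<nu>. Q z"
    by (intro \<mu>\<nu>.AE_pair_measure) auto
  moreover have "indep_var borel U borel V"
    using R by (intro indep_var_inc_algebra[OF _ R(2) U V]) (auto dest: between_le)
  then have "\<mu> \<Otimes>\<^sub>M \<nu> = distr W (borel \<Otimes>\<^sub>M borel) (\<lambda>\<omega>. (U \<omega>, V \<omega>))"
    unfolding indep_var_distribution_eq \<mu>_def \<nu>_def by blast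
  ultimately have "AE z in distr W (borel \<Otimes>\<^sub>M borel) (\<lambda>\<omega>. (U \<omega>, V \<omega>)). Q z"
    by metis
  moreover have "(\<lambda>\<omega>. (U \<omega>, V \<omega>)) \<in> measurable W (borel \<Otimes>\<^sub>M borel)"
    using UW VW by measurable
  ultimately have "AE \<omega> in W. Q (U \<omega>, V \<omega>)"
    using Q by (subst (asm) AE_distr_iff) (auto simp: pred_def)
  then show ?thesis
    using MV
  proof eventually_elim
    case (elim \<omega>)
    have m: "emeasure lborel {y. (U \<omega>, y) \<in> E \<and> y \<in> {s<..<t}} = m (U \<omega>)"
      by (simp add: m_def E'_def)
    have "(U \<omega>, y) \<notin> E" if y: "m (U \<omega>) = 0" "y \<in> M \<omega>" "y \<in> {s<..<t}" for y
    proof -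
      have "y \<in> range (V \<omega>)"
        using elim(2) y(2,3) by blast
      then obtain i where "y = V \<omega> i"
        by blast
      then show ?thesis
        using elim(1) y by (auto simp: Q_def E'_def)
    qed
    moreover have "\<exists>y\<in>M \<omega>. (U \<omega>, y) \<in> E" if m0: "m (U \<omega>) \<noteq> 0"
    proof -
      obtain i where i: "(U \<omega>, V \<omega> i) \<in> E'"
        using elim(1) m0 by (auto simp: Q_def)
      then have "V \<omega> i \<in> M \<omega>"
        using elim(2) unfolding E'_def by blast
      with i show ?thesis
        by (auto simp: E'_def)
    qed
    ultimately show ?case
      unfolding m by blast
  qed
qed

text \<open>The dichotomy for \<open>E = UNIV\<close> shows that \<open>M\<close> is almost surely
  nonempty; coffin entries can then be replaced by the first genuine point.\<close>

lemma real_enumeration: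
  assumes ne: "\<not> (AE \<omega> in W. M \<omega> = {})"
  obtains S :: "nat \<Rightarrow> (real \<Rightarrow> real) \<Rightarrow> real" where "\<forall>i. S i \<in> borel_measurable W" "AE \<omega> in W. M \<omega> = range (\<lambda>i. S i \<omega>)"
proof -
  obtain S where "\<forall>i. S i \<in> measurable W coffin_borel" "AE \<omega> in W. M \<omega> = seq_set (\<lambda>i. S i \<omega>)"
    by (rule enumeration)
  note S = this(1)[rule_format] this(2)
  note [measurable] = S(1)
  note [measurable] = pred_not_None[OF S(1)]
  define n where "n \<omega> = (LEAST i. S i \<omega> \<noteq> None)" for \<omega>
  have [measurable]: "n \<in> measurable W (count_space UNIV)"
    unfolding n_def[abs_def] by measurable
  have X [measurable]: "(\<lambda>\<omega>. from_coffin 0 (S i \<omega>)) \<in> borel_measurable W" for i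
    by measurable
  have [measurable]: "(\<lambda>\<omega>. from_coffin 0 (S (n \<omega>) \<omega>)) \<in> borel_measurable W"
    by (rule measurable_compose_countable[OF X]) simp
  define S' where "S' i \<omega> = (if S i \<omega> \<noteq> None then from_coffin 0 (S i \<omega>) else from_coffin 0 (S (n \<omega>) \<omega>))" for i \<omega>
  have "S' i \<in> borel_measurable W" for i
    unfolding S'_def[abs_def] by measurable
  moreover have "AE \<omega> in W. M \<omega> \<inter> UNIV \<noteq> {}"
    using ne by (intro hit_positive) (auto simp: emeasure_lborel_UNIV)
  then have "AE \<omega> in W. M \<omega> = range (\<lambda>i. S' i \<omega>)"
    using S(2)
  proof eventually_elim
    case (elim \<omega>)
    then obtain i where "S i \<omega> \<noteq> None"
      by (auto simp: seq_set_def)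
    then have n: "S (n \<omega>) \<omega> \<noteq> None"
      unfolding n_def by (rule LeastI)
    have "S' j \<omega> \<in> M \<omega>" for j
      unfolding elim(2) seq_set_def S'_def using n by (cases "S j \<omega>") auto
    moreover have "x \<in> range (\<lambda>i. S' i \<omega>)" if x: "x \<in> M \<omega>" for x
    proof -
      obtain j where "S j \<omega> = Some x"
        using x unfolding elim(2) seq_set_def by blast
      then have "S' j \<omega> = x"
        by (simp add: S'_def)
      then show ?thesis
        by blast
    qed
    ultimately show ?case
      by blast
  qed
  ultimately show thesis
    by (intro that[of S']) auto
qed

end

section \<open>Genericity and the zero-one law\<close>

lemma rat_interval_avoiding:
  assumes "finite F" "y \<notin> F"
  shows "\<exists>a b. rat_enum a < y \<and> y < rat_enum b \<and> (\<forall>x\<in>F. x < rat_enum a \<or> rat_enum b < x)"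
proof -
  obtain d where d: "d > 0" "\<And>x. x \<in> F \<Longrightarrow> x \<noteq> y \<Longrightarrow> d \<le> dist y x"
    using finite_set_avoid[OF assms(1), of y] by blast
  obtain a where a: "y - d < rat_enum a" "rat_enum a < y"
    using rat_enum_between[of "y - d" y] d(1) by auto
  obtain b where b: "y < rat_enum b" "rat_enum b < y + d"
    using rat_enum_between[of y "y + d"] d(1) by auto
  have "x < rat_enum a \<or> rat_enum b < x" if "x \<in> F" for x
  proof -
    have "d \<le> dist y x"
      using d(2)[OF that] that assms(2) by blast
    then show ?thesis
      using a b unfolding dist_real_def by linarith
  qed
  then show ?thesis
    using a b by blast
qed

context local_noise_set
begin

text \<open>The tuple is not independent of \<open>M\<close>, but the points of \<open>M\<close>
  inside a rational interval are independent of everything outside it. If the interval avoids the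
  tuple, the tuple consists of points of \<open>M\<close> outside and equals one of countably many
  tuples measurable with respect to the outside increments. Intervals avoiding the tuple cover all
  other reals.\<close>

lemma generic_real_enumeration:
  fixes S :: "nat \<Rightarrow> (real \<Rightarrow> real) \<Rightarrow> real"
  assumes ne: "\<not> (AE \<omega> in W. M \<omega> = {})" and MS: "AE \<omega> in W. M \<omega> = range (\<lambda>i. S i \<omega>)"
  shows "generic_enumeration W S"
  unfolding generic_enumeration_def
proof (intro allI ballI)
  fix "is" :: "nat list" and E :: "((nat \<Rightarrow> real) \<times> real) set"
  assume E: "E \<in> sets (borel \<Otimes>\<^sub>M borel)"
  define N where "N a b u \<longleftrightarrow> emeasure lborel {y. (u, y) \<in> E \<and> y \<in> {rat_enum a<..<rat_enum b}} = 0" for a b u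
  define good where "good a b \<omega> \<longleftrightarrow> rat_enum a < rat_enum b \<longrightarrow>
    (\<forall>r<length is. S (is ! r) \<omega> < rat_enum a \<or> rat_enum b < S (is ! r) \<omega>) \<longrightarrow>
    (N a b (tuple_of S is \<omega>) \<longrightarrow> (\<forall>y\<in>M \<omega>. y \<in> {rat_enum a<..<rat_enum b} \<longrightarrow> (tuple_of S is \<omega>, y) \<notin> E)) \<and>
    (\<not> N a b (tuple_of S is \<omega>) \<longrightarrow> (\<exists>y\<in>M \<omega>. (tuple_of S is \<omega>, y) \<in> E))" for a b \<omega>
  have "AE \<omega> in W. good a b \<omega>" for a b
  proof (cases "rat_enum a < rat_enum b")
    case lt: True
    let ?s = "rat_enum a" and ?t = "rat_enum b"
    let ?R = "between (- \<infinity>) (ereal ?s) \<union> between (ereal ?t) \<infinity>"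
    obtain T where T: "\<And>i. T i \<in> measurable (inc_algebra (between (- \<infinity>) (ereal ?s))) coffin_borel"
      "AE \<omega> in W. M \<omega> \<inter> {x. - \<infinity> < ereal x \<and> ereal x < ereal ?s} = seq_set (\<lambda>i. T i \<omega>)"
      using local_enumeration[of "- \<infinity>" "ereal ?s"] by auto
    obtain T' where T': "\<And>i. T' i \<in> measurable (inc_algebra (between (ereal ?t) \<infinity>)) coffin_borel"
      "AE \<omega> in W. M \<omega> \<inter> {x. ereal ?t < ereal x \<and> ereal x < \<infinity>} = seq_set (\<lambda>i. T' i \<omega>)"
      using local_enumeration[of "ereal ?t" "\<infinity>"] by auto
    \<comment> \<open>\<open>Z\<close> interleaves enumerations of \<open>M\<close> left and right
      of the interval. Default entries \<open>0\<close> are harmless: each relevant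
      \<open>S (is ! r)\<close> only has to occur among the \<open>Z i\<close>.\<close>
    define Z where "Z i \<omega> = from_coffin 0 (if even i then T (i div 2) \<omega> else T' (i div 2) \<omega>)" for i \<omega>
    have Z: "Z i \<in> borel_measurable (inc_algebra ?R)" for i
    proof (cases "even i")
      case True
      then show ?thesis
        using measurable_compose[OF measurable_inc_algebra_mono[OF T(1), of ?R] measurable_from_coffin]
        by (simp add: Z_def[abs_def])
    next
      case False
      then show ?thesis
        using measurable_compose[OF measurable_inc_algebra_mono[OF T'(1), of ?R] measurable_from_coffin]
        by (simp add: Z_def[abs_def])
    qed
    have R: "\<And>p. p \<in> ?R \<Longrightarrow> fst p \<le> snd p" "nonoverlapping ?R (between (ereal ?s) (ereal ?t))"
      unfolding nonoverlapping_def by (auto simp: between_def)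
    \<comment> \<open>The list of indices in \<open>Z\<close> representing the tuple varies with the
      outcome. There are only countably many lists, so all are treated at once.\<close>
    have "AE \<omega> in W. \<forall>\<kappa>.
        (N a b (tuple_of Z \<kappa> \<omega>) \<longrightarrow> (\<forall>y\<in>M \<omega>. y \<in> {?s<..<?t} \<longrightarrow> (tuple_of Z \<kappa> \<omega>, y) \<notin> E)) \<and>
        (\<not> N a b (tuple_of Z \<kappa> \<omega>) \<longrightarrow> (\<exists>y\<in>M \<omega>. (tuple_of Z \<kappa> \<omega>, y) \<in> E))"
      unfolding N_def
      by (subst AE_all_countable, intro allI hits_of_independent_set[OF lt ne R _ E] measurable_tuple_of Z)
    then show ?thesis
      using T(2) T'(2) MS
    proof eventually_elim
      case (elim \<omega>)
      show ?case
        unfolding good_def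
      proof (intro impI)
        assume out: "\<forall>r<length is. S (is ! r) \<omega> < ?s \<or> ?t < S (is ! r) \<omega>"
        have "\<exists>i. S (is ! r) \<omega> = Z i \<omega>" if "r < length is" for r
        proof -
          have "S (is ! r) \<omega> \<in> M \<omega>"
            unfolding elim(4) by blast
          from out that consider "S (is ! r) \<omega> < ?s" | "?t < S (is ! r) \<omega>"
            by blast
          then show ?thesis
          proof cases
            case 1
            then have "S (is ! r) \<omega> \<in> seq_set (\<lambda>i. T i \<omega>)"
              unfolding elim(2)[symmetric] using \<open>S (is ! r) \<omega> \<in> M \<omega>\<close> by simp
            then obtain i where "T i \<omega> = Some (S (is ! r) \<omega>)"
              unfolding seq_set_def by blast
            then show ?thesis
              by (intro exI[of _ "2 * i"]) (simp add: Z_def)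
          next
            case 2
            then have "S (is ! r) \<omega> \<in> seq_set (\<lambda>i. T' i \<omega>)"
              unfolding elim(3)[symmetric] using \<open>S (is ! r) \<omega> \<in> M \<omega>\<close> by simp
            then obtain i where "T' i \<omega> = Some (S (is ! r) \<omega>)"
              unfolding seq_set_def by blast
            then show ?thesis
              by (intro exI[of _ "2 * i + 1"]) (simp add: Z_def)
          qed
        qed
        then obtain k where k: "\<And>r. r < length is \<Longrightarrow> S (is ! r) \<omega> = Z (k r) \<omega>"
          by metis
        have "tuple_of S is \<omega> = tuple_of Z (map k [0..<length is]) \<omega>"
          using k by (auto simp: tuple_of_def fun_eq_iff)
        then show "(N a b (tuple_of S is \<omega>) \<longrightarrow> (\<forall>y\<in>M \<omega>. y \<in> {?s<..<?t} \<longrightarrow> (tuple_of S is \<omega>, y) \<notin> E)) \<and>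
            (\<not> N a b (tuple_of S is \<omega>) \<longrightarrow> (\<exists>y\<in>M \<omega>. (tuple_of S is \<omega>, y) \<in> E))"
          using elim(1) by simp
      qed
    qed
  qed (simp add: good_def)
  then have "AE \<omega> in W. \<forall>a b. good a b \<omega>"
    by (simp add: AE_all_countable)
  then show "AE \<omega> in W.
     (emeasure lborel {y. (tuple_of S is \<omega>, y) \<in> E} = 0 \<longrightarrow>
        (\<forall>i. (tuple_of S is \<omega>, S i \<omega>) \<in> E \<longrightarrow> (\<exists>r<length is. S i \<omega> = S (is ! r) \<omega>))) \<and>
     (emeasure lborel {y. (tuple_of S is \<omega>, y) \<in> E} \<noteq> 0 \<longrightarrow> (\<exists>i. (tuple_of S is \<omega>, S i \<omega>) \<in> E))"
    using MS
  proof eventually_elim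
    case (elim \<omega>)
    let ?u = "tuple_of S is \<omega>"
    let ?F = "{S (is ! r) \<omega> | r. r < length is}"
    have F: "finite ?F"
      by simp
    have E_u: "{y. (?u, y) \<in> E} \<in> sets lborel"
      using sets_Pair1[OF E, of ?u] by (simp add: vimage_def)
    have meas: "{y. (?u, y) \<in> E \<and> y \<in> {s<..<t}} \<in> sets lborel" for s t
    proof -
      have "{y. (?u, y) \<in> E \<and> y \<in> {s<..<t}} = {y. (?u, y) \<in> E} \<inter> {s<..<t}"
        by auto
      then show ?thesis
        using E_u by auto
    qed
    have "\<exists>r<length is. S i \<omega> = S (is ! r) \<omega>"
      if null: "emeasure lborel {y. (?u, y) \<in> E} = 0" and i: "(?u, S i \<omega>) \<in> E" for i
    proof (rule ccontr)
      assume "\<not> ?thesis"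
      then have "S i \<omega> \<notin> ?F"
        by auto
      then obtain a b where ab: "rat_enum a < S i \<omega>" "S i \<omega> < rat_enum b" "\<forall>x\<in>?F. x < rat_enum a \<or> rat_enum b < x"
        using rat_interval_avoiding[OF F] by blast
      have "emeasure lborel {y. (?u, y) \<in> E \<and> y \<in> {rat_enum a<..<rat_enum b}} \<le> emeasure lborel {y. (?u, y) \<in> E}"
        using E_u by (intro emeasure_mono) auto
      then have "N a b ?u"
        unfolding N_def using null by simp
      moreover have "S i \<omega> \<in> M \<omega>"
        unfolding elim(2) by blast
      ultimately have "(?u, S i \<omega>) \<notin> E"
        using elim(1)[rule_format, of a b] ab unfolding good_def by fastforce
      with i show False
        by blast
    qed
    moreover have "\<exists>i. (?u, S i \<omega>) \<in> E" if pos: "emeasure lborel {y. (?u, y) \<in> E} \<noteq> 0"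
    proof -
      \<comment> \<open>Countably many intervals that, together with the finite set of tuple points,
        cover the line: a non-null section meets one of them in a non-null set.\<close>
      define G where "G = {(a, b). rat_enum a < rat_enum b \<and> (\<forall>x\<in>?F. x < rat_enum a \<or> rat_enum b < x)}"
      have "\<exists>(a, b)\<in>G. \<not> N a b ?u"
      proof (rule ccontr)
        assume "\<not> ?thesis"
        then have "{y. (?u, y) \<in> E \<and> y \<in> {rat_enum (fst p)<..<rat_enum (snd p)}} \<in> null_sets lborel" if "p \<in> G" for p
          using that meas unfolding N_def null_sets_def by (cases p) auto
        then have "(\<Union>p\<in>G. {y. (?u, y) \<in> E \<and> y \<in> {rat_enum (fst p)<..<rat_enum (snd p)}}) \<in> null_sets lborel"
          by (intro null_sets_UN') auto
        moreover have "?F \<in> null_sets lborel"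
          using F by (rule finite_imp_null_set_lborel)
        ultimately have null: "?F \<union> (\<Union>p\<in>G. {y. (?u, y) \<in> E \<and> y \<in> {rat_enum (fst p)<..<rat_enum (snd p)}}) \<in> null_sets lborel"
          by (intro null_sets.Un)
        have "{y. (?u, y) \<in> E} \<subseteq> ?F \<union> (\<Union>p\<in>G. {y. (?u, y) \<in> E \<and> y \<in> {rat_enum (fst p)<..<rat_enum (snd p)}})"
        proof
          fix y assume y: "y \<in> {y. (?u, y) \<in> E}"
          show "y \<in> ?F \<union> (\<Union>p\<in>G. {y. (?u, y) \<in> E \<and> y \<in> {rat_enum (fst p)<..<rat_enum (snd p)}})"
          proof (cases "y \<in> ?F")
            case False
            then obtain a b where ab: "rat_enum a < y" "y < rat_enum b" "\<forall>x\<in>?F. x < rat_enum a \<or> rat_enum b < x"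
              using rat_interval_avoiding[OF F] by blast
            then have "(a, b) \<in> G"
              unfolding G_def by simp
            moreover have "y \<in> {y. (?u, y) \<in> E \<and> y \<in> {rat_enum (fst (a, b))<..<rat_enum (snd (a, b))}}"
              using ab y by simp
            ultimately show ?thesis
              by blast
          qed blast
        qed
        then have "{y. (?u, y) \<in> E} \<in> null_sets lborel"
          using null_sets_subset[OF null E_u] by blast
        with pos show False
          by auto
      qed
      then obtain a b where ab: "(a, b) \<in> G" "\<not> N a b ?u"
        by blast
      then obtain y where "y \<in> M \<omega>" "(?u, y) \<in> E"
        using elim(1)[rule_format, of a b] unfolding good_def G_def by fastforce
      then show ?thesis
        unfolding elim(2) by blast
    qed
    ultimately show ?case
      by blast
  qed
qed

theorem zero_one_law:
  assumes A: "{\<omega> \<in> space W. M \<omega> \<in> A} \<in> sets W"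
  shows "prob {\<omega> \<in> space W. M \<omega> \<in> A} \<in> {0, 1}"
proof (cases "AE \<omega> in W. M \<omega> = {}")
  case True
  show ?thesis
  proof (cases "{} \<in> A")
    case True
    have "AE \<omega> in W. \<omega> \<in> {\<omega> \<in> space W. M \<omega> \<in> A}"
      using \<open>AE \<omega> in W. M \<omega> = {}\<close> AE_space by eventually_elim (use True in auto)
    then show ?thesis
      using prob_eq_1[OF A] by simp
  next
    case False
    have "AE \<omega> in W. \<omega> \<notin> {\<omega> \<in> space W. M \<omega> \<in> A}"
      using \<open>AE \<omega> in W. M \<omega> = {}\<close> by eventually_elim (use False in auto)
    then show ?thesis
      using prob_eq_0[OF A] by simp
  qed
next
  case ne: False
  obtain S :: "nat \<Rightarrow> (real \<Rightarrow> real) \<Rightarrow> real" where "\<forall>i. S i \<in> borel_measurable W" and MS: "AE \<omega> in W. M \<omega> = range (\<lambda>i. S i \<omega>)"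
    using ne by (rule real_enumeration)
  note S = this(1)[rule_format]
  show ?thesis
  proof (rule ccontr)
    assume not01: "prob {\<omega> \<in> space W. M \<omega> \<in> A} \<notin> {0, 1}"
    obtain P where P: "two_sided_wiener_measure P" "W = completion P"
      by (rule wiener_base)
    then have P': "prob_space P" "sets P = sets path_borel"
      by (simp_all add: two_sided_wiener_measure_def)
    \<comment> \<open>The contradiction concerns two single outcomes, so the null set where
      \<open>S\<close> fails to enumerate \<open>M\<close> is removed from both events
      beforehand.\<close>
    obtain N where N: "N \<in> null_sets W" "{\<omega> \<in> space W. M \<omega> \<noteq> range (\<lambda>i. S i \<omega>)} \<subseteq> N"
      using MS unfolding eventually_ae_filter by blast
    define C where "C = {\<omega> \<in> space W. M \<omega> \<in> A} - N"
    define C' where "C' = space W - {\<omega> \<in> space W. M \<omega> \<in> A} - N"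
    have sets_C: "C \<in> sets W" "C' \<in> sets W"
      using A N(1) by (auto simp: C_def C'_def)
    have AE_N: "AE \<omega> in W. \<omega> \<notin> N"
      using N(1) by (rule AE_not_in)
    have pos: "\<not> (AE \<omega> in W. \<omega> \<notin> C)"
    proof
      assume "AE \<omega> in W. \<omega> \<notin> C"
      then have "AE \<omega> in W. \<omega> \<notin> {\<omega> \<in> space W. M \<omega> \<in> A}"
        using AE_N by eventually_elim (auto simp: C_def)
      then show False
        using prob_eq_0[OF A] not01 by simp
    qed
    have pos': "\<not> (AE \<omega> in W. \<omega> \<notin> C')"
    proof
      assume "AE \<omega> in W. \<omega> \<notin> C'"
      then have "AE \<omega> in W. \<omega> \<in> {\<omega> \<in> space W. M \<omega> \<in> A}"
        using AE_N AE_space by eventually_elim (auto simp: C'_def)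
      then show False
        using prob_eq_1[OF A] not01 by simp
    qed
    note coded = closed_set_of_coded_paths[OF P', folded P(2)]
    obtain K Q where K: "closed K" "Q \<in> sets W" "\<not> (AE \<omega> in W. \<omega> \<notin> Q)"
      "(\<lambda>\<omega> c. coded_path S c \<omega>) ` Q \<subseteq> K" "K \<subseteq> (\<lambda>\<omega> c. coded_path S c \<omega>) ` C"
      by (rule coded[where S = S, OF sets_C(1) pos S])
    obtain K' Q' where K': "closed K'" "Q' \<in> sets W" "\<not> (AE \<omega> in W. \<omega> \<notin> Q')"
      "(\<lambda>\<omega> c. coded_path S c \<omega>) ` Q' \<subseteq> K'" "K' \<subseteq> (\<lambda>\<omega> c. coded_path S c \<omega>) ` C'"
      by (rule coded[where S = S, OF sets_C(2) pos' S])
    have S_eq: "coded_path S (Suc (2 * i)) = S i" for i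
      by (simp add: fun_eq_iff coded_path_simps)
    have "coded_path S c \<in> borel_measurable W" for c
      unfolding coded_path_def[abs_def] using S by (cases "even c") auto
    moreover have "generic_enumeration W (\<lambda>i. coded_path S (Suc (2 * i)))"
      unfolding S_eq by (rule generic_real_enumeration[OF ne MS])
    ultimately obtain x y where x: "x \<in> closure ((\<lambda>\<omega> c. coded_path S c \<omega>) ` Q)"
      and y: "y \<in> closure ((\<lambda>\<omega> c. coded_path S c \<omega>) ` Q')"
      and xy: "\<forall>i. \<exists>j. x (Suc (2 * i)) = y (Suc (2 * j))" "\<forall>j. \<exists>i. x (Suc (2 * i)) = y (Suc (2 * j))"
      using fusion[where V = "coded_path S" and s = "\<lambda>i. Suc (2 * i)", OF _ _ K(2) K'(2) K(3) K'(3)] by blast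
    \<comment> \<open>The limits stay in the closed sets \<open>K\<close> and \<open>K'\<close>, all
      of whose members are codes of outcomes in \<open>C\<close> and \<open>C'\<close>.\<close>
    have "x \<in> K" "y \<in> K'"
      using x y closure_minimal[OF K(4,1)] closure_minimal[OF K'(4,1)] by blast+
    then obtain \<omega> \<omega>' where w: "\<omega> \<in> C" "(\<lambda>c. coded_path S c \<omega>) = x" and w': "\<omega>' \<in> C'" "(\<lambda>c. coded_path S c \<omega>') = y"
      using K(5) K'(5) by blast
    have "S i \<omega> = x (Suc (2 * i))" "S i \<omega>' = y (Suc (2 * i))" for i
      using w(2) w'(2) by (auto simp: coded_path_simps)
    then have "range (\<lambda>i. S i \<omega>) = range (\<lambda>i. S i \<omega>')"
      using xy by (auto simp: image_iff) metis
    moreover have "M \<omega> = range (\<lambda>i. S i \<omega>)" "M \<omega>' = range (\<lambda>i. S i \<omega>')"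
      using w(1) w'(1) N(2) unfolding C_def C'_def by blast+
    ultimately show False
      using w(1) w'(1) by (auto simp: C_def C'_def)
  qed
qed

end

theorem proposition3p19:
  fixes W :: "(real \<Rightarrow> real) measure"
    and M :: "(real \<Rightarrow> real) \<Rightarrow> real set"
    and A :: "real set set"
  assumes "completed_wiener_measure W"
    and "random_countable_set W M"
    and "local_random_set W M"
    and "stationary_in_law W M"
    and "{\<omega> \<in> space W. M \<omega> \<in> A} \<in> sets W"
  shows "measure W {\<omega> \<in> space W. M \<omega> \<in> A} \<in> {0, 1}"
proof -
  interpret local_noise_set W M
    using assms(1-4) by unfold_locales
  show ?thesis
    using assms(5) by (rule zero_one_law)
qed

end
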